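(* Let $A$ be a finite-type, connected, graded-commutative graded $\mathbb{Q}$-algebra, and let $k$ be a positive integer. Then $A$ is Koszul if and only if $$\mathrm{Hilb}\bigl(H_*\mathcal{L}(A[k],0),t\bigr)=\mathrm{Hilb}\bigl(\mathcal{H}_*(A)[k],t\bigr).$$
   Context: $\mathrm{Hilb}(V,t)=\sum_i\dim_{\mathbb{Q}}(V_i)\,t^i$ is the Hilbert series. $A$ is Koszul if $\mathrm{Tor}^A_{p,q}(\mathbb{Q},\mathbb{Q})=0$ for all $p\ne q$ ($p$ homological degree, $q$ internal degree). Rescaling: $A[k]^{p}=A^q$ if $p=q(2k+1)$ and $0$ otherwise, with the multiplication of $A$. For a Lie algebra with grading $L_*$, $L[k]_p=L_q$ if $p=2kq$ and $0$ otherwise, with the bracket of $L$. Quillen functor: for a finite-type, simply-connected (i.e. $B^0=\mathbb{Q}$, $B^1=0$) graded-commutative $\mathbb{Q}$-algebra $B$ with zero differential and augmentation ideal $\bar B$, $\mathcal{L}(B,0)$ is the differential graded Lie algebra $(\mathbb{L}(s^{-1}\,{}^{\sharp}\bar B),\partial)$: the free graded Lie algebra on the desuspended dual of $\bar B$ (the dual of $B^p$ placed in degree $p-1$), with $\partial$ the degree $-1$ Lie derivation whose restriction to generators takes values in brackets of length $2$ and is dual to the multiplication $\bar B\otimes\bar B\to\bar B$; explicitly, if the dual comultiplication is $\bar\Delta c=\sum c'_i\otimes c''_i$, then $\partial(s^{-1}c)=\tfrac12\sum(-1)^{|c'_i|}[s^{-1}c'_i,s^{-1}c''_i]$ (up to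 a global sign convention). Holonomy Lie algebra: let $A_q$ be the dual of $A^q$, and let $\nabla:A_2\to A_1\wedge A_1$ be the dual of the multiplication $A^1\wedge A^1\to A^2$. Then $\mathcal{H}_*(A)=\mathbb{L}^*(A_1)/\mathrm{ideal}(\mathrm{im}\,\nabla)$, where $\mathbb{L}^*(A_1)$ is the free Lie algebra on $A_1$ graded by bracket length, and $A_1\wedge A_1$ is identified with $\mathbb{L}^2(A_1)$. *)

theory Defs
  imports Complex_Main "HOL-Library.Function_Algebras"
    "HOL-Computational_Algebra.Formal_Power_Series"
begin

section \<open>Rational vector spaces of functions, subquotients, Hilbert series\<close>

definition fscale :: "rat \<Rightarrow> ('x \<Rightarrow> rat) \<Rightarrow> 'x \<Rightarrow> rat" where
  "fscale c f = (\<lambda>x. c * f x)"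

interpretation frat: vector_space "fscale :: rat \<Rightarrow> ('x \<Rightarrow> rat) \<Rightarrow> 'x \<Rightarrow> rat"
  by unfold_locales (auto simp: fscale_def fun_eq_iff algebra_simps)

text \<open>A pair \<open>(Z, B)\<close> of subspaces \<open>B \<subseteq> Z\<close> stands for the quotient vector space \<open>Z / B\<close>.\<close>

type_synonym 'x subquotient = "('x \<Rightarrow> rat) set \<times> ('x \<Rightarrow> rat) set"

definition sq_zero :: "'x subquotient \<Rightarrow> bool" where
  "sq_zero Q \<longleftrightarrow> fst Q \<subseteq> snd Q"

text \<open>Meaningful for finite-dimensional numerators only, which is the case of all the
  Hilbert series below.\<close>

definition sq_dim :: "'x subquotient \<Rightarrow> nat" where
  "sq_dim Q = frat.dim (fst Q) - frat.dim (snd Q)"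

definition hilb :: "(nat \<Rightarrow> 'x subquotient) \<Rightarrow> int fps" where
  "hilb Q = Abs_fps (\<lambda>i. int (sq_dim (Q i)))"


section \<open>Graded algebras\<close>

text \<open>The whole type \<open>'a\<close> is the direct sum of the subspaces \<open>A n\<close>.\<close>

locale graded_algebra = vector_space scale
  for scale :: "rat \<Rightarrow> 'a::ring_1 \<Rightarrow> 'a" +
  fixes A :: "nat \<Rightarrow> 'a set"
  assumes scale_mult_left: "scale c x * y = scale c (x * y)"
    and scale_mult_right: "x * scale c y = scale c (x * y)"
    and subspace_component: "subspace (A n)"
    and one_in_component: "1 \<in> A 0"
    and mult_in_component: "x \<in> A m \<Longrightarrow> y \<in> A n \<Longrightarrow> x * y \<in> A (m + n)"
    and homogeneous_decomposition:
      "\<exists>!f. (\<forall>n. f n \<in> A n) \<and> finite {n. f n \<noteq> 0} \<and> x = (\<Sum>n | f n \<noteq> 0. f n)"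

definition finite_type :: "(rat \<Rightarrow> 'a::ring_1 \<Rightarrow> 'a) \<Rightarrow> (nat \<Rightarrow> 'a set) \<Rightarrow> bool" where
  "finite_type scale A \<longleftrightarrow> (\<forall>n. \<exists>S. finite S \<and> A n = module.span scale S)"

definition connected_algebra :: "(rat \<Rightarrow> 'a::ring_1 \<Rightarrow> 'a) \<Rightarrow> (nat \<Rightarrow> 'a set) \<Rightarrow> bool" where
  "connected_algebra scale A \<longleftrightarrow> A 0 = range (\<lambda>c. scale c 1)"

definition graded_commutative :: "(nat \<Rightarrow> 'a::ring_1 set) \<Rightarrow> bool" where
  "graded_commutative A \<longleftrightarrow>
     (\<forall>m n. \<forall>x\<in>A m. \<forall>y\<in>A n. x * y = (-1) ^ (m * n) * (y * x))"

definition aug_ideal :: "(rat \<Rightarrow> 'a::ring_1 \<Rightarrow> 'a) \<Rightarrow> (nat \<Rightarrow> 'a set) \<Rightarrow> 'a set" where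
  "aug_ideal scale A = module.span scale (\<Union>n. A (Suc n))"

definition rescale_algebra :: "nat \<Rightarrow> (nat \<Rightarrow> 'a::ring_1 set) \<Rightarrow> nat \<Rightarrow> 'a set" where
  "rescale_algebra k A p = (if (2 * k + 1) dvd p then A (p div (2 * k + 1)) else {0})"

text \<open>The dual of \<open>A p\<close>, as the functionals on \<open>'a\<close> that vanish on the other components.\<close>

definition graded_dual ::
    "(rat \<Rightarrow> 'a::ring_1 \<Rightarrow> 'a) \<Rightarrow> (nat \<Rightarrow> 'a set) \<Rightarrow> nat \<Rightarrow> ('a \<Rightarrow> rat) set" where
  "graded_dual scale A p =
     {f. Vector_Spaces.linear scale (*) f \<and> (\<forall>q. q \<noteq> p \<longrightarrow> (\<forall>x\<in>A q. f x = 0))}"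


section \<open>The Koszul property\<close>

text \<open>Elements of the free vector space on words are finitely supported functions.
  It becomes the tensor algebra of the vector space \<open>'a\<close> after dividing by the
  multilinearity relations; the word \<open>[x\<^sub>1, \<dots>, x\<^sub>n]\<close> is \<open>x\<^sub>1 \<otimes> \<dots> \<otimes> x\<^sub>n\<close>.\<close>

definition word :: "'a list \<Rightarrow> 'a list \<Rightarrow> rat" where
  "word w = (\<lambda>v. if v = w then 1 else 0)"

definition multilinearity ::
    "(rat \<Rightarrow> 'a::ring_1 \<Rightarrow> 'a) \<Rightarrow> ('a list \<Rightarrow> rat) set" where
  "multilinearity scale =
     {word (us @ (x + y) # vs) - word (us @ x # vs) - word (us @ y # vs) | us vs x y. True} \<union>
     {word (us @ scale c x # vs) - fscale c (word (us @ x # vs)) | us vs c x. True}"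

text \<open>Normalized bar resolution of the trivial left module, in homological degree \<open>p\<close>:
  \<open>A \<otimes> \<bar>A\<otimes>\<dots>\<otimes>\<bar>A\<close> with \<open>p\<close> factors \<open>\<bar>A\<close> (the augmentation ideal), the word
  \<open>x\<^sub>0 # [x\<^sub>1, \<dots>, x\<^sub>p]\<close> being \<open>x\<^sub>0[x\<^sub>1|\<dots>|x\<^sub>p]\<close>. Applying the functor \<open>\<rat> \<otimes>\<^sub>A _\<close> amounts to
  dividing by the words whose head \<open>x\<^sub>0\<close> has positive degree. The index \<open>m\<close> bounds the
  degree of the head from below, \<open>q\<close> is the internal degree.\<close>

definition bar_words :: "(nat \<Rightarrow> 'a::ring_1 set) \<Rightarrow> nat \<Rightarrow> nat \<Rightarrow> nat \<Rightarrow> 'a list set" where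
  "bar_words A m p q =
     {x # xs | x xs. length xs = p \<and>
        (\<exists>d ds. m \<le> d \<and> x \<in> A d \<and> list_all2 (\<lambda>y e. 1 \<le> e \<and> y \<in> A e) xs ds \<and>
                q = d + sum_list ds)}"

definition bar_chains ::
    "(rat \<Rightarrow> 'a::ring_1 \<Rightarrow> 'a) \<Rightarrow> (nat \<Rightarrow> 'a set) \<Rightarrow> nat \<Rightarrow> nat \<Rightarrow> ('a list \<Rightarrow> rat) set" where
  "bar_chains scale A p q = frat.span (word ` bar_words A 0 p q \<union> multilinearity scale)"

definition bar_null ::
    "(rat \<Rightarrow> 'a::ring_1 \<Rightarrow> 'a) \<Rightarrow> (nat \<Rightarrow> 'a set) \<Rightarrow> nat \<Rightarrow> nat \<Rightarrow> ('a list \<Rightarrow> rat) set" where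
  "bar_null scale A p q = frat.span (word ` bar_words A 1 p q \<union> multilinearity scale)"

text \<open>The last face, in which \<open>x\<^sub>p\<close> acts on the trivial module, vanishes.\<close>

definition bar_d_word :: "'a::ring_1 list \<Rightarrow> 'a list \<Rightarrow> rat" where
  "bar_d_word w = (\<Sum>i<length w - 1. fscale ((-1) ^ i)
     (word (take i w @ (w ! i * w ! Suc i) # drop (i + 2) w)))"

definition bar_d :: "('a::ring_1 list \<Rightarrow> rat) \<Rightarrow> 'a list \<Rightarrow> rat" where
  "bar_d z = (\<Sum>w | z w \<noteq> 0. fscale (z w) (bar_d_word w))"

text \<open>\<open>tor scale A p q\<close> is the internal degree \<open>q\<close> part of the \<open>p\<close>-th homology of
  \<open>\<rat> \<otimes>\<^sub>A P\<close>, where \<open>P\<close> is the bar resolution.\<close>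

definition tor ::
    "(rat \<Rightarrow> 'a::ring_1 \<Rightarrow> 'a) \<Rightarrow> (nat \<Rightarrow> 'a set) \<Rightarrow> nat \<Rightarrow> nat \<Rightarrow> 'a list subquotient" where
  "tor scale A p q =
     ({z \<in> bar_chains scale A p q. p = 0 \<or> bar_d z \<in> bar_null scale A (p - 1) q},
      {bar_d z + n | z n. z \<in> bar_chains scale A (Suc p) q \<and> n \<in> bar_null scale A p q})"

definition koszul :: "(rat \<Rightarrow> 'a::ring_1 \<Rightarrow> 'a) \<Rightarrow> (nat \<Rightarrow> 'a set) \<Rightarrow> bool" where
  "koszul scale A \<longleftrightarrow> (\<forall>p q. p \<noteq> q \<longrightarrow> sq_zero (tor scale A p q))"


section \<open>Free Lie algebras\<close>

text \<open>For a vector space \<open>V\<close> of functions \<open>'x \<Rightarrow> rat\<close>, the tensor algebra \<open>T(V)\<close> is realized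
  inside the functions on words: \<open>f\<^sub>1 \<otimes> \<dots> \<otimes> f\<^sub>n\<close> is the function
  \<open>[x\<^sub>1, \<dots>, x\<^sub>n] \<mapsto> f\<^sub>1 x\<^sub>1 * \<dots> * f\<^sub>n x\<^sub>n\<close>, which is zero on words of other lengths. \<open>gen\<close> is
  the inclusion of \<open>V\<close> and \<open>tmul\<close> is the product of \<open>T(V)\<close>.\<close>

definition gen :: "('x \<Rightarrow> rat) \<Rightarrow> 'x list \<Rightarrow> rat" where
  "gen f = (\<lambda>w. case w of [x] \<Rightarrow> f x | _ \<Rightarrow> 0)"

definition tmul :: "('x list \<Rightarrow> rat) \<Rightarrow> ('x list \<Rightarrow> rat) \<Rightarrow> 'x list \<Rightarrow> rat" where
  "tmul F G = (\<lambda>w. \<Sum>i\<le>length w. F (take i w) * G (drop i w))"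

text \<open>Graded commutator of elements of degrees \<open>m\<close> and \<open>n\<close>; plain commutator.\<close>

definition gr_bracket ::
    "nat \<Rightarrow> nat \<Rightarrow> ('x list \<Rightarrow> rat) \<Rightarrow> ('x list \<Rightarrow> rat) \<Rightarrow> 'x list \<Rightarrow> rat" where
  "gr_bracket m n F G = tmul F G - fscale ((-1) ^ (m * n)) (tmul G F)"

definition bracket :: "('x list \<Rightarrow> rat) \<Rightarrow> ('x list \<Rightarrow> rat) \<Rightarrow> 'x list \<Rightarrow> rat" where
  "bracket F G = tmul F G - tmul G F"

text \<open>The free (graded) Lie algebra on \<open>V\<close> is the (graded) Lie subalgebra of \<open>T(V)\<close> generated
  by \<open>V\<close> (over a field of characteristic zero this subalgebra is free on \<open>V\<close>).
  \<open>free_gr_lie V n\<close> is its component of degree \<open>n\<close>, for a graded \<open>V\<close>;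
  \<open>free_lie V n\<close> is its component of bracket length \<open>n\<close>, for an ungraded \<open>V\<close>.\<close>

inductive_set lie_closure ::
    "(nat \<Rightarrow> nat \<Rightarrow> ('x list \<Rightarrow> rat) \<Rightarrow> ('x list \<Rightarrow> rat) \<Rightarrow> 'x list \<Rightarrow> rat) \<Rightarrow>
     (nat \<times> ('x list \<Rightarrow> rat)) set \<Rightarrow> (nat \<times> ('x list \<Rightarrow> rat)) set"
  for br S where
  base: "(n, x) \<in> S \<Longrightarrow> (n, x) \<in> lie_closure br S"
| zero: "(n, 0) \<in> lie_closure br S"
| add: "(n, x) \<in> lie_closure br S \<Longrightarrow> (n, y) \<in> lie_closure br S \<Longrightarrow>
    (n, x + y) \<in> lie_closure br S"
| scale: "(n, x) \<in> lie_closure br S \<Longrightarrow> (n, fscale c x) \<in> lie_closure br S"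
| bracket: "(m, x) \<in> lie_closure br S \<Longrightarrow> (n, y) \<in> lie_closure br S \<Longrightarrow>
    (m + n, br m n x y) \<in> lie_closure br S"

definition free_gr_lie :: "(nat \<Rightarrow> ('x \<Rightarrow> rat) set) \<Rightarrow> nat \<Rightarrow> ('x list \<Rightarrow> rat) set" where
  "free_gr_lie V n = {x. (n, x) \<in> lie_closure gr_bracket {(m, gen f) | m f. f \<in> V m}}"

definition free_lie :: "('x \<Rightarrow> rat) set \<Rightarrow> nat \<Rightarrow> ('x list \<Rightarrow> rat) set" where
  "free_lie V n = {x. (n, x) \<in> lie_closure (\<lambda>_ _. bracket) {(1, gen f) | f. f \<in> V}}"


section \<open>The Quillen functor\<close>

text \<open>Component of degree \<open>n\<close>: the generators are the dual of \<open>B (n + 1)\<close> in degree \<open>n\<close>.\<close>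

definition quillen_lie ::
    "(rat \<Rightarrow> 'a::ring_1 \<Rightarrow> 'a) \<Rightarrow> (nat \<Rightarrow> 'a set) \<Rightarrow> nat \<Rightarrow> ('a list \<Rightarrow> rat) set" where
  "quillen_lie scale B = free_gr_lie (\<lambda>n. graded_dual scale B (Suc n))"

text \<open>\<open>\<Sum>i<N. c' i \<otimes> c'' i\<close> is the reduced coproduct of \<open>c\<close>, where \<open>c' i\<close> and \<open>c'' i\<close> are
  homogeneous of degrees \<open>p' i\<close> and \<open>p'' i\<close>.\<close>

definition reduced_coproduct ::
    "(rat \<Rightarrow> 'a::ring_1 \<Rightarrow> 'a) \<Rightarrow> (nat \<Rightarrow> 'a set) \<Rightarrow> ('a \<Rightarrow> rat) \<Rightarrow> nat \<Rightarrow>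
     (nat \<Rightarrow> nat) \<Rightarrow> (nat \<Rightarrow> 'a \<Rightarrow> rat) \<Rightarrow> (nat \<Rightarrow> nat) \<Rightarrow> (nat \<Rightarrow> 'a \<Rightarrow> rat) \<Rightarrow> bool" where
  "reduced_coproduct scale B c N p' c' p'' c'' \<longleftrightarrow>
     (\<forall>i<N. 1 \<le> p' i \<and> c' i \<in> graded_dual scale B (p' i) \<and>
            1 \<le> p'' i \<and> c'' i \<in> graded_dual scale B (p'' i)) \<and>
     (\<forall>x\<in>aug_ideal scale B. \<forall>y\<in>aug_ideal scale B. c (x * y) = (\<Sum>i<N. c' i x * c'' i y))"

definition quillen_differential ::
    "(rat \<Rightarrow> 'a::ring_1 \<Rightarrow> 'a) \<Rightarrow> (nat \<Rightarrow> 'a set) \<Rightarrow>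
     (('a list \<Rightarrow> rat) \<Rightarrow> 'a list \<Rightarrow> rat) \<Rightarrow> bool" where
  "quillen_differential scale B D \<longleftrightarrow>
     (let L = quillen_lie scale B in
       (\<forall>n. \<forall>x\<in>L n. \<forall>y\<in>L n. \<forall>c. D (x + y) = D x + D y \<and> D (fscale c x) = fscale c (D x)) \<and>
       (\<forall>x\<in>L 0. D x = 0) \<and> (\<forall>n. \<forall>x\<in>L (Suc n). D x \<in> L n) \<and>
       (\<forall>m n. \<forall>x\<in>L m. \<forall>y\<in>L n. D (gr_bracket m n x y) =
          gr_bracket (m - 1) n (D x) y + fscale ((-1) ^ m) (gr_bracket m (n - 1) x (D y))) \<and>
       (\<forall>p\<ge>1. \<forall>c\<in>graded_dual scale B p. \<forall>N p' c' p'' c''.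
          reduced_coproduct scale B c N p' c' p'' c'' \<longrightarrow>
          D (gen c) = fscale (1/2) (\<Sum>i<N. fscale ((-1) ^ p' i)
            (gr_bracket (p' i - 1) (p'' i - 1) (gen (c' i)) (gen (c'' i))))))"

definition quillen_d ::
    "(rat \<Rightarrow> 'a::ring_1 \<Rightarrow> 'a) \<Rightarrow> (nat \<Rightarrow> 'a set) \<Rightarrow> ('a list \<Rightarrow> rat) \<Rightarrow> 'a list \<Rightarrow> rat" where
  "quillen_d scale B = (SOME D. quillen_differential scale B D)"

definition quillen_homology ::
    "(rat \<Rightarrow> 'a::ring_1 \<Rightarrow> 'a) \<Rightarrow> (nat \<Rightarrow> 'a set) \<Rightarrow> nat \<Rightarrow> 'a list subquotient" where
  "quillen_homology scale B n =
     ({x \<in> quillen_lie scale B n. quillen_d scale B x = 0},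
      quillen_d scale B ` quillen_lie scale B (Suc n))"


section \<open>The holonomy Lie algebra\<close>

text \<open>The image of \<open>\<nabla>\<close> in bracket length \<open>2\<close>. An element \<open>\<Sum>i<N. a i \<and> b i\<close> of the exterior square
  of the dual of \<open>A 1\<close> pairs with \<open>x \<and> y\<close> to the sum over \<open>i\<close> of the determinants
  \<open>a i x * b i y - a i y * b i x\<close>; it is identified with \<open>\<Sum>i<N. [a i, b i]\<close>.\<close>

definition nabla_image ::
    "(rat \<Rightarrow> 'a::ring_1 \<Rightarrow> 'a) \<Rightarrow> (nat \<Rightarrow> 'a set) \<Rightarrow> ('a list \<Rightarrow> rat) set" where
  "nabla_image scale A =
     {\<Sum>i<N. bracket (gen (a i)) (gen (b i)) | N a b.
        (\<forall>i<N::nat. a i \<in> graded_dual scale A 1 \<and> b i \<in> graded_dual scale A 1) \<and>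
        (\<exists>c\<in>graded_dual scale A 2. \<forall>x\<in>A 1. \<forall>y\<in>A 1.
           c (x * y) = (\<Sum>i<N. a i x * b i y - a i y * b i x))}"

text \<open>Component of bracket length \<open>n\<close> of the ideal of \<open>free_lie V\<close> generated by a set \<open>R\<close> of
  elements of bracket length \<open>2\<close>.\<close>

inductive_set lie_ideal ::
    "('x \<Rightarrow> rat) set \<Rightarrow> ('x list \<Rightarrow> rat) set \<Rightarrow> (nat \<times> ('x list \<Rightarrow> rat)) set"
  for V R where
  base: "r \<in> R \<Longrightarrow> (2, r) \<in> lie_ideal V R"
| zero: "(n, 0) \<in> lie_ideal V R"
| add: "(n, x) \<in> lie_ideal V R \<Longrightarrow> (n, y) \<in> lie_ideal V R \<Longrightarrow> (n, x + y) \<in> lie_ideal V R"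
| scale: "(n, x) \<in> lie_ideal V R \<Longrightarrow> (n, fscale c x) \<in> lie_ideal V R"
| bracket: "x \<in> free_lie V m \<Longrightarrow> (n, y) \<in> lie_ideal V R \<Longrightarrow>
    (m + n, bracket x y) \<in> lie_ideal V R"

definition holonomy ::
    "(rat \<Rightarrow> 'a::ring_1 \<Rightarrow> 'a) \<Rightarrow> (nat \<Rightarrow> 'a set) \<Rightarrow> nat \<Rightarrow> 'a list subquotient" where
  "holonomy scale A n =
     (free_lie (graded_dual scale A 1) n,
      {x. (n, x) \<in> lie_ideal (graded_dual scale A 1) (nabla_image scale A)})"

definition rescale_lie :: "nat \<Rightarrow> (nat \<Rightarrow> 'x subquotient) \<Rightarrow> nat \<Rightarrow> 'x subquotient" where
  "rescale_lie k L p = (if (2 * k) dvd p then L (p div (2 * k)) else ({0}, {0}))"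


section \<open>Existence of the Quillen differential\<close>

text \<open>\<open>quillen_differential\<close> determines \<open>D\<close> on the components of \<open>quillen_lie\<close>, since they are
  generated by brackets of the generators. Here we show that such a \<open>D\<close> exists, so that the
  choice made by \<open>quillen_d\<close> is a correct one. On words of homogeneous letters \<open>D\<close> is given by
  \<open>D F [x\<^sub>1, \<dots>, x\<^sub>n] = (\<Sum>1\<le>i<n. \<plusminus> F [x\<^sub>1, \<dots>, x\<^sub>i * x\<^sub>i\<^sub>+\<^sub>1, \<dots>, x\<^sub>n])\<close>, with the sign \<open>-1\<close> to the power
  \<open>(|x\<^sub>1| - 1) + \<dots> + (|x\<^sub>i\<^sub>-\<^sub>1| - 1) + |x\<^sub>i|\<close>.\<close>

fun dexp :: "('x \<Rightarrow> 'x \<Rightarrow> 'x) \<Rightarrow> ('x \<Rightarrow> 'x) \<Rightarrow> ('x list \<Rightarrow> rat) \<Rightarrow> 'x list \<Rightarrow> rat" where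
  "dexp m s F (x # y # v) = F (m x y # v) + dexp m s (\<lambda>u. F (s x # u)) (y # v)"
| "dexp m s F v = 0"

lemma dexp_add: "dexp m s (F + G) v = dexp m s F v + dexp m s G v"
proof (induction m s F v arbitrary: G rule: dexp.induct)
  case (1 m s F x y v)
  then show ?case using 1[of "\<lambda>u. G (s x # u)"] by (simp add: plus_fun_def)
qed auto

lemma dexp_scale: "dexp m s (fscale c F) v = c * dexp m s F v"
  by (induction m s F v rule: dexp.induct) (auto simp: fscale_def algebra_simps)

lemma dexp_cmul: "dexp m s (\<lambda>u. c * F u) v = c * dexp m s F v"
  using dexp_scale[of m s c F v] by (simp add: fscale_def)

lemma tmul_Cons: "tmul F G (x # v) = F [] * G (x # v) + tmul (\<lambda>u. F (x # u)) G v"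
  unfolding tmul_def by (simp add: sum.atMost_Suc_shift del: sum.atMost_Suc)

lemma tmul_Nil: "tmul F G [] = F [] * G []"
  by (simp add: tmul_def)

lemma tmul_add_left: "tmul (F + F') G = tmul F G + tmul F' G"
  by (auto simp: tmul_def fun_eq_iff sum.distrib algebra_simps)
lemma tmul_add_right: "tmul F (G + G') = tmul F G + tmul F G'"
  by (auto simp: tmul_def fun_eq_iff sum.distrib algebra_simps)
lemma tmul_scale_left: "tmul (fscale c F) G = fscale c (tmul F G)"
  by (auto simp: tmul_def fscale_def fun_eq_iff sum_distrib_left algebra_simps)
lemma tmul_scale_right: "tmul F (fscale c G) = fscale c (tmul F G)"
  by (auto simp: tmul_def fscale_def fun_eq_iff sum_distrib_left algebra_simps)
lemma tmul_zero_left: "tmul 0 G = 0" by (auto simp: tmul_def fun_eq_iff)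
lemma tmul_zero_right: "tmul F 0 = 0" by (auto simp: tmul_def fun_eq_iff)

lemma dexp_tmul:
  "dexp m s (tmul F G) v = tmul (dexp m s F) G v + tmul (F \<circ> map s) (dexp m s G) v"
proof (induction v arbitrary: F rule: length_induct)
  case (1 v)
  show ?case
  proof (cases v rule: list.exhaust)
    case Nil then show ?thesis by (simp add: tmul_Nil)
  next
    case (Cons x v')
    show ?thesis
    proof (cases v')
      case Nil then show ?thesis using Cons by (simp add: tmul_Cons tmul_Nil)
    next
      case Cons': (Cons y w)
      let ?Fx = "\<lambda>u. F (s x # u)"
      have IH: "dexp m s (tmul ?Fx G) (y # w) =
          tmul (dexp m s ?Fx) G (y # w) + tmul (?Fx \<circ> map s) (dexp m s G) (y # w)"
        by (rule 1[rule_format]) (simp add: Cons Cons')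
      have e: "(\<lambda>u. tmul F G (s x # u)) =
          (\<lambda>u. F [] * G (s x # u)) + tmul ?Fx G"
        by (auto simp: tmul_Cons fun_eq_iff)
      have a: "dexp m s (tmul F G) (x # y # w) =
          F [] * G (m x y # w) + tmul (\<lambda>u. F (m x y # u)) G w
          + F [] * dexp m s (\<lambda>u. G (s x # u)) (y # w) + dexp m s (tmul ?Fx G) (y # w)"
        by (simp only: dexp.simps e dexp_add dexp_cmul) (simp add: tmul_Cons)
      have b: "tmul (dexp m s F) G (x # y # w) =
         tmul (\<lambda>u. F (m x y # u)) G w + tmul (\<lambda>u. dexp m s ?Fx (y # u)) G w"
      proof -
        have "(\<lambda>u. dexp m s F (x # y # u)) =
            (\<lambda>u. F (m x y # u)) + (\<lambda>u. dexp m s ?Fx (y # u))"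
          by (auto simp: fun_eq_iff)
        then show ?thesis
          by (simp only: tmul_Cons tmul_add_left dexp.simps) (simp add: plus_fun_def)
      qed
      have c: "tmul (dexp m s ?Fx) G (y # w) = tmul (\<lambda>u. dexp m s ?Fx (y # u)) G w"
        by (simp add: tmul_Cons)
      have d: "tmul (F \<circ> map s) (dexp m s G) (x # y # w) =
         F [] * (G (m x y # w) + dexp m s (\<lambda>u. G (s x # u)) (y # w))
         + tmul (?Fx \<circ> map s) (dexp m s G) (y # w)"
      proof -
        have "(\<lambda>u. (F \<circ> map s) (x # u)) = ?Fx \<circ> map s" by auto
        then show ?thesis by (subst tmul_Cons) simp
      qed
      show ?thesis unfolding Cons Cons' a IH b d c by (simp add: algebra_simps)
    qed
  qed
qed

lemma tmul_map: "tmul F G \<circ> map s = tmul (F \<circ> map s) (G \<circ> map s)"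
  by (auto simp: tmul_def fun_eq_iff take_map drop_map)

lemma gen_Cons: "gen f (x # u) = (if u = [] then f x else 0)" "gen f [] = 0"
  by (auto simp: gen_def split: list.splits)

lemma tmul_unit: "tmul (\<lambda>u. if u = [] then c else 0) G v = c * G v"
  by (cases v) (auto simp: tmul_Nil tmul_Cons, auto simp: tmul_def)

lemma tmul_gen: "tmul (gen f) (gen g) w = (case w of [x, y] \<Rightarrow> f x * g y | _ \<Rightarrow> 0)"
  by (cases w) (auto simp: tmul_Nil tmul_Cons gen_Cons tmul_unit split: list.splits)

lemma dexp_unit: "dexp m s (\<lambda>u. if u = [] then c else 0) v = 0"
proof -
  have z: "dexp m s (\<lambda>u. 0) v = 0" for s v
    using dexp_scale[of m s 0 "\<lambda>_. 0" v] by (simp add: fscale_def)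
  show ?thesis by (cases v; cases "tl v") (auto simp: z)
qed

context graded_algebra begin

definition cmp :: "'a \<Rightarrow> nat \<Rightarrow> 'a" where
  "cmp x = (THE f. (\<forall>n. f n \<in> A n) \<and> finite {n. f n \<noteq> 0} \<and> x = (\<Sum>n | f n \<noteq> 0. f n))"

lemma cmp: "cmp x n \<in> A n" "finite {n. cmp x n \<noteq> 0}" "x = (\<Sum>n | cmp x n \<noteq> 0. cmp x n)"
  using theI'[OF homogeneous_decomposition[of x]] unfolding cmp_def by auto

lemma cmp_eqI:
  assumes "\<And>n. f n \<in> A n" "finite S" "\<And>n. n \<notin> S \<Longrightarrow> f n = 0" "x = sum f S"
  shows "cmp x = f"
proof -
  have *: "{n. f n \<noteq> 0} \<subseteq> S" using assms by auto
  then have "x = (\<Sum>n | f n \<noteq> 0. f n)"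
    using assms by (auto intro!: sum.mono_neutral_cong_right)
  then show ?thesis
    unfolding cmp_def using assms * homogeneous_decomposition[of x]
    by (intro the1_equality) (auto intro: finite_subset)
qed

lemma A0[simp]: "0 \<in> A n" using subspace_component subspace_0 by blast
lemma A_scale: "x \<in> A n \<Longrightarrow> scale c x \<in> A n" using subspace_component subspace_scale by blast
lemma A_add: "x \<in> A n \<Longrightarrow> y \<in> A n \<Longrightarrow> x + y \<in> A n" using subspace_component subspace_add by blast

lemma cmp_hom: "x \<in> A n \<Longrightarrow> cmp x = (\<lambda>m. if m = n then x else 0)"
  by (rule cmp_eqI[where S="{n}"]) auto

lemma cmp_sum: "finite S \<Longrightarrow> {n. cmp x n \<noteq> 0} \<subseteq> S \<Longrightarrow> x = sum (cmp x) S"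
  by (rule trans[OF cmp(3)[of x]]) (auto intro: sum.mono_neutral_left)

lemma cmp_add: "cmp (x + y) = (\<lambda>n. cmp x n + cmp y n)"
proof (rule cmp_eqI[where S="{n. cmp x n \<noteq> 0} \<union> {n. cmp y n \<noteq> 0}"])
  let ?S = "{n. cmp x n \<noteq> 0} \<union> {n. cmp y n \<noteq> 0}"
  have "x = sum (cmp x) ?S" "y = sum (cmp y) ?S" using cmp(2) by (auto intro!: cmp_sum)
  then have "x + y = sum (cmp x) ?S + sum (cmp y) ?S" by (rule arg_cong2)
  then show "x + y = (\<Sum>n\<in>?S. cmp x n + cmp y n)" by (simp only: sum.distrib)
qed (auto simp: cmp A_add)

lemma cmp_scale: "cmp (scale c x) = (\<lambda>n. scale c (cmp x n))"
proof (rule cmp_eqI[where S="{n. cmp x n \<noteq> 0}"])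
  show "scale c x = (\<Sum>n | cmp x n \<noteq> 0. scale c (cmp x n))"
    using arg_cong[OF cmp(3)[of x], of "scale c"] by (simp only: scale_sum_right)
qed (auto simp: cmp A_scale)

definition wt :: "(nat \<Rightarrow> rat) \<Rightarrow> 'a \<Rightarrow> 'a" where
  "wt w x = (\<Sum>n | cmp x n \<noteq> 0. scale (w n) (cmp x n))"

lemma wt_eq: "finite S \<Longrightarrow> {n. cmp x n \<noteq> 0} \<subseteq> S \<Longrightarrow> wt w x = (\<Sum>n\<in>S. scale (w n) (cmp x n))"
  unfolding wt_def by (rule sum.mono_neutral_left) auto

lemma wt_add: "wt w (x + y) = wt w x + wt w y"
proof -
  let ?S = "{n. cmp x n \<noteq> 0} \<union> {n. cmp y n \<noteq> 0}"
  have f: "finite ?S" using cmp(2) by auto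
  have "wt w (x+y) = (\<Sum>n\<in>?S. scale (w n) (cmp (x+y) n))"
    by (rule wt_eq[OF f]) (auto simp: cmp_add)
  also have "\<dots> = (\<Sum>n\<in>?S. scale (w n) (cmp x n)) + (\<Sum>n\<in>?S. scale (w n) (cmp y n))"
    by (simp add: cmp_add scale_right_distrib sum.distrib)
  also have "\<dots> = wt w x + wt w y" by (intro arg_cong2[where f="(+)"] wt_eq[symmetric] f) auto
  finally show ?thesis .
qed

lemma wt_scale: "wt w (scale c x) = scale c (wt w x)"
proof -
  have "wt w (scale c x) = (\<Sum>n | cmp x n \<noteq> 0. scale (w n) (cmp (scale c x) n))"
    by (rule wt_eq) (auto simp: cmp cmp_scale)
  then show ?thesis by (simp add: cmp_scale scale_sum_right wt_def mult.commute)
qed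

lemma wt_hom:
  assumes "x \<in> A n" shows "wt w x = scale (w n) x"
proof -
  have "wt w x = (\<Sum>n\<in>{n}. scale (w n) (cmp x n))"
    by (rule wt_eq) (auto simp: cmp_hom[OF assms])
  then show ?thesis by (simp add: cmp_hom[OF assms])
qed

lemma lin_ext:
  assumes "Vector_Spaces.linear scale (*) f" "Vector_Spaces.linear scale (*) g"
    and "\<And>n x. x \<in> A n \<Longrightarrow> f x = (g x :: rat)"
  shows "f x = g x"
proof -
  interpret f: Vector_Spaces.linear scale "(*)" f by fact
  interpret g: Vector_Spaces.linear scale "(*)" g by fact
  have "f x = (\<Sum>n | cmp x n \<noteq> 0. f (cmp x n))" 
    using arg_cong[OF cmp(3)[of x], of f] by (simp only: f.sum)
  also have "\<dots> = (\<Sum>n | cmp x n \<noteq> 0. g (cmp x n))" by (intro sum.cong refl assms(3)) (rule cmp(1))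
  also have "\<dots> = g x" 
    using arg_cong[OF cmp(3)[of x], of g] by (simp only: g.sum)
  finally show ?thesis .
qed

lemma vsQ: "vector_space ((*) :: rat \<Rightarrow> rat \<Rightarrow> rat)"
  by unfold_locales (auto simp: algebra_simps)

lemma linI:
  assumes "\<And>x y. f (x + y) = f x + f y" "\<And>c x. f (scale c x) = c * f x"
  shows "Vector_Spaces.linear scale ((*) :: rat \<Rightarrow> rat \<Rightarrow> rat) f"
  using assms vsQ vector_space_axioms
  by (simp add: Vector_Spaces.linear_def module_hom_def module_hom_axioms_def vector_space_def module_def)

lemma linD:
  assumes "Vector_Spaces.linear scale ((*) :: rat \<Rightarrow> rat \<Rightarrow> rat) f"
  shows "f (x + y) = f x + f y" "f (scale c x) = c * f x" "f 0 = 0"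
    "f (sum h S) = (\<Sum>i\<in>S. f (h i))"
proof -
  interpret f: Vector_Spaces.linear scale "(*)" f by fact
  show "f (x + y) = f x + f y" "f (scale c x) = c * f x" "f 0 = 0" 
    "f (sum h S) = (\<Sum>i\<in>S. f (h i))"
    by (simp_all add: f.add f.scale f.zero f.sum)
qed

lemma bilin_ext:
  assumes "\<And>y. Vector_Spaces.linear scale (*) (\<lambda>x. f x y)" "\<And>y. Vector_Spaces.linear scale (*) (\<lambda>x. g x y)"
   "\<And>x. Vector_Spaces.linear scale (*) (\<lambda>y. f x y)" "\<And>x. Vector_Spaces.linear scale (*) (\<lambda>y. g x y)"
    and "\<And>m n x y. x \<in> A m \<Longrightarrow> y \<in> A n \<Longrightarrow> f x y = (g x y :: rat)"
  shows "f x y = g x y"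
proof (rule lin_ext[OF assms(1,2)])
  fix n x assume x: "x \<in> A n"
  show "f x y = g x y" by (rule lin_ext[OF assms(3,4)]) (use x assms(5) in auto)
qed

lemma dualD:
  assumes "f \<in> graded_dual scale A p"
  shows "Vector_Spaces.linear scale (*) f" "x \<in> A q \<Longrightarrow> q \<noteq> p \<Longrightarrow> f x = 0"
  using assms by (auto simp: graded_dual_def)

lemma lin_wt:
  assumes "Vector_Spaces.linear scale ((*) :: rat \<Rightarrow> rat \<Rightarrow> rat) f"
  shows "Vector_Spaces.linear scale (*) (\<lambda>x. f (wt w x))"
  by (rule linI) (simp_all add: wt_add wt_scale linD[OF assms])

lemma dual_wt:
  assumes "f \<in> graded_dual scale A p"
  shows "f (wt w x) = w p * f x"
proof (rule lin_ext)
  note f = linD[OF dualD(1)[OF assms]]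
  show "Vector_Spaces.linear scale (*) (\<lambda>x. f (wt w x))" using dualD[OF assms] lin_wt by auto
  show "Vector_Spaces.linear scale (*) (\<lambda>x. w p * f x)"
    by (rule linI) (auto simp: f algebra_simps)
  fix n x assume "x \<in> A n"
  then show "f (wt w x) = w p * f x" 
    using dualD(2)[OF assms, of x n] by (cases "n = p") (auto simp: wt_hom f)
qed

lemma neg_one_scale: "(-1) ^ n * x = scale ((-1) ^ n) x"
  by (cases "even n") auto

definition qm :: "'a \<Rightarrow> 'a \<Rightarrow> 'a" where
  "qm x y = wt (\<lambda>n. if n = 0 then 0 else (-1) ^ n) x * wt (\<lambda>n. if n = 0 then 0 else 1) y"

definition qD where "qD = dexp qm (wt (\<lambda>n. (-1) ^ Suc n))"

lemma wt_aug:
  assumes "w 0 = 0" shows "wt w x \<in> aug_ideal scale A"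
  unfolding wt_def aug_ideal_def
proof (rule span_sum)
  fix n
  have "scale (w n) (cmp x n) \<in> A (Suc m)" if "n = Suc m" for m
    using that cmp(1) A_scale by auto
  then show "scale (w n) (cmp x n) \<in> span (\<Union>n. A (Suc n))"
    using assms span_zero by (cases n) (auto intro!: span_base)
qed

lemma qD_gen: "qD (gen c) w = (case w of [x, y] \<Rightarrow> c (qm x y) | _ \<Rightarrow> 0)"
  by (cases w; cases "tl w") (auto simp: qD_def gen_Cons dexp_unit split: list.splits)


abbreviation "L \<equiv> quillen_lie scale A"

lemma L_def': "x \<in> L n \<longleftrightarrow>
    (n, x) \<in> lie_closure gr_bracket {(m, gen f) | m f. f \<in> graded_dual scale A (Suc m)}"
  by (simp add: quillen_lie_def free_gr_lie_def)

lemma L_gen: "f \<in> graded_dual scale A (Suc n) \<Longrightarrow> gen f \<in> L n"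
  unfolding L_def' by (rule lie_closure.base) auto

lemma L_closed:
  "0 \<in> L n" "x \<in> L n \<Longrightarrow> y \<in> L n \<Longrightarrow> x + y \<in> L n" "x \<in> L n \<Longrightarrow> fscale c x \<in> L n"
  "x \<in> L m \<Longrightarrow> z \<in> L n \<Longrightarrow> gr_bracket m n x z \<in> L (m + n)"
  unfolding L_def' by (auto intro: lie_closure.intros)

lemma L_sum: "(\<And>i. i \<in> S \<Longrightarrow> h i \<in> L n) \<Longrightarrow> sum h S \<in> L n"
  by (induction S rule: infinite_finite_induct) (auto simp: L_closed)

lemma L_induct[consumes 1, case_names gen zero add scale bracket]:
  assumes "x \<in> L n"
    and "\<And>n f. f \<in> graded_dual scale A (Suc n) \<Longrightarrow> P n (gen f)"
    and "\<And>n. P n 0"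
    and "\<And>n x y. x \<in> L n \<Longrightarrow> P n x \<Longrightarrow> y \<in> L n \<Longrightarrow> P n y \<Longrightarrow> P n (x + y)"
    and "\<And>n c x. x \<in> L n \<Longrightarrow> P n x \<Longrightarrow> P n (fscale c x)"
    and "\<And>m n x y. x \<in> L m \<Longrightarrow> P m x \<Longrightarrow> y \<in> L n \<Longrightarrow> P n y \<Longrightarrow>
           P (m + n) (gr_bracket m n x y)"
  shows "P n x"
  using assms(1)[unfolded L_def']
proof (induction rule: lie_closure.induct)
  case (base n x) then show ?case using assms(2) by blast
next
  case zero show ?case by (rule assms(3))
next
  case add then show ?case by (intro assms(4)) (simp_all only: L_def')
next
  case scale then show ?case by (intro assms(5)) (simp_all only: L_def')
next
  case bracket then show ?case by (intro assms(6)) (simp_all only: L_def')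
qed

lemma fscale_map: "fscale c F \<circ> map s = fscale c (F \<circ> map s)"
  by (auto simp: fscale_def)

lemma fscale_fscale: "fscale a (fscale b F) = fscale (a * b) F"
  by (auto simp: fscale_def)

lemma L_map: "x \<in> L n \<Longrightarrow> x \<circ> map (wt (\<lambda>n. (-1) ^ Suc n)) = fscale ((-1) ^ n) x"
proof (induction rule: L_induct)
  case (gen n f)
  show ?case
    using dual_wt[OF gen] by (auto simp: fun_eq_iff gen_def fscale_def split: list.splits)
next
  case (bracket m n x y)
  let ?s = "wt (\<lambda>n. (-1) ^ Suc n)"
  have "gr_bracket m n x y \<circ> map ?s = gr_bracket m n (x \<circ> map ?s) (y \<circ> map ?s)"
    unfolding gr_bracket_def tmul_map[symmetric] by (auto simp: fun_eq_iff fscale_def)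
  also have "\<dots> = fscale ((-1) ^ (m + n)) (gr_bracket m n x y)"
    unfolding bracket.IH gr_bracket_def tmul_scale_left tmul_scale_right
    by (auto simp: fscale_def fun_eq_iff power_add algebra_simps)
  finally show ?case .
qed (auto simp: fun_eq_iff fscale_def algebra_simps)

lemma qD_add: "qD (F + G) = qD F + qD G"
  by (auto simp: qD_def fun_eq_iff dexp_add)
lemma qD_scale: "qD (fscale c F) = fscale c (qD F)"
  by (rule ext) (simp add: qD_def dexp_scale fscale_def[of c "dexp _ _ _"])
lemma qD_zero: "qD 0 = 0"
  using qD_scale[of 0 0] by (simp add: fscale_def zero_fun_def)

lemma qD_tmul: "x \<in> L n \<Longrightarrow> qD (tmul x G) = tmul (qD x) G + fscale ((-1) ^ n) (tmul x (qD G))"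
proof
  fix v assume "x \<in> L n"
  show "qD (tmul x G) v = (tmul (qD x) G + fscale ((-1) ^ n) (tmul x (qD G))) v"
    unfolding qD_def dexp_tmul L_map[OF \<open>x \<in> L n\<close>] tmul_scale_left plus_fun_def ..
qed

lemma qD_diff: "qD (F - G) = qD F - qD G"
proof -
  have "F - G = F + fscale (-1) G" "qD F - qD G = qD F + fscale (-1) (qD G)"
    by (auto simp: fscale_def)
  then show ?thesis by (simp only: qD_add qD_scale)
qed

lemma qD_bracket:
  assumes "x \<in> L m" "y \<in> L n" "m = 0 \<Longrightarrow> qD x = 0" "n = 0 \<Longrightarrow> qD y = 0"
  shows "qD (gr_bracket m n x y) =
    gr_bracket (m - 1) n (qD x) y + fscale ((-1) ^ m) (gr_bracket m (n - 1) x (qD y))"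
proof -
  have e: "qD (gr_bracket m n x y) = tmul (qD x) y + fscale ((-1) ^ m) (tmul x (qD y)) -
      fscale ((-1) ^ (m * n)) (tmul (qD y) x + fscale ((-1) ^ n) (tmul y (qD x)))"
    unfolding gr_bracket_def qD_diff qD_scale qD_tmul[OF assms(1)] qD_tmul[OF assms(2)] ..
  have 1: "fscale ((-1) ^ (m * n)) (fscale ((-1) ^ n) (tmul y (qD x))) =
      fscale ((-1) ^ ((m - 1) * n)) (tmul y (qD x))"
  proof (cases m)
    case 0
    with assms(3) have "qD x = 0" by simp
    then show ?thesis by (simp only: tmul_zero_right frat.scale_zero_right)
  qed (auto simp: fscale_def power_add)
  have 2: "fscale ((-1) ^ (m * n)) (tmul (qD y) x) =
      fscale ((-1) ^ m) (fscale ((-1) ^ (m * (n - 1))) (tmul (qD y) x))"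
  proof (cases n)
    case 0
    with assms(4) have "qD y = 0" by simp
    then show ?thesis by (simp only: tmul_zero_left frat.scale_zero_right)
  qed (auto simp: fscale_def power_add)
  show ?thesis
    unfolding e frat.scale_right_distrib 1 2
    unfolding gr_bracket_def frat.scale_right_diff_distrib by simp
qed

lemma gr_bracket_gen:
  "gr_bracket m n (gen f) (gen g) w =
     (case w of [x, y] \<Rightarrow> f x * g y - (-1) ^ (m * n) * (g x * f y) | _ \<Rightarrow> 0)"
  by (auto simp: gr_bracket_def tmul_gen fscale_def split: list.splits)

lemma qm_linear:
  assumes "Vector_Spaces.linear scale ((*) :: rat \<Rightarrow> rat \<Rightarrow> rat) c"
  shows "Vector_Spaces.linear scale (*) (\<lambda>x. c (qm x y))"
    "Vector_Spaces.linear scale (*) (\<lambda>y. c (qm x y))"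
  by (rule linI; simp add: qm_def wt_add wt_scale distrib_left distrib_right
        scale_mult_left scale_mult_right linD[OF assms])+

lemma sum_fun_apply: "(\<Sum>i\<in>S. F i) x = (\<Sum>i\<in>S. F i x)" for F :: "'i \<Rightarrow> 'y \<Rightarrow> rat"
  by (induction S rule: infinite_finite_induct) auto

lemma aug_hom: "x \<in> A (Suc n) \<Longrightarrow> x \<in> aug_ideal scale A"
  unfolding aug_ideal_def by (auto intro: span_base)

lemma qD_gen_formula:
  assumes comm: "graded_commutative A" and c: "c \<in> graded_dual scale A p"
    and cop: "reduced_coproduct scale A c N p' c' p'' c''"
  shows "qD (gen c) = fscale (1/2) (\<Sum>i<N. fscale ((-1) ^ p' i)
            (gr_bracket (p' i - 1) (p'' i - 1) (gen (c' i)) (gen (c'' i))))"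
proof
  fix w
  have c': "c' i \<in> graded_dual scale A (p' i)" "c'' i \<in> graded_dual scale A (p'' i)"
     "p' i \<ge> 1" "p'' i \<ge> 1" if "i < N" for i
    using cop that by (auto simp: reduced_coproduct_def)
  have cxy: "c (x * y) = (\<Sum>i<N. c' i x * c'' i y)"
    if "x \<in> aug_ideal scale A" "y \<in> aug_ideal scale A" for x y
    using cop that by (auto simp: reduced_coproduct_def)
  have lin: "c' i (x + y) = c' i x + c' i y" "c'' i (x + y) = c'' i x + c'' i y"
    "c' i (scale d x) = d * c' i x" "c'' i (scale d x) = d * c'' i x" if "i \<in> {..<N}" for i x y d
    using that linD(1,2)[OF dualD(1)[OF c'(1)], of i] linD(1,2)[OF dualD(1)[OF c'(2)], of i] by auto
  define R where "R x y = 1/2 * (\<Sum>i<N. (-1) ^ p' i * (c' i x * c'' i y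
      - (-1) ^ ((p' i - 1) * (p'' i - 1)) * (c'' i x * c' i y)))" for x y
  have "c (qm x y) = R x y" for x y
  proof (rule bilin_ext[where f="\<lambda>x y. c (qm x y)" and g=R])
    show "Vector_Spaces.linear scale (*) (\<lambda>x. R x y)" for y
      unfolding R_def by (rule linI; unfold sum_distrib_left sum.distrib[symmetric];
        intro sum.cong refl) (simp_all add: lin algebra_simps)
    show "Vector_Spaces.linear scale (*) (\<lambda>y. R x y)" for x
      unfolding R_def by (rule linI; unfold sum_distrib_left sum.distrib[symmetric];
        intro sum.cong refl) (simp_all add: lin algebra_simps)
    fix a b x y assume xy: "x \<in> A a" "y \<in> A b"
    show "c (qm x y) = R x y"
    proof (cases "a = 0 \<or> b = 0")
      case True
      have z: "c' i x * c'' i y = 0 \<and> c'' i x * c' i y = 0" if "i < N" for i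
        using True c'(3,4)[OF that] dualD(2)[OF c'(1)[OF that] xy(1)]
          dualD(2)[OF c'(1)[OF that] xy(2)] dualD(2)[OF c'(2)[OF that] xy(1)]
          dualD(2)[OF c'(2)[OF that] xy(2)] by auto
      have "(\<Sum>i<N. (-1) ^ p' i * (c' i x * c'' i y
          - (-1) ^ ((p' i - 1) * (p'' i - 1)) * (c'' i x * c' i y))) = 0"
        by (intro sum.neutral ballI) (simp only: z lessThan_iff mult_zero_right diff_zero)
      then have "R x y = 0" unfolding R_def by simp
      moreover have "qm x y = 0" using True xy by (auto simp: qm_def wt_hom)
      ultimately show ?thesis using linD(3)[OF dualD(1)[OF c]] by simp
    next
      case False
      then have aug: "x \<in> aug_ideal scale A" "y \<in> aug_ideal scale A"
        using xy aug_hom by (metis not0_implies_Suc)+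
      have 1: "c (qm x y) = (-1) ^ a * c (x * y)"
        using False xy by (simp add: qm_def wt_hom scale_mult_left linD[OF dualD(1)[OF c]])
      have "x * y = scale ((-1) ^ (a * b)) (y * x)"
        using comm xy unfolding graded_commutative_def neg_one_scale[symmetric] by blast
      then have 2: "c (x * y) = (-1) ^ (a * b) * c (y * x)"
        by (simp add: linD[OF dualD(1)[OF c]])
      have 3: "(-1) ^ p' i * (c' i x * c'' i y) = (-1) ^ a * (c' i x * c'' i y)" if "i < N" for i
        using dualD(2)[OF c'(1)[OF that] xy(1)] by (cases "a = p' i") auto
      have 4: "(-1) ^ p' i * (-1) ^ ((p' i - 1) * (p'' i - 1)) * (c'' i x * c' i y) =
          - ((-1) ^ a * (-1) ^ (a * b) * (c' i y * c'' i x))" if "i < N" for i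
      proof (cases "b = p' i \<and> a = p'' i")
        case True
        obtain u v where uv: "p' i = Suc u" "p'' i = Suc v"
          using c'(3,4)[OF \<open>i < N\<close>] by (cases "p' i"; cases "p'' i") auto
        show ?thesis using True uv by (simp add: power_add algebra_simps)
      next
        case False
        then have "c'' i x = 0 \<or> c' i y = 0"
          using dualD(2)[OF c'(1)[OF that] xy(2)] dualD(2)[OF c'(2)[OF that] xy(1)] by auto
        then show ?thesis by auto
      qed
      have "R x y = 1/2 * (\<Sum>i<N. (-1) ^ a * (c' i x * c'' i y)
            + (-1) ^ a * (-1) ^ (a * b) * (c' i y * c'' i x))"
        unfolding R_def using 3 4 
        by (intro arg_cong2[where f="(*)"] refl sum.cong) (simp add: right_diff_distrib mult.assoc)
      also have "\<dots> = 1/2 * ((-1) ^ a * c (x * y) + (-1) ^ a * ((-1) ^ (a * b) * c (y * x)))"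
        by (simp add: cxy aug sum.distrib sum_distrib_left mult.assoc)
      also have "\<dots> = (-1) ^ a * c (x * y)" using 2 by simp
      finally show ?thesis using 1 by simp
    qed
  qed (use qm_linear[OF dualD(1)[OF c]] in auto)
  then show "qD (gen c) w = fscale (1/2) (\<Sum>i<N. fscale ((-1) ^ p' i)
            (gr_bracket (p' i - 1) (p'' i - 1) (gen (c' i)) (gen (c'' i)))) w"
    by (auto simp: qD_gen fscale_def sum_fun_apply gr_bracket_gen R_def split: list.splits)
qed

lemma coproduct_exists:
  assumes ft: "finite_type scale A" and c: "c \<in> graded_dual scale A p"
  shows "\<exists>N p' c' p'' c''. reduced_coproduct scale A c N p' c' p'' c'' \<and>
     (\<forall>i<N. p' i + p'' i = p)"
proof -
  note cl = linD[OF dualD(1)[OF c]]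
  have basis: "\<exists>S. finite S \<and> independent S \<and> span S = A n" for n
  proof -
    obtain S where S: "finite S" "A n = span S" using ft by (auto simp: finite_type_def)
    obtain T where "T \<subseteq> S" "independent T" "S \<subseteq> span T"
      using maximal_independent_subset[of S] by blast
    have "span T = span S"
      using span_mono[OF \<open>T \<subseteq> S\<close>] span_minimal[OF \<open>S \<subseteq> span T\<close> subspace_span] by auto
    then show ?thesis
      using S finite_subset[OF \<open>T \<subseteq> S\<close>] \<open>independent T\<close> by (intro exI[of _ T]) simp
  qed
  then obtain S where S: "\<And>n. finite (S n)" "\<And>n. independent (S n)" "\<And>n. span (S n) = A n"
    using basis by metis
  define r where "r n b x = representation (S n) (cmp x n) b" for n b x
  have inS: "cmp x n \<in> span (S n)" for x n using S(3) cmp(1) by auto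
  have r_lin: "Vector_Spaces.linear scale (*) (r n b)" for n b
    by (rule linI) (simp_all add: r_def cmp_add cmp_scale representation_add[OF S(2) inS inS]
          representation_scale[OF S(2) inS])
  have r_dual: "r n b \<in> graded_dual scale A n" for n b
    unfolding graded_dual_def using r_lin by (auto simp: r_def cmp_hom representation_zero)
  have r_sum: "x = (\<Sum>b\<in>S n. scale (r n b x) b)" if "x \<in> A n" for x n
    using sum_representation_eq[OF S(2)[of n], of x "S n"] that S(1,3)[of n]
    by (simp add: r_def cmp_hom)
  define cc where "cc n b y = (if n \<le> p then c (b * cmp y (p - n)) else 0)" for n b y
  have cc_dual: "cc n b \<in> graded_dual scale A (p - n)" if "n < p" for n b
  proof -
    have "Vector_Spaces.linear scale (*) (cc n b)"
      by (rule linI) (simp_all add: cc_def cmp_add cmp_scale distrib_left scale_mult_right cl)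
    then show ?thesis using that
      by (auto simp: graded_dual_def cc_def cmp_hom cl)
  qed
  define I where "I = Sigma {1..<p} S"
  have fI: "finite I" using S by (auto simp: I_def)
  obtain h where h: "bij_betw h {0..<card I} I" using ex_bij_betw_nat_finite[OF fI] by blast
  define N where "N = card I"
  have h': "h i \<in> I" if "i < N" for i using h that by (auto simp: bij_betw_def N_def)
  have hfs: "1 \<le> fst (h i)" "fst (h i) < p" "1 \<le> p - fst (h i)" if "i < N" for i
    using h'[OF that] by (auto simp: I_def)
  have key: "c (x * y) = (\<Sum>i<N. r (fst (h i)) (snd (h i)) x * cc (fst (h i)) (snd (h i)) y)"
    if "x \<in> aug_ideal scale A" "y \<in> aug_ideal scale A" for x y
  proof -
    define G where "G x y = (\<Sum>(n,b)\<in>I. r n b x * cc n b y)" for x y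
    have hom: "c (x * y) = G x y" if xy: "x \<in> A (Suc m)" "y \<in> A (Suc n)" for x y m n
    proof (cases "Suc m + Suc n = p")
      case True
      have r0: "r i b x = 0" if "i \<noteq> Suc m" for i b using dualD(2)[OF r_dual xy(1)] that by auto
      have "G x y = (\<Sum>i\<in>{1..<p}. \<Sum>b\<in>S i. r i b x * cc i b y)"
        unfolding G_def I_def by (rule sum.Sigma[symmetric]) (auto simp: S)
      also have "\<dots> = (\<Sum>i\<in>{Suc m}. \<Sum>b\<in>S i. r i b x * cc i b y)"
        by (rule sum.mono_neutral_right) (use True in \<open>auto simp: r0\<close>)
      also have "\<dots> = (\<Sum>b\<in>S (Suc m). r (Suc m) b x * c (b * y))"
        using True xy by (auto simp: cc_def cmp_hom)
      also have "\<dots> = (\<Sum>b\<in>S (Suc m). c (scale (r (Suc m) b x) b * y))"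
        by (simp add: scale_mult_left cl)
      also have "\<dots> = c ((\<Sum>b\<in>S (Suc m). scale (r (Suc m) b x) b) * y)"
        by (simp add: sum_distrib_right cl)
      also have "\<dots> = c (x * y)" using r_sum[OF xy(1)] by simp
      finally show ?thesis by simp
    next
      case False
      have "G x y = 0" unfolding G_def
      proof (rule sum.neutral, clarify)
        fix i b assume i: "(i, b) \<in> I"
        show "r i b x * cc i b y = 0"
        proof (cases "i = Suc m")
          case True
          then show ?thesis using dualD(2)[OF cc_dual xy(2), of i b] i False by (auto simp: I_def)
        qed (use dualD(2)[OF r_dual xy(1)] in auto)
      qed
      then show ?thesis using dualD(2)[OF c mult_in_component[OF xy]] False by simp
    qed
    have G1: "Vector_Spaces.linear scale (*) (\<lambda>x. G x y)" for y
      unfolding G_def by (rule linI; unfold sum_distrib_left sum.distrib[symmetric];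
        intro sum.cong refl) (auto simp: linD[OF r_lin] algebra_simps)
    have G2: "G x (y + z) = G x y + G x z" "G x (scale d y) = d * G x y" for x y z d
      unfolding G_def sum.distrib[symmetric] sum_distrib_left
      by (auto simp: I_def linD(1,2)[OF dualD(1)[OF cc_dual]] algebra_simps intro!: sum.cong)
    have G3: "Vector_Spaces.linear scale (*) (G x)" for x
      by (rule linI) (auto simp: G2)
    have homx: "c (x * y) = G x y" if x: "x \<in> A (Suc m)" for m x
      using \<open>y \<in> aug_ideal scale A\<close> unfolding aug_ideal_def
    proof (induction rule: span_induct_alt)
      case base show ?case using linD(3)[OF G3] cl(3) by simp
    next
      case (step d u v)
      then have "u \<in> (\<Union>n. A (Suc n))" "c (x * v) = G x v" by blast+
      then show ?case using hom x
        by (auto simp: distrib_left scale_mult_right cl(1,2) G2)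
    qed
    have "c (x * y) = G x y" using \<open>x \<in> aug_ideal scale A\<close> unfolding aug_ideal_def
    proof (induction rule: span_induct_alt)
      case base show ?case using linD(3)[OF G1] cl(3) by simp
    next
      case (step d u v)
      then have "c (u * y) = G u y" "c (v * y) = G v y" using homx by blast+
      then show ?case
        by (simp add: distrib_right scale_mult_left cl(1,2) linD(1,2)[OF G1])
    qed
    also have "G x y = (\<Sum>i\<in>{0..<card I}. case h i of (n, b) \<Rightarrow> r n b x * cc n b y)"
      unfolding G_def by (rule sum.reindex_bij_betw[OF h, symmetric])
    finally show ?thesis by (simp add: N_def split_def lessThan_atLeast0)
  qed
  have "reduced_coproduct scale A c N (\<lambda>i. fst (h i)) (\<lambda>i. r (fst (h i)) (snd (h i)))
      (\<lambda>i. p - fst (h i)) (\<lambda>i. cc (fst (h i)) (snd (h i)))"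
    unfolding reduced_coproduct_def using key hfs r_dual cc_dual by auto
  moreover have "\<forall>i<N. fst (h i) + (p - fst (h i)) = p" using hfs by force
  ultimately show ?thesis by blast
qed

lemma qD_gen_L:
  assumes ft: "finite_type scale A" and comm: "graded_commutative A"
    and c: "c \<in> graded_dual scale A (Suc n)"
  shows "n = 0 \<Longrightarrow> qD (gen c) = 0" "n = Suc m \<Longrightarrow> qD (gen c) \<in> L m"
proof -
  obtain N p' c' p'' c'' where cop: "reduced_coproduct scale A c N p' c' p'' c''"
    and p: "\<And>i. i < N \<Longrightarrow> p' i + p'' i = Suc n"
    using coproduct_exists[OF ft c] by blast
  note f = qD_gen_formula[OF comm c cop]
  have c': "c' i \<in> graded_dual scale A (p' i)" "c'' i \<in> graded_dual scale A (p'' i)"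
     "p' i \<ge> 1" "p'' i \<ge> 1" if "i < N" for i
    using cop that by (auto simp: reduced_coproduct_def)
  show "qD (gen c) = 0" if "n = 0"
  proof -
    have "N = 0" using p[of 0] c'(3,4)[of 0] that by (cases N) auto
    then show ?thesis using f by (simp add: fscale_def zero_fun_def)
  qed
  show "qD (gen c) \<in> L m" if "n = Suc m"
    unfolding f
  proof (intro L_closed(3) L_sum)
    fix i assume "i \<in> {..<N}"
    then have i: "i < N" by simp
    have "gr_bracket (p' i - 1) (p'' i - 1) (gen (c' i)) (gen (c'' i)) \<in> L ((p' i - 1) + (p'' i - 1))"
      by (intro L_closed(4) L_gen) (use c'[OF i] in auto)
    moreover have "(p' i - 1) + (p'' i - 1) = m" using p[OF i] c'(3,4)[OF i] that by auto
    ultimately show "gr_bracket (p' i - 1) (p'' i - 1) (gen (c' i)) (gen (c'' i)) \<in> L m" by simp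
  qed
qed

lemma qD_L:
  assumes ft: "finite_type scale A" and comm: "graded_commutative A"
    and "x \<in> L n"
  shows "(n = 0 \<longrightarrow> qD x = 0) \<and> (\<forall>m. n = Suc m \<longrightarrow> qD x \<in> L m)"
  using assms(3)
proof (induction rule: L_induct)
  case (gen n f) then show ?case using qD_gen_L[OF ft comm] by auto
next
  case (bracket m n x y)
  note b = qD_bracket[OF bracket.hyps(1,2)]
  have z: "gr_bracket i j 0 y = 0" "gr_bracket i j x 0 = 0" for i j
    unfolding gr_bracket_def tmul_zero_left tmul_zero_right by simp_all
  show ?case
  proof (intro conjI impI allI)
    assume "m + n = 0"
    then have "m = 0" "n = 0" "qD x = 0" "qD y = 0" using bracket.IH by auto
    then show "qD (gr_bracket m n x y) = 0"
      using b by (simp only: z frat.scale_zero_right add_0)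
  next
    fix k assume k: "m + n = Suc k"
    have e: "qD (gr_bracket m n x y) =
        gr_bracket (m - 1) n (qD x) y + fscale ((-1) ^ m) (gr_bracket m (n - 1) x (qD y))"
      by (rule b) (use bracket.IH in blast)+
    have "gr_bracket (m - 1) n (qD x) y \<in> L k"
    proof (cases m)
      case (Suc m')
      then show ?thesis using L_closed(4)[of "qD x" m' y n] bracket k by simp
    next
      case 0
      then have "qD x = 0" using bracket.IH by blast
      then show ?thesis by (simp only: z L_closed(1))
    qed
    moreover have "gr_bracket m (n - 1) x (qD y) \<in> L k"
    proof (cases n)
      case (Suc n')
      then show ?thesis using L_closed(4)[of x m "qD y" n'] bracket k by simp
    next
      case 0
      then have "qD y = 0" using bracket.IH by blast
      then show ?thesis by (simp only: z L_closed(1))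
    qed
    ultimately show "qD (gr_bracket m n x y) \<in> L k"
      using L_closed(2)[OF _ L_closed(3)] e by (simp only:)
  qed
next
  case (add n x y)
  then show ?case using L_closed(2) by (metis qD_add add_0)
next
  case (scale n c x)
  then show ?case using L_closed(3) by (metis qD_scale frat.scale_zero_right)
next
  case (zero n)
  then show ?case using L_closed(1) by (metis qD_zero)
qed

lemma quillen_differential_qD:
  assumes "finite_type scale A" "graded_commutative A"
  shows "quillen_differential scale A qD"
proof -
  note L = qD_L[OF assms]
  show ?thesis
    unfolding quillen_differential_def Let_def
    by (intro conjI allI ballI impI qD_add qD_scale qD_bracket qD_gen_formula[OF assms(2)])
       (use L in auto)
qed

lemma quillen_differential_quillen_d:
  assumes "finite_type scale A" "graded_commutative A"
  shows "quillen_differential scale A (quillen_d scale A)"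
  unfolding quillen_d_def by (rule someI[of "quillen_differential scale A", OF quillen_differential_qD[OF assms]])

end

end

(* Take as letters of weight d a basis of the dual of A^d, d > 0. The free graded Lie algebra L on the
   letters sits in the tensor algebra T = U(L), both bigraded by weight and word length; the quadratic
   derivation D dual to the multiplication preserves the weight and raises the length by one.
   Dually to the bar complex, A is Koszul iff H(T) lives on the diagonal weight = length.
   The rescaling by k makes the total degree (2k+1) weight - length separate the diagonal of H(L),
   which is the holonomy Lie algebra, from the rest without changing any sign, so the equality
   of the Hilbert series says that H(L) lives on the diagonal.

   That the two diagonality conditions agree is a PBW type statement. There is a chain map
   phi : T -> L (x) T, the derivation with phi x = |x| (x (x) 1) on letters, such that multiplication
   after phi is the multiplication by the weight, and the component of phi in L (x) 1 restricts to the
   multiplication by the weight on L. Hence L is a retract of T up to the scalar |x|, and, by the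
   Kuenneth formula and induction on the weight, H(T) is generated by H(L). *)

theory Submission
  imports Defs
begin

text \<open>The passage between T = U(L) and L rests on two identities. \<open>phi\<close> followed
  by the multiplication is an Euler operator: every letter contributes its own degree.
  \<open>phi\<close> followed by the counit of T is the Dynkin operator weighted by the degree of
  the last letter; that it multiplies a Lie element by its weight is a graded Dynkin-Specht-Wever
  theorem. The weight, not the length, serves as scalar because D preserves it, so that
  \<open>phi\<close> commutes with the differentials; in positive weight it is invertible over the
  rationals.

  Total degree alone does not isolate the diagonal: degree 2kw may also contain off-diagonal
  bidegrees, of weight below w. But in a fixed total degree the length determines the weight, so the
  homology splits by length. The diagonal summand always has the dimensions of the holonomy Lie
  algebra: everything in bidegree (w, w) is a cycle, and the boundaries of (w, w-1) form the ideal.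
  Dimensions add, so equal series force the other summands to vanish.

  Bar chains are a quotient of the free space on all words of elements of A. They are compared with
  T through their linear functionals, which avoids choosing a basis of the quotient.\<close>

section \<open>Linear operators on rational functions\<close>

text \<open>As simplification rules these also rewrite unapplied sums of functions into
  \<open>\<lambda>\<close>-abstractions, which hides the vector space operations.\<close>

lemmas fun_apply = plus_fun_apply zero_fun_apply minus_apply uminus_apply

declare fun_apply [simp del]

abbreviation flinear :: "(('x \<Rightarrow> rat) \<Rightarrow> 'y \<Rightarrow> rat) \<Rightarrow> bool" where
  "flinear \<equiv> Vector_Spaces.linear fscale fscale"

interpretation fpair: vector_space_pair
  "fscale :: rat \<Rightarrow> ('x \<Rightarrow> rat) \<Rightarrow> 'x \<Rightarrow> rat" "fscale :: rat \<Rightarrow> ('y \<Rightarrow> rat) \<Rightarrow> 'y \<Rightarrow> rat"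
  by unfold_locales

lemma flinearI:
  assumes "\<And>F G. f (F + G) = f F + f G" "\<And>c F. f (fscale c F) = fscale c (f F)"
  shows "flinear f"
  unfolding Vector_Spaces.linear_def module_hom_def module_hom_axioms_def
  using assms by (auto intro: frat.vector_space_axioms frat.module_axioms)

lemma flinearD:
  assumes "flinear f"
  shows "f (F + G) = f F + f G" "f (F - G) = f F - f G" "f (- F) = - f F"
    "f (fscale c F) = fscale c (f F)" "f 0 = 0" "f (\<Sum>i\<in>I. H i) = (\<Sum>i\<in>I. f (H i))"
proof -
  interpret f: Vector_Spaces.linear fscale fscale f by fact
  show "f (F + G) = f F + f G" "f (F - G) = f F - f G" "f (- F) = - f F"
    "f (fscale c F) = fscale c (f F)" "f 0 = 0" "f (\<Sum>i\<in>I. H i) = (\<Sum>i\<in>I. f (H i))"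
    by (simp_all add: f.add f.diff f.neg f.scale f.zero f.sum)
qed

lemma sum_fun_rat: "(\<Sum>i\<in>I. F i) x = (\<Sum>i\<in>I. F i x)" for F :: "'i \<Rightarrow> 'y \<Rightarrow> rat"
  by (induction I rule: infinite_finite_induct) (auto simp: fun_apply)

lemma flinear_add: assumes "flinear f" "flinear g" shows "flinear (\<lambda>F. f F + g F)"
  by (rule flinearI; unfold flinearD[OF assms(1)] flinearD[OF assms(2)])
    (auto simp: fscale_def fun_apply algebra_simps)

lemma flinear_diff: assumes "flinear f" "flinear g" shows "flinear (\<lambda>F. f F - g F)"
  by (rule flinearI; unfold flinearD[OF assms(1)] flinearD[OF assms(2)])
    (auto simp: fscale_def fun_apply algebra_simps)

lemma flinear_scale: assumes "flinear f" shows "flinear (\<lambda>F. fscale c (f F))"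
  by (rule flinearI; unfold flinearD[OF assms]) (auto simp: fscale_def fun_apply algebra_simps)

lemma flinear_compose: assumes "flinear f" "flinear g" shows "flinear (\<lambda>F. f (g F))"
  by (rule flinearI) (simp_all add: flinearD[OF assms(1)] flinearD[OF assms(2)])

lemma flinear_id: "flinear (\<lambda>F. F)"
  by (rule flinearI) simp_all

lemma flinear_zero: "flinear (\<lambda>_. 0)"
  by (rule flinearI) simp_all

lemma flinear_tmul: "flinear (tmul F)" "flinear (\<lambda>F. tmul F G)"
  by (rule flinearI, simp_all add: tmul_add_right tmul_scale_right tmul_add_left tmul_scale_left)+

lemma tmul_assoc: "tmul (tmul F G) H = tmul F (tmul G H)"
proof
  fix v show "tmul (tmul F G) H v = tmul F (tmul G H) v"
  proof (induction v arbitrary: F)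
    case Nil then show ?case by (simp add: tmul_Nil)
  next
    case (Cons x v)
    have "(\<lambda>u. tmul F G (x # u)) = fscale (F []) (\<lambda>u. G (x # u)) + tmul (\<lambda>u. F (x # u)) G"
      by (auto simp: tmul_Cons fscale_def fun_apply)
    then have "tmul (\<lambda>u. tmul F G (x # u)) H v =
        F [] * tmul (\<lambda>u. G (x # u)) H v + tmul (\<lambda>u. F (x # u)) (tmul G H) v"
      by (simp add: tmul_add_left tmul_scale_left Cons.IH fun_apply) (simp add: fscale_def)
    then show ?case by (simp add: tmul_Cons tmul_Nil algebra_simps)
  qed
qed

lemma word_Cons: "(\<lambda>u. word (x # w) (y # u)) = (if x = y then word w else 0)"
  by (auto simp: word_def fun_apply)

lemma tmul_word: "tmul (word u) (word w) = word (u @ w)"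
proof
  fix v show "tmul (word u) (word w) v = word (u @ w) v"
  proof (induction v arbitrary: u)
    case Nil then show ?case by (auto simp: tmul_Nil word_def)
  next
    case (Cons x v)
    then show ?case
    proof (cases u)
      case Nil
      then have "(\<lambda>ua. word u (x # ua)) = 0" by (auto simp: word_def fun_apply)
      then show ?thesis using Nil by (simp add: tmul_Cons tmul_zero_left fun_apply) (simp add: word_def)
    next
      case (Cons y u')
      then show ?thesis using Cons.IH[of u']
        by (simp add: tmul_Cons word_Cons tmul_zero_left fun_apply) (auto simp: word_def)
    qed
  qed
qed

lemma tmul_word_Nil: "tmul (word []) G = G"
proof
  fix v
  have "word [] = (\<lambda>u::'a list. if u = [] then 1 else 0)" by (auto simp: word_def)
  then show "tmul (word []) G v = G v" by (simp add: tmul_unit)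
qed

lemma gr_bracket_flinear: "flinear (gr_bracket m n F)" "flinear (\<lambda>F. gr_bracket m n F G)"
  unfolding gr_bracket_def by (intro flinear_diff flinear_scale flinear_tmul)+

text \<open>The degrees enter only through a sign. This identifies brackets taken in different
  gradings: weight plus length, bracket length, and total degree.\<close>

lemma gr_bracket_parity: "even (m * n + m' * n') \<Longrightarrow> gr_bracket m n = gr_bracket m' n'"
  by (auto simp: gr_bracket_def fun_eq_iff minus_one_power_iff)

lemma span_linear_mem:
  assumes "F \<in> frat.span X" "flinear f" "frat.subspace Y" "\<And>x. x \<in> X \<Longrightarrow> f x \<in> Y"
  shows "f F \<in> Y"
proof -
  interpret f: Vector_Spaces.linear fscale fscale f by fact
  have "f ` frat.span X = frat.span (f ` X)" by (rule f.span_image[symmetric])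
  also have "\<dots> \<subseteq> Y" by (rule frat.span_minimal[OF _ assms(3)]) (use assms(4) in blast)
  finally show ?thesis using assms(1) by blast
qed

section \<open>Tensor products as functions of two words\<close>

definition tens :: "('x list \<Rightarrow> rat) \<Rightarrow> ('x list \<Rightarrow> rat) \<Rightarrow> 'x list \<times> 'x list \<Rightarrow> rat" where
  "tens a b = (\<lambda>z. a (fst z) * b (snd z))"

text \<open>This is f (x) id, obtained by freezing the second word, so that no decomposition into
  pure tensors is needed. Neither \<open>lapp\<close> nor \<open>rapp\<close> carries a Koszul sign;
  \<open>sg\<close> supplies it where required.\<close>

definition lapp ::
    "(('x list \<Rightarrow> rat) \<Rightarrow> 'x list \<Rightarrow> rat) \<Rightarrow> ('x list \<times> 'x list \<Rightarrow> rat) \<Rightarrow> 'x list \<times> 'x list \<Rightarrow> rat"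
  where "lapp f G = (\<lambda>z. f (\<lambda>u. G (u, snd z)) (fst z))"

definition rapp ::
    "(('x list \<Rightarrow> rat) \<Rightarrow> 'x list \<Rightarrow> rat) \<Rightarrow> ('x list \<times> 'x list \<Rightarrow> rat) \<Rightarrow> 'x list \<times> 'x list \<Rightarrow> rat"
  where "rapp f G = (\<lambda>z. f (\<lambda>v. G (fst z, v)) (snd z))"

text \<open>The multiplication T (x) T -> T, extended to arbitrary functions of two words.\<close>

definition tcollapse :: "('x list \<times> 'x list \<Rightarrow> rat) \<Rightarrow> 'x list \<Rightarrow> rat" where
  "tcollapse G = (\<lambda>w. \<Sum>i\<le>length w. G (take i w, drop i w))"

lemma tcollapse_tens: "tcollapse (tens a b) = tmul a b"
  by (simp add: tcollapse_def tens_def tmul_def)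

lemma flinear_tcollapse: "flinear tcollapse"
  by (rule flinearI) (auto simp: tcollapse_def fscale_def fun_apply sum.distrib sum_distrib_left)

lemma flinear_tens: "flinear (tens a)" "flinear (\<lambda>a. tens a b)"
  by (rule flinearI; auto simp: tens_def fscale_def fun_apply algebra_simps)+

lemma lapp_tens: assumes "flinear f" shows "lapp f (tens a b) = tens (f a) b"
proof -
  have "(\<lambda>u. a u * b v) = fscale (b v) a" for v by (auto simp: fscale_def)
  then show ?thesis by (simp add: lapp_def tens_def flinearD(4)[OF assms]) (simp add: fscale_def mult.commute)
qed

lemma rapp_tens: assumes "flinear f" shows "rapp f (tens a b) = tens a (f b)"
proof -
  have "(\<lambda>v. a u * b v) = fscale (a u) b" for u by (auto simp: fscale_def)
  then show ?thesis by (simp add: rapp_def tens_def flinearD(4)[OF assms]) (simp add: fscale_def)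
qed

lemma flinear_lapp: assumes "flinear f" shows "flinear (lapp f)"
proof (rule flinearI)
  show "lapp f (F + G) = lapp f F + lapp f G" for F G
    using flinearD(1)[OF assms] by (auto simp: lapp_def plus_fun_def)
  show "lapp f (fscale c F) = fscale c (lapp f F)" for c F
    using flinearD(4)[OF assms] by (auto simp: lapp_def fscale_def fun_eq_iff)
qed

lemma flinear_rapp: assumes "flinear f" shows "flinear (rapp f)"
proof (rule flinearI)
  show "rapp f (F + G) = rapp f F + rapp f G" for F G
    using flinearD(1)[OF assms] by (auto simp: rapp_def plus_fun_def)
  show "rapp f (fscale c F) = fscale c (rapp f F)" for c F
    using flinearD(4)[OF assms] by (auto simp: rapp_def fscale_def fun_eq_iff)
qed

lemmas flinear_intros = flinear_add flinear_diff flinear_scale flinear_tmul flinear_tens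
  gr_bracket_flinear flinear_lapp flinear_rapp flinear_tcollapse flinear_id

lemmas tmul_linear = flinearD[OF flinear_tmul(1)] flinearD[OF flinear_tmul(2)]
lemmas tens_linear = flinearD[OF flinear_tens(1)] flinearD[OF flinear_tens(2)]

lemma even_double: "even (P + l + P + l)" for P l :: nat
  by presburger

lemma bracket_gr_bracket: "even m \<or> even n \<Longrightarrow> gr_bracket m n = bracket"
  by (auto simp: gr_bracket_def bracket_def fun_eq_iff)

lemma flinear_gen: "flinear gen"
  by (rule flinearI) (auto simp: gen_def fun_apply fscale_def fun_eq_iff split: list.splits)

lemma gen_zero: "gen 0 = 0"
  by (rule flinearD(5)[OF flinear_gen])

definition part :: "nat \<Rightarrow> ('x list \<Rightarrow> rat) \<Rightarrow> 'x list \<Rightarrow> rat" where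
  "part l F w = (if length w = l then F w else 0)"

lemma flinear_part: "flinear (part l)"
  by (rule flinearI) (auto simp: part_def fun_apply fscale_def)


section \<open>Words in weighted letters\<close>

text \<open>Positive degrees bound the length of a word by its weight; together with the finiteness
  assumption this leaves finitely many words of each weight.\<close>

locale weighted_words =
  fixes S :: "'i set" and deg :: "'i \<Rightarrow> nat"
  assumes deg_pos: "i \<in> S \<Longrightarrow> 1 \<le> deg i" and finite_deg: "finite {i \<in> S. deg i = n}"
begin

definition wgt :: "'i list \<Rightarrow> nat" where "wgt w = sum_list (map deg w)"

lemma wgt_simps[simp]: "wgt [] = 0" "wgt (i # w) = deg i + wgt w" "wgt (u @ w) = wgt u + wgt w"
  by (simp_all add: wgt_def)

definition words :: "nat \<Rightarrow> 'i list set" where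
  "words P = {w \<in> lists S. wgt w = P}"

lemma length_le_wgt: "w \<in> lists S \<Longrightarrow> length w \<le> wgt w"
  by (induction w) (use deg_pos in fastforce)+

lemma finite_words: "finite (words P)"
proof -
  have 1: "{i \<in> S. deg i \<le> P} = (\<Union>n\<le>P. {i \<in> S. deg i = n})" by auto
  have "finite {i \<in> S. deg i \<le> P}" unfolding 1 using finite_deg by blast
  then have "finite {w. set w \<subseteq> {i \<in> S. deg i \<le> P} \<and> length w \<le> P}"
    by (rule finite_lists_length_le)
  moreover have "deg i \<le> wgt w" if "i \<in> set w" for i w
    using that by (induction w) auto
  then have "words P \<subseteq> {w. set w \<subseteq> {i \<in> S. deg i \<le> P} \<and> length w \<le> P}"
    using length_le_wgt by (fastforce simp: words_def)
  ultimately show ?thesis by (rule rev_finite_subset)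
qed

definition T :: "nat \<Rightarrow> nat \<Rightarrow> ('i list \<Rightarrow> rat) set" where
  "T P l = {F. \<forall>w. F w \<noteq> 0 \<longrightarrow> w \<in> words P \<and> length w = l}"

lemma T_D: "F \<in> T P l \<Longrightarrow> F w \<noteq> 0 \<Longrightarrow> w \<in> words P \<and> length w = l"
  by (simp add: T_def)

lemma T_subspace: "frat.subspace (T P l)"
proof (rule frat.subspaceI)
  fix F G assume "F \<in> T P l" "G \<in> T P l"
  moreover have "F w \<noteq> 0 \<or> G w \<noteq> 0" if "(F + G) w \<noteq> 0" for w
    using that by (auto simp: fun_apply)
  ultimately show "F + G \<in> T P l" unfolding T_def by blast
qed (auto simp: T_def fscale_def fun_apply)

lemma T_word: "w \<in> lists S \<Longrightarrow> word w \<in> T (wgt w) (length w)"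
  by (auto simp: T_def word_def words_def)

lemma T_tmul: assumes "F \<in> T P l" "G \<in> T Q m" shows "tmul F G \<in> T (P + Q) (l + m)"
  unfolding T_def
proof (intro CollectI allI impI)
  fix w assume "tmul F G w \<noteq> 0"
  then obtain i where i: "i \<le> length w" "F (take i w) * G (drop i w) \<noteq> 0"
    unfolding tmul_def by (meson atMost_iff sum.not_neutral_contains_not_neutral)
  then have *: "take i w \<in> words P" "length (take i w) = l" "drop i w \<in> words Q" "length (drop i w) = m"
    using assms T_D by force+
  then have "take i w @ drop i w \<in> words (P + Q)" "length (take i w @ drop i w) = l + m"
    unfolding words_def mem_Collect_eq append_in_lists_conv wgt_simps(3) length_append by blast+
  then show "w \<in> words (P + Q) \<and> length w = l + m" by simp
qed

lemma part_T: "F \<in> T P m \<Longrightarrow> part l F = (if l = m then F else 0)"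
  by (rule ext) (use T_D in \<open>fastforce simp: part_def fun_apply\<close>)

lemma T_expand:
  assumes "F \<in> T P l"
  shows "F = (\<Sum>w | w \<in> words P \<and> length w = l. fscale (F w) (word w))"
proof
  fix v
  have "(\<Sum>w | w \<in> words P \<and> length w = l. fscale (F w) (word w)) v =
      (\<Sum>w | w \<in> words P \<and> length w = l. if w = v then F w else 0)"
    unfolding sum_fun_rat fscale_def word_def by (intro sum.cong refl) auto
  also have "\<dots> = F v" using finite_words[of P] T_D[OF assms, of v] by (auto simp: sum.delta')
  finally show "F v = (\<Sum>w | w \<in> words P \<and> length w = l. fscale (F w) (word w)) v" ..
qed

lemma T_eq_span: "T P l = frat.span (word ` {w \<in> words P. length w = l})"
proof
  show "T P l \<subseteq> frat.span (word ` {w \<in> words P. length w = l})"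
  proof
    fix F assume "F \<in> T P l"
    then show "F \<in> frat.span (word ` {w \<in> words P. length w = l})"
      by (subst T_expand) (auto intro!: frat.span_sum frat.span_scale intro: frat.span_base)
  qed
  show "frat.span (word ` {w \<in> words P. length w = l}) \<subseteq> T P l"
    using T_word by (intro frat.span_minimal T_subspace) (auto simp: words_def)
qed

lemma T_linear_eq:
  assumes "F \<in> T P l" "flinear f" "flinear g"
    and "\<And>w. w \<in> lists S \<Longrightarrow> wgt w = P \<Longrightarrow> length w = l \<Longrightarrow> f (word w) = g (word w)"
  shows "f F = g F"
  by (rule fpair.linear_eq_on[OF assms(2,3) assms(1)[unfolded T_eq_span]])
    (use assms(4) in \<open>auto simp: words_def\<close>)

lemma T_0: assumes "F \<in> T P 0" shows "F = fscale (F []) (word [])" "P \<noteq> 0 \<Longrightarrow> F = 0"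
proof -
  have 1: "F w = 0" if "w \<noteq> [] \<or> P \<noteq> 0" for w
    using T_D[OF assms, of w] that by (cases "F w = 0") (auto simp: words_def)
  show "F = fscale (F []) (word [])"
    by (rule ext) (simp add: 1 fscale_def word_def)
  show "F = 0" if "P \<noteq> 0"
    by (rule ext) (simp add: 1 that zero_fun_apply)
qed

lemma T_gt_zero: assumes "F \<in> T P l" "P < l" shows "F = 0"
proof
  fix w show "F w = 0 w"
    using T_D[OF assms(1), of w] length_le_wgt[of w] assms(2)
    by (cases "F w = 0") (auto simp: words_def fun_apply)
qed

lemma T_0_left: "F \<in> T 0 l \<Longrightarrow> l \<noteq> 0 \<Longrightarrow> F = 0"
  using T_gt_zero by blast

lemma T_tail: "F \<in> T P (Suc l) \<Longrightarrow> (\<lambda>u. F (x # u)) \<in> T (P - deg x) l"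
  unfolding T_def words_def
proof (intro CollectI allI impI)
  fix w assume F: "F \<in> {F. \<forall>w. F w \<noteq> 0 \<longrightarrow> w \<in> {w \<in> lists S. wgt w = P} \<and> length w = Suc l}" "F (x # w) \<noteq> 0"
  then have "x # w \<in> {w \<in> lists S. wgt w = P} \<and> length (x # w) = Suc l" by blast
  then show "w \<in> {w \<in> lists S. wgt w = P - deg x} \<and> length w = l" by auto
qed

text \<open>The Koszul sign for moving something of parity p past F. The desuspension gives a letter
  of weight d the parity of d + 1, so the parity of a word is weight plus length.\<close>

definition sg :: "nat \<Rightarrow> ('i list \<Rightarrow> rat) \<Rightarrow> 'i list \<Rightarrow> rat" where
  "sg p F = (\<lambda>w. (-1) ^ (p * (wgt w + length w)) * F w)"

lemma flinear_sg: "flinear (sg p)"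
  by (rule flinearI) (auto simp: sg_def fscale_def fun_apply algebra_simps)

lemma sg_T: "F \<in> T P l \<Longrightarrow> sg p F = fscale ((-1) ^ (p * (P + l))) F"
  using T_D by (fastforce simp: sg_def fscale_def words_def)

text \<open>Built from \<open>lapp\<close> and \<open>rapp\<close>, hence linear in G by
  construction; on pure tensors it is x.(a (x) b) = [x,a] (x) b +- a (x) xb, see
  \<open>act_tens\<close>.\<close>

definition act ::
    "nat \<Rightarrow> ('i list \<Rightarrow> rat) \<Rightarrow> ('i list \<times> 'i list \<Rightarrow> rat) \<Rightarrow> 'i list \<times> 'i list \<Rightarrow> rat" where
  "act p x G = lapp (tmul x) G - lapp (\<lambda>a. tmul (sg p a) x) G + rapp (tmul x) (lapp (sg p) G)"

lemma flinear_sg_tmul: "flinear (\<lambda>a. tmul (sg p a) x)"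
  by (rule flinear_compose[OF flinear_tmul(2) flinear_sg])

lemma flinear_act: "flinear (act p x)"
  unfolding act_def
  by (intro flinear_intros flinear_sg flinear_sg_tmul flinear_compose[of "rapp (tmul x)" "lapp (sg p)"])

lemma act_tens:
  assumes "a \<in> T P l"
  shows "act p x (tens a b) =
    tens (gr_bracket p (P + l) x a) b + fscale ((-1) ^ (p * (P + l))) (tens a (tmul x b))"
  unfolding act_def lapp_tens[OF flinear_tmul(1)] lapp_tens[OF flinear_sg_tmul] lapp_tens[OF flinear_sg]
    flinearD(4)[OF flinear_rapp[OF flinear_tmul(1)]] rapp_tens[OF flinear_tmul(1)] sg_T[OF assms] gr_bracket_def tmul_scale_left
    flinearD[OF flinear_tens(2)] ..

text \<open>The free graded Lie algebra on the letters, bigraded by weight and bracket length; the parity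
  of an element is the parity of the sum of these two degrees.\<close>

inductive_set lie_graph :: "(nat \<times> nat \<times> ('i list \<Rightarrow> rat)) set" where
  letter: "i \<in> S \<Longrightarrow> (deg i, 1, word [i]) \<in> lie_graph"
| zero: "(P, l, 0) \<in> lie_graph"
| add: "(P, l, x) \<in> lie_graph \<Longrightarrow> (P, l, y) \<in> lie_graph \<Longrightarrow> (P, l, x + y) \<in> lie_graph"
| scale: "(P, l, x) \<in> lie_graph \<Longrightarrow> (P, l, fscale c x) \<in> lie_graph"
| bracket: "(P, l, x) \<in> lie_graph \<Longrightarrow> (Q, m, y) \<in> lie_graph \<Longrightarrow>
    (P + Q, l + m, gr_bracket (P + l) (Q + m) x y) \<in> lie_graph"

definition lie :: "nat \<Rightarrow> nat \<Rightarrow> ('i list \<Rightarrow> rat) set" where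
  "lie P l = {x. (P, l, x) \<in> lie_graph}"

lemma lie_intros:
  "i \<in> S \<Longrightarrow> word [i] \<in> lie (deg i) 1" "0 \<in> lie P l"
  "x \<in> lie P l \<Longrightarrow> y \<in> lie P l \<Longrightarrow> x + y \<in> lie P l"
  "x \<in> lie P l \<Longrightarrow> fscale c x \<in> lie P l"
  "x \<in> lie P l \<Longrightarrow> z \<in> lie Q m \<Longrightarrow> gr_bracket (P + l) (Q + m) x z \<in> lie (P + Q) (l + m)"
  unfolding lie_def using lie_graph.intros by auto

lemma lie_induct[consumes 1, case_names letter zero add scale bracket]:
  assumes "x \<in> lie P l"
    and "\<And>i. i \<in> S \<Longrightarrow> R (deg i) 1 (word [i])"
    and "\<And>P l. R P l 0"
    and "\<And>P l x y. x \<in> lie P l \<Longrightarrow> R P l x \<Longrightarrow> y \<in> lie P l \<Longrightarrow> R P l y \<Longrightarrow> R P l (x + y)"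
    and "\<And>P l c x. x \<in> lie P l \<Longrightarrow> R P l x \<Longrightarrow> R P l (fscale c x)"
    and "\<And>P l Q m x y. x \<in> lie P l \<Longrightarrow> R P l x \<Longrightarrow> y \<in> lie Q m \<Longrightarrow> R Q m y \<Longrightarrow>
      R (P + Q) (l + m) (gr_bracket (P + l) (Q + m) x y)"
  shows "R P l x"
proof -
  have "(P, l, x) \<in> lie_graph" using assms(1) by (simp add: lie_def)
  then show ?thesis
    by (induction rule: lie_graph.induct) (use assms(2-) in \<open>auto simp: lie_def\<close>)
qed

lemma lie_subspace: "frat.subspace (lie P l)"
  by (auto simp: frat.subspace_def intro: lie_intros)

lemma T_gr_bracket: "x \<in> T P l \<Longrightarrow> y \<in> T Q m \<Longrightarrow> gr_bracket p q x y \<in> T (P + Q) (l + m)"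
  unfolding gr_bracket_def
  using T_tmul[of x P l y Q m] T_tmul[of y Q m x P l]
  by (auto intro!: frat.subspace_diff[OF T_subspace] frat.subspace_scale[OF T_subspace]
      simp: add.commute)

lemma lie_T: "x \<in> lie P l \<Longrightarrow> x \<in> T P l"
proof (induction rule: lie_induct)
  case (letter i) then show ?case using T_word[of "[i]"] by simp
next
  case (bracket P l Q m x y) then show ?case by (intro T_gr_bracket)
qed (auto intro: frat.subspace_0 frat.subspace_add frat.subspace_scale T_subspace)

lemma lie_Nil: "x \<in> lie P l \<Longrightarrow> x [] = 0"
  by (induction rule: lie_induct) (auto simp: word_def fscale_def gr_bracket_def tmul_Nil fun_apply)

lemma lie_0: "x \<in> lie P 0 \<Longrightarrow> x = 0"
  using T_0(1)[OF lie_T] lie_Nil by (metis frat.scale_zero_left)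

lemma lie_0_left: "x \<in> lie 0 l \<Longrightarrow> x = 0"
  using T_0_left[OF lie_T] lie_0 by (cases "l = 0") blast+

definition M :: "nat \<Rightarrow> nat \<Rightarrow> ('i list \<times> 'i list \<Rightarrow> rat) set" where
  "M P l = frat.span {tens a b | a b Q m Q' m'. a \<in> lie Q m \<and> b \<in> T Q' m' \<and> Q + Q' = P \<and> m + m' = l}"

lemma M_tens: "a \<in> lie Q m \<Longrightarrow> b \<in> T Q' m' \<Longrightarrow> Q + Q' = P \<Longrightarrow> m + m' = l \<Longrightarrow> tens a b \<in> M P l"
  unfolding M_def by (rule frat.span_base) blast

lemma M_subspace: "frat.subspace (M P l)"
  by (simp add: M_def)

lemma M_linear_eq:
  assumes "G \<in> M P l" "flinear f" "flinear g"
    and "\<And>a b Q m Q' m'. a \<in> lie Q m \<Longrightarrow> b \<in> T Q' m' \<Longrightarrow> Q + Q' = P \<Longrightarrow> m + m' = l \<Longrightarrow>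
      f (tens a b) = g (tens a b)"
  shows "f G = g G"
  by (rule fpair.linear_eq_on[OF assms(2,3) assms(1)[unfolded M_def]]) (use assms(4) in blast)

lemma M_linear_mem:
  assumes "G \<in> M P l" "flinear f" "frat.subspace X"
    and "\<And>a b Q m Q' m'. a \<in> lie Q m \<Longrightarrow> b \<in> T Q' m' \<Longrightarrow> Q + Q' = P \<Longrightarrow> m + m' = l \<Longrightarrow>
      f (tens a b) \<in> X"
  shows "f G \<in> X"
  by (rule span_linear_mem[OF assms(1)[unfolded M_def] assms(2,3)]) (use assms(4) in blast)

lemma act_M:
  assumes "x \<in> lie P l" "G \<in> M Q m" "even (p + P + l)"
  shows "act p x G \<in> M (P + Q) (l + m)"
proof (rule M_linear_mem[OF assms(2) flinear_act M_subspace])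
  fix a b Q1 m1 Q2 m2
  assume *: "a \<in> lie Q1 m1" "b \<in> T Q2 m2" "Q1 + Q2 = Q" "m1 + m2 = m"
  have "gr_bracket p (Q1 + m1) x a = gr_bracket (P + l) (Q1 + m1) x a"
    using assms(3) by (subst gr_bracket_parity[of p _ "P + l" "Q1 + m1"]) (auto simp: algebra_simps)
  then have "gr_bracket p (Q1 + m1) x a \<in> lie (P + Q1) (l + m1)"
    using lie_intros(5)[OF assms(1) *(1)] by simp
  then have 1: "tens (gr_bracket p (Q1 + m1) x a) b \<in> M (P + Q) (l + m)"
    by (rule M_tens) (use * in auto)
  have 2: "tens a (tmul x b) \<in> M (P + Q) (l + m)"
    by (rule M_tens[OF *(1) T_tmul[OF lie_T[OF assms(1)] *(2)]]) (use * in auto)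
  show "act p x (tens a b) \<in> M (P + Q) (l + m)"
    unfolding act_tens[OF lie_T[OF *(1)]]
    by (intro frat.subspace_add frat.subspace_scale M_subspace 1 2)
qed

end

section \<open>The Euler-type map from T to L (x) T\<close>

context weighted_words begin

text \<open>With p and r fixed only up to parity, later computations can replace them by successors
  when \<open>D\<close> raises the length.\<close>

lemma act_tens':
  assumes "a \<in> T P l" "even (r + P + l)"
  shows "act p x (tens a b) = tens (gr_bracket p r x a) b + fscale ((-1) ^ (p * r)) (tens a (tmul x b))"
proof -
  have "gr_bracket p (P + l) = (gr_bracket p r :: ('i list \<Rightarrow> rat) \<Rightarrow> _)"
    using assms(2) by (intro gr_bracket_parity) (auto simp: algebra_simps)
  moreover have "(-1) ^ (p * (P + l)) = ((-1) ^ (p * r) :: rat)"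
    using assms(2) by (auto simp: minus_one_power_iff)
  ultimately show ?thesis by (simp add: act_tens[OF assms(1)])
qed

text \<open>The diagonal action is a representation: the left factor uses the Jacobi identity, the
  right one the definition of the commutator, and the mixed terms cancel. After expansion into
  products only associativity and the parities of p, q, r matter.\<close>

lemma act_gr_bracket_tens:
  assumes x: "x \<in> T P l" "even (p + P + l)" and y: "y \<in> T Q m" "even (q + Q + m)"
    and a: "a \<in> T R n" "even (r + R + n)"
  shows "act (p + q) (gr_bracket p q x y) (tens a b) =
    act p x (act q y (tens a b)) - fscale ((-1) ^ (p * q)) (act q y (act p x (tens a b)))"
proof -
  have 1: "act p x (tens (gr_bracket q r y a) c) = tens (gr_bracket p (q + r) x (gr_bracket q r y a)) c
      + fscale ((-1) ^ (p * (q + r))) (tens (gr_bracket q r y a) (tmul x c))" for c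
    by (rule act_tens'[OF T_gr_bracket[OF y(1) a(1)]]) (use y(2) a(2) in auto)
  have 2: "act q y (tens (gr_bracket p r x a) c) = tens (gr_bracket q (p + r) y (gr_bracket p r x a)) c
      + fscale ((-1) ^ (q * (p + r))) (tens (gr_bracket p r x a) (tmul y c))" for c
    by (rule act_tens'[OF T_gr_bracket[OF x(1) a(1)]]) (use x(2) a(2) in auto)
  show ?thesis
    unfolding act_tens'[OF a] flinearD[OF flinear_act] 1 2
    unfolding gr_bracket_def
    by (cases "even p"; cases "even q"; cases "even r")
      (simp_all add: tmul_linear tens_linear tmul_assoc algebra_simps)
qed

lemma act_gr_bracket:
  assumes x: "x \<in> T P l" and y: "y \<in> T Q m" and G: "G \<in> M R n"
  shows "act (P + l + (Q + m)) (gr_bracket (P + l) (Q + m) x y) G = act (P + l) x (act (Q + m) y G)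
    - fscale ((-1) ^ ((P + l) * (Q + m))) (act (Q + m) y (act (P + l) x G))"
proof (rule M_linear_eq[OF G])
  fix a b R n assume "a \<in> lie R n"
  then show "act (P + l + (Q + m)) (gr_bracket (P + l) (Q + m) x y) (tens a b) =
      act (P + l) x (act (Q + m) y (tens a b))
      - fscale ((-1) ^ ((P + l) * (Q + m))) (act (Q + m) y (act (P + l) x (tens a b)))"
    by (intro act_gr_bracket_tens[OF x _ y, where r="R + n"]) (auto dest: lie_T)
qed (intro flinear_intros flinear_act flinear_compose[OF flinear_act flinear_act])+

text \<open>The derivation with value \<open>|i| \<cdot> i \<otimes> 1\<close> on a letter \<open>i\<close>, for the diagonal left action
  \<open>act\<close> (adjoint on \<open>L\<close>, multiplication on \<open>T\<close>) and the right multiplication of \<open>T\<close> on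
  \<open>L \<otimes> T\<close>.\<close>

primrec phiw :: "'i list \<Rightarrow> 'i list \<times> 'i list \<Rightarrow> rat" where
  "phiw [] = 0"
| "phiw (i # w) = fscale (of_nat (deg i)) (tens (word [i]) (word w)) + act (deg i + 1) (word [i]) (phiw w)"

lemma phiw_M: "w \<in> lists S \<Longrightarrow> phiw w \<in> M (wgt w) (length w)"
proof (induction w)
  case Nil then show ?case using frat.subspace_0[OF M_subspace] by simp
next
  case (Cons i w)
  have "tens (word [i]) (word w) \<in> M (wgt (i # w)) (length (i # w))"
    by (rule M_tens[OF lie_intros(1) T_word]) (use Cons in auto)
  moreover have "act (deg i + 1) (word [i]) (phiw w) \<in> M (deg i + wgt w) (1 + length w)"
    by (rule act_M[OF lie_intros(1)]) (use Cons in auto)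
  ultimately show ?case
    by (auto intro!: frat.subspace_add[OF M_subspace] frat.subspace_scale[OF M_subspace])
qed

text \<open>Linear extension of a weight preserving function defined on words, evaluated at a point
  of weight \<open>g z\<close>: only the finitely many words of that weight matter.\<close>

definition linext :: "('z \<Rightarrow> nat) \<Rightarrow> ('i list \<Rightarrow> 'z \<Rightarrow> rat) \<Rightarrow> ('i list \<Rightarrow> rat) \<Rightarrow> 'z \<Rightarrow> rat" where
  "linext g f F = (\<lambda>z. \<Sum>w\<in>words (g z). F w * f w z)"

lemma flinear_linext: "flinear (linext g f)"
  by (rule flinearI)
    (auto simp: linext_def fscale_def fun_apply algebra_simps sum.distrib sum_distrib_left)

lemma linext_word:
  assumes "w \<in> lists S" "\<And>z. f w z \<noteq> 0 \<Longrightarrow> g z = wgt w"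
  shows "linext g f (word w) = f w"
proof
  fix z
  have "linext g f (word w) z = (\<Sum>v\<in>words (g z). if v = w then f w z else 0)"
    unfolding linext_def word_def by (intro sum.cong) auto
  also have "\<dots> = f w z"
    using assms(1) assms(2)[of z] finite_words[of "g z"] by (cases "f w z = 0") (auto simp: words_def)
  finally show "linext g f (word w) z = f w z" .
qed

definition phi :: "('i list \<Rightarrow> rat) \<Rightarrow> 'i list \<times> 'i list \<Rightarrow> rat" where
  "phi = linext (\<lambda>z. wgt (fst z) + wgt (snd z)) phiw"

lemma flinear_phi: "flinear phi"
  unfolding phi_def by (rule flinear_linext)

text \<open>Justifies the definition of \<open>phi\<close> by \<open>linext\<close>, which evaluates
  at a pair of words using only the words of the same total weight.\<close>

lemma M_support: assumes "G \<in> M P l" "G z \<noteq> 0" shows "wgt (fst z) + wgt (snd z) = P"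
proof -
  let ?Y = "{G. \<forall>z. wgt (fst z) + wgt (snd z) \<noteq> P \<longrightarrow> G z = 0}"
  have "frat.subspace ?Y" by (rule frat.subspaceI) (auto simp: fun_apply fscale_def)
  then have "G \<in> ?Y"
  proof (rule M_linear_mem[OF assms(1) flinear_id])
    fix a b Q m Q' m'
    assume *: "a \<in> lie Q m" "b \<in> T Q' m'" "Q + Q' = P"
    show "tens a b \<in> ?Y"
      using T_D[OF lie_T[OF *(1)]] T_D[OF *(2)] *(3) by (fastforce simp: tens_def words_def)
  qed
  then show ?thesis using assms(2) by blast
qed

lemma phi_word: "w \<in> lists S \<Longrightarrow> phi (word w) = phiw w"
  unfolding phi_def using M_support[OF phiw_M] by (intro linext_word) auto

lemma phi_letter:
  assumes "i \<in> S" "F \<in> T Q m"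
  shows "phi (tmul (word [i]) F) =
    fscale (of_nat (deg i)) (tens (word [i]) F) + act (deg i + 1) (word [i]) (phi F)"
  by (rule T_linear_eq[OF assms(2)];
      (intro flinear_intros flinear_compose[OF flinear_phi] flinear_compose[OF flinear_act] flinear_phi)?)
    (use assms(1) in \<open>simp add: tmul_word phi_word\<close>)

lemma phi_M: assumes "F \<in> T P l" shows "phi F \<in> M P l"
proof -
  have "phi F = (\<Sum>w | w \<in> words P \<and> length w = l. fscale (F w) (phiw w))"
    by (subst T_expand[OF assms])
      (auto simp: flinearD[OF flinear_phi] phi_word words_def intro!: sum.cong)
  also have "\<dots> \<in> M P l"
    using phiw_M by (intro frat.subspace_sum[OF M_subspace] frat.subspace_scale[OF M_subspace])
      (auto simp: words_def)
  finally show ?thesis .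
qed

text \<open>The formula holds for letters and is stable under brackets. In the graded commutator of
  the formulas for x and y the terms x (x) yF and y (x) xF cancel, while [x,y] (x) F appears with
  coefficient P' from one order and P from the other; the weights therefore add up.\<close>

lemma phi_lie:
  assumes "x \<in> lie P l" "F \<in> T Q m"
  shows "phi (tmul x F) = fscale (of_nat P) (tens x F) + act (P + l) x (phi F)"
  using assms
proof (induction arbitrary: F Q m rule: lie_induct)
  case (letter i) then show ?case using phi_letter by simp
next
  case (zero P l)
  have "act (P + l) 0 G = 0" for G
    by (rule ext) (simp add: act_def lapp_def rapp_def tmul_zero_left tmul_zero_right fun_apply)
  then show ?case by (simp add: tmul_zero_left flinearD[OF flinear_phi] tens_linear)
next
  case (add P l x y)
  have "act (P + l) (x + y) G = act (P + l) x G + act (P + l) y G" for G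
    by (auto simp: act_def lapp_def rapp_def tmul_linear fun_apply)
  then show ?case using add by (simp add: tmul_linear flinearD[OF flinear_phi] tens_linear algebra_simps)
next
  case (scale P l c x)
  have "act (P + l) (fscale c x) G = fscale c (act (P + l) x G)" for G
    by (rule ext, simp add: act_def lapp_def rapp_def tmul_linear fun_apply)
      (simp add: fscale_def fun_apply algebra_simps)
  then show ?case using scale
    by (simp add: tmul_linear flinearD[OF flinear_phi] tens_linear algebra_simps)
next
  case (bracket P l P' l' x y)
  let ?p = "P + l" and ?q = "P' + l'"
  note x = lie_T[OF bracket.hyps(1)] and y = lie_T[OF bracket.hyps(2)]
  have xF: "tmul x F \<in> T (P + Q) (l + m)" and yF: "tmul y F \<in> T (P' + Q) (l' + m)"
    using T_tmul x y bracket.prems by auto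
  have xy: "phi (tmul x (tmul y F)) = fscale (of_nat P) (tens x (tmul y F)) +
      act ?p x (fscale (of_nat P') (tens y F) + act ?q y (phi F))"
    using bracket.IH(1)[OF yF] bracket.IH(2)[OF bracket.prems] by simp
  have yx: "phi (tmul y (tmul x F)) = fscale (of_nat P') (tens y (tmul x F)) +
      act ?q y (fscale (of_nat P) (tens x F) + act ?p x (phi F))"
    using bracket.IH(2)[OF xF] bracket.IH(1)[OF bracket.prems] by simp
  have c: "P + P' + (l + l') = ?p + ?q" by simp
  have "phi (tmul (gr_bracket ?p ?q x y) F) =
      phi (tmul x (tmul y F)) - fscale ((-1) ^ (?p * ?q)) (phi (tmul y (tmul x F)))"
    by (simp add: gr_bracket_def tmul_linear tmul_assoc flinearD[OF flinear_phi])
  also have "\<dots> = fscale (of_nat (P + P')) (tens (gr_bracket ?p ?q x y) F)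
      + act (?p + ?q) (gr_bracket ?p ?q x y) (phi F)"
    unfolding act_gr_bracket[OF x y phi_M[OF bracket.prems]] xy yx flinearD[OF flinear_act]
      act_tens[OF x] act_tens[OF y]
    unfolding gr_bracket_def
    by (cases "even ?p"; cases "even ?q")
      (simp_all add: tens_linear algebra_simps minus_one_power_iff)
  finally show ?case unfolding c .
qed

text \<open>The two terms of the diagonal action multiply to [x,a] b +- a x b = x a b.\<close>

lemma tcollapse_act:
  assumes "x \<in> T P l" "G \<in> M Q m"
  shows "tcollapse (act (P + l) x G) = tmul x (tcollapse G)"
proof (rule M_linear_eq[OF assms(2)])
  fix a b R n R' n' assume a: "a \<in> lie R n" "b \<in> T R' n'"
  show "tcollapse (act (P + l) x (tens a b)) = tmul x (tcollapse (tens a b))"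
    unfolding act_tens[OF lie_T[OF a(1)]] flinearD[OF flinear_tcollapse] tcollapse_tens
    by (simp add: gr_bracket_def tmul_linear tmul_assoc)
qed (intro flinear_compose[OF flinear_tcollapse] flinear_compose[OF flinear_tmul(1)]
    flinear_act flinear_tcollapse)+

text \<open>Each letter of a word returns the whole word times its own degree, and the degrees sum
  to the weight.\<close>

lemma tcollapse_phi:
  assumes "F \<in> T P l" shows "tcollapse (phi F) = fscale (of_nat P) F"
proof (rule T_linear_eq[OF assms])
  fix w assume "w \<in> lists S" "wgt w = P"
  moreover have "tcollapse (phiw w) = fscale (of_nat (wgt w)) (word w)" if "w \<in> lists S" for w
    using that
  proof (induction w)
    case Nil
    then show ?case using flinearD(5)[OF flinear_tcollapse] by simp
  next
    case (Cons i w)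
    have "tcollapse (act (deg i + 1) (word [i]) (phiw w)) = tmul (word [i]) (tcollapse (phiw w))"
      using Cons tcollapse_act[OF T_word[of "[i]"] phiw_M[of w]] by simp
    then show ?case
      using Cons by (simp add: flinearD[OF flinear_tcollapse] tcollapse_tens tmul_linear tmul_word
          frat.scale_left_distrib)
  qed
  ultimately show "tcollapse (phi (word w)) = fscale (of_nat P) (word w)" by (simp add: phi_word)
qed (intro flinear_intros flinear_compose[OF flinear_tcollapse] flinear_phi)+

text \<open>This is id (x) counit, the projection of L (x) T onto L (x) 1.\<close>

definition retr :: "('i list \<times> 'i list \<Rightarrow> rat) \<Rightarrow> 'i list \<Rightarrow> rat" where
  "retr G = (\<lambda>u. G (u, []))"

lemma flinear_retr: "flinear retr"
  by (rule flinearI) (auto simp: retr_def fscale_def fun_apply)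

lemma retr_tens: "retr (tens a b) = fscale (b []) a"
  by (auto simp: retr_def tens_def fscale_def)

lemma retr_M: assumes "G \<in> M P l" shows "retr G \<in> lie P l"
proof (rule M_linear_mem[OF assms flinear_retr lie_subspace])
  fix a b Q m Q' m'
  assume *: "a \<in> lie Q m" "b \<in> T Q' m'" "Q + Q' = P" "m + m' = l"
  show "retr (tens a b) \<in> lie P l"
  proof (cases "b [] = 0")
    case True then show ?thesis by (simp add: retr_tens lie_intros)
  next
    case False
    then have "Q' = 0" "m' = 0" using T_D[OF *(2) False] by (auto simp: words_def)
    then show ?thesis using * by (simp add: retr_tens lie_intros)
  qed
qed

text \<open>Take F = 1 in \<open>phi_lie\<close>: since phi 1 = 0, only P times x (x) 1 remains. On
  words \<open>retr\<close> after \<open>phi\<close> is the iterated bracket weighted by the degree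
  of the last letter, so this is the Dynkin-Specht-Wever identity.\<close>

lemma retr_phi_lie: assumes "x \<in> lie P l" shows "retr (phi x) = fscale (of_nat P) x"
proof -
  have 1: "tmul x (word []) = x"
  proof (rule T_linear_eq[OF lie_T[OF assms]])
    show "tmul (word w) (word []) = word w" for w by (simp add: tmul_word)
  qed (intro flinear_tmul flinear_id)+
  have "phi (tmul x (word [])) = fscale (of_nat P) (tens x (word [])) + act (P + l) x (phi (word []))"
    by (rule phi_lie[OF assms T_word]) simp
  then have "phi x = fscale (of_nat P) (tens x (word []))"
    by (simp add: 1 phi_word flinearD[OF flinear_act])
  then show ?thesis by (simp add: flinearD[OF flinear_retr] retr_tens) (simp add: word_def)
qed

end

section \<open>The quadratic derivation on T, L and L (x) T\<close>

locale quadratic_letters = weighted_words S deg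
  for S :: "'i set" and deg :: "'i \<Rightarrow> nat" +
  fixes delta :: "'i \<Rightarrow> 'i list \<Rightarrow> rat"
  assumes delta_lie: "i \<in> S \<Longrightarrow> delta i \<in> lie (deg i) 2"
begin

primrec dw :: "'i list \<Rightarrow> 'i list \<Rightarrow> rat" where
  "dw [] = 0"
| "dw (i # w) = tmul (delta i) (word w) + fscale ((-1) ^ (deg i + 1)) (tmul (word [i]) (dw w))"

lemma dw_T: "w \<in> lists S \<Longrightarrow> dw w \<in> T (wgt w) (Suc (length w))"
proof (induction w)
  case Nil then show ?case using frat.subspace_0[OF T_subspace] by simp
next
  case (Cons i w)
  have "tmul (delta i) (word w) \<in> T (deg i + wgt w) (2 + length w)"
    by (rule T_tmul[OF lie_T[OF delta_lie] T_word]) (use Cons in auto)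
  moreover have "tmul (word [i]) (dw w) \<in> T (deg i + wgt w) (1 + Suc (length w))"
    by (rule T_tmul) (use Cons T_word[of "[i]"] in auto)
  ultimately show ?case
    unfolding dw.simps using Cons
    by (intro frat.subspace_add[OF T_subspace] frat.subspace_scale[OF T_subspace]) simp_all
qed

definition D :: "('i list \<Rightarrow> rat) \<Rightarrow> 'i list \<Rightarrow> rat" where
  "D = linext wgt dw"

lemma flinear_D: "flinear D"
  unfolding D_def by (rule flinear_linext)

lemmas D_linear = flinearD[OF flinear_D]

lemma D_word: "w \<in> lists S \<Longrightarrow> D (word w) = dw w"
  unfolding D_def using T_D[OF dw_T] by (intro linext_word) (auto simp: words_def)

lemma D_letter: "i \<in> S \<Longrightarrow> D (word [i]) = delta i"
proof -
  assume i: "i \<in> S"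
  have "tmul (delta i) (word []) = delta i"
  proof (rule T_linear_eq[OF lie_T[OF delta_lie[OF i]]])
    show "tmul (word w) (word []) = word w" for w by (simp add: tmul_word)
  qed (intro flinear_tmul flinear_id)+
  then show ?thesis using i by (simp add: D_word tmul_zero_right)
qed

lemma D_T: assumes "F \<in> T P l" shows "D F \<in> T P (Suc l)"
proof (rule span_linear_mem[OF assms[unfolded T_eq_span] flinear_D T_subspace])
  show "D x \<in> T P (Suc l)" if "x \<in> word ` {w \<in> words P. length w = l}" for x
    using that dw_T by (auto simp: words_def D_word in_lists_conv_set)
qed

lemma D_Nil: assumes "F \<in> T P l" shows "D F [] = 0"
  using T_D[OF D_T[OF assms], of "[]"] by (cases "D F [] = 0") auto

lemma D_letter_tmul:
  assumes "i \<in> S" "F \<in> T P l"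
  shows "D (tmul (word [i]) F) = tmul (delta i) F + fscale ((-1) ^ (deg i + 1)) (tmul (word [i]) (D F))"
  by (rule T_linear_eq[OF assms(2)];
      (intro flinear_intros flinear_compose[OF flinear_D] flinear_compose[OF flinear_tmul(1) flinear_D])?)
    (use assms(1) in \<open>simp add: tmul_word D_word\<close>)

lemma D_word_tmul:
  assumes "w \<in> lists S" "F \<in> T P l"
  shows "D (tmul (word w) F) = tmul (dw w) F + fscale ((-1) ^ (wgt w + length w)) (tmul (word w) (D F))"
  using assms(1)
proof (induction w)
  case Nil then show ?case by (simp add: tmul_word_Nil tmul_zero_left)
next
  case (Cons i w)
  then have i: "i \<in> S" and w: "w \<in> lists S" by auto
  have "tmul (word w) F \<in> T (wgt w + P) (length w + l)" by (rule T_tmul[OF T_word[OF w] assms(2)])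
  from D_letter_tmul[OF i this] Cons.IH
  have "D (tmul (tmul (word [i]) (word w)) F) = tmul (delta i) (tmul (word w) F) +
     fscale ((-1) ^ (deg i + 1)) (tmul (word [i]) (tmul (dw w) F +
        fscale ((-1) ^ (wgt w + length w)) (tmul (word w) (D F))))"
    by (simp add: tmul_assoc)
  then show ?case
    by (simp add: tmul_word tmul_assoc[symmetric] tmul_linear power_add algebra_simps)
qed

lemma D_tmul:
  assumes "F \<in> T P l" "G \<in> T Q m"
  shows "D (tmul F G) = tmul (D F) G + fscale ((-1) ^ (P + l)) (tmul F (D G))"
  by (rule T_linear_eq[OF assms(1)];
      (intro flinear_intros flinear_compose[OF flinear_D] flinear_compose[OF flinear_tmul(2) flinear_D])?)
    (use assms(2) in \<open>auto simp: D_word_tmul D_word\<close>)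

lemma D_tmul':
  assumes "F \<in> T P l" "G \<in> T Q m" "even (p + P + l)"
  shows "D (tmul F G) = tmul (D F) G + fscale ((-1) ^ p) (tmul F (D G))"
proof -
  have "(-1) ^ (P + l) = ((-1) ^ p :: rat)" using assms(3) by (auto simp: minus_one_power_iff)
  then show ?thesis by (simp add: D_tmul[OF assms(1,2)])
qed

lemma D_gr_bracket:
  assumes "x \<in> T P l" "y \<in> T Q m" "even (p + P + l)" "even (q + Q + m)"
  shows "D (gr_bracket p q x y) =
    gr_bracket (Suc p) q (D x) y + fscale ((-1) ^ p) (gr_bracket p (Suc q) x (D y))"
  unfolding gr_bracket_def D_linear D_tmul'[OF assms(1,2,3)] D_tmul'[OF assms(2,1,4)]
  by (cases "even p"; cases "even q") (simp_all add: algebra_simps)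

lemma D_lie: "x \<in> lie P l \<Longrightarrow> D x \<in> lie P (Suc l)"
proof (induction rule: lie_induct)
  case (letter i)
  then show ?case using delta_lie by (simp add: D_letter numeral_2_eq_2)
next
  case (bracket P l Q m x y)
  have "D (gr_bracket (P + l) (Q + m) x y) = gr_bracket (P + Suc l) (Q + m) (D x) y
      + fscale ((-1) ^ (P + l)) (gr_bracket (P + l) (Q + Suc m) x (D y))"
    using D_gr_bracket[OF bracket.hyps[THEN lie_T] even_double even_double] by simp
  then show ?case
    using lie_intros(5)[OF bracket.IH(1) bracket.hyps(2)] lie_intros(5)[OF bracket.hyps(1) bracket.IH(2)]
    by (simp only:, intro lie_intros(3,4)) simp_all
qed (auto simp: D_linear intro: lie_intros)

text \<open>The dual description of D as an operation on arguments: merge the first two letters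
  through the structure constants \<open>delta\<close>, or pass to the tail. It is checked on F =
  \<open>word w\<close> and is what matches D with the bar differential.\<close>

lemma D_Cons:
  assumes F: "F \<in> T P l" and x: "x \<in> S" and y: "y \<in> S"
  shows "D F (x # y # v) = (\<Sum>c | c \<in> S \<and> deg c = deg x + deg y. delta c [x, y] * F (c # v))
    + (-1) ^ (deg x + 1) * D (\<lambda>u. F (x # u)) (y # v)"
proof -
  let ?C = "{c \<in> S. deg c = deg x + deg y}"
  \<comment> \<open>Scalars are functions on \<open>unit\<close>, so that the results on linear maps
    between function spaces also cover functionals.\<close>
  define f where "f F = (\<lambda>_::unit. D F (x # y # v))" for F
  define g where "g F = (\<lambda>_::unit. (\<Sum>c\<in>?C. delta c [x, y] * F (c # v))
    + (-1) ^ (deg x + 1) * D (\<lambda>u. F (x # u)) (y # v))" for F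
  have f: "flinear f"
    by (rule flinearI; unfold f_def D_linear) (auto simp: fun_apply fscale_def)
  have g: "flinear g"
  proof (rule flinearI)
    show "g (F + G) = g F + g G" for F G
    proof -
      have 1: "(\<lambda>u. (F + G) (x # u)) = (\<lambda>u. F (x # u)) + (\<lambda>u. G (x # u))" by (auto simp: fun_apply)
      show ?thesis
        unfolding g_def 1 D_linear by (rule ext) (simp only: fun_apply sum.distrib distrib_left add_ac)
    qed
    show "g (fscale c F) = fscale c (g F)" for c F
    proof -
      have 1: "(\<lambda>u. fscale c F (x # u)) = fscale c (\<lambda>u. F (x # u))" by (auto simp: fscale_def)
      show ?thesis
        unfolding g_def 1 D_linear
        by (rule ext) (simp add: fscale_def sum_distrib_left algebra_simps)
    qed
  qed
  have "f F = g F"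
  proof (rule T_linear_eq[OF F f g])
    fix w assume w: "w \<in> lists S"
    show "f (word w) = g (word w)"
    proof (cases w)
      case Nil
      have "(\<lambda>u. word [] (x # u)) = 0" by (auto simp: word_def fun_apply)
      then show ?thesis using Nil by (auto simp: f_def g_def D_word D_linear fun_apply) (simp add: word_def)
    next
      case (Cons c w')
      then have c: "c \<in> S" and w': "w' \<in> lists S" using w by auto
      note dT = T_D[OF lie_T[OF delta_lie[OF c]]]
      have d0: "delta c [] = 0" "delta c [z] = 0" for z
        using dT[of "[]"] dT[of "[z]"] by (cases "delta c [] = 0"; cases "delta c [z] = 0"; force)+
      have "(\<lambda>u. delta c (x # y # u)) = (\<lambda>u. if u = [] then delta c [x, y] else 0)"
        using dT by fastforce
      then have 1: "tmul (delta c) G (x # y # v) = delta c [x, y] * G v" for G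
        by (simp add: tmul_Cons d0 tmul_unit)
      have 2: "tmul (word [c]) G (x # u) = (if c = x then G u else 0)" for G u
        by (simp add: tmul_Cons word_Cons tmul_word_Nil tmul_zero_left fun_apply) (simp add: word_def)
      have 3: "(\<lambda>u. word (c # w') (x # u)) = (if c = x then word w' else 0)"
        by (rule word_Cons)
      have "(\<Sum>d\<in>?C. delta d [x, y] * word (c # w') (d # v)) =
          (\<Sum>d\<in>?C. if d = c then delta c [x, y] * word w' v else 0)"
        by (intro sum.cong) (auto simp: word_def)
      also have "\<dots> = delta c [x, y] * word w' v"
      proof (cases "c \<in> ?C")
        case True then show ?thesis using finite_deg[of "deg x + deg y"] by (auto simp: sum.delta)
      next
        case False
        then have "delta c [x, y] = 0" using dT[of "[x, y]"] c
          by (cases "delta c [x, y] = 0") (auto simp: words_def)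
        then show ?thesis by (simp add: sum.neutral)
      qed
      finally have 4: "(\<Sum>d\<in>?C. delta d [x, y] * word (c # w') (d # v)) = delta c [x, y] * word w' v" .
      show ?thesis
        using c w' by (auto simp: f_def g_def Cons D_word 3 4 fun_apply fscale_def 1 2 D_linear)
    qed
  qed
  then show ?thesis by (simp add: f_def g_def fun_eq_iff)
qed

text \<open>D (x) 1 + 1 (x) D; the argument 1 of \<open>sg\<close> is the odd parity of D.\<close>

definition dt :: "('i list \<times> 'i list \<Rightarrow> rat) \<Rightarrow> 'i list \<times> 'i list \<Rightarrow> rat" where
  "dt G = lapp D G + rapp D (lapp (sg 1) G)"

lemma flinear_dt: "flinear dt"
  unfolding dt_def by (intro flinear_intros flinear_D flinear_sg
    flinear_compose[OF flinear_rapp[OF flinear_D] flinear_lapp[OF flinear_sg]])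

lemmas dt_linear = flinearD[OF flinear_dt]

lemma dt_tens:
  assumes "a \<in> T P l" "even (r + P + l)"
  shows "dt (tens a b) = tens (D a) b + fscale ((-1) ^ r) (tens a (D b))"
proof -
  have 1: "(-1) ^ (P + l) = ((-1) ^ r :: rat)" using assms(2) by (auto simp: minus_one_power_iff)
  show ?thesis
    unfolding dt_def lapp_tens[OF flinear_D] lapp_tens[OF flinear_sg] rapp_tens[OF flinear_D]
      sg_T[OF assms(1)] tens_linear flinearD[OF flinear_rapp[OF flinear_D]] by (simp add: 1)
qed

text \<open>A Leibniz rule for the action, inherited from the derivation property of D on brackets
  in the left factor and on products in the right one.\<close>

lemma dt_act:
  assumes x: "x \<in> T P l" "even (p + P + l)" and G: "G \<in> M Q m"
  shows "dt (act p x G) = act (Suc p) (D x) G + fscale ((-1) ^ p) (act p x (dt G))"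
proof (rule M_linear_eq[OF G])
  fix a b R n R' n'
  assume "a \<in> lie R n" and b: "b \<in> T R' n'"
  then have a: "a \<in> T R n" by (simp add: lie_T)
  obtain r where r: "even (r + R + n)" "even (Suc r + R + Suc n)"
    by (rule that[of "R + n"]) auto
  have 1: "dt (tens (gr_bracket p r x a) c) = tens (D (gr_bracket p r x a)) c +
      fscale ((-1) ^ (p + r)) (tens (gr_bracket p r x a) (D c))" for c
    by (rule dt_tens[OF T_gr_bracket[OF x(1) a]]) (use x r in auto)
  note 2 = dt_tens[OF a r(1)]
  show "dt (act p x (tens a b)) = act (Suc p) (D x) (tens a b)
      + fscale ((-1) ^ p) (act p x (dt (tens a b)))"
    unfolding act_tens'[OF a r(1)] dt_linear 1 2 flinearD[OF flinear_act] act_tens'[OF D_T[OF a] r(2)]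
      D_gr_bracket[OF x(1) a x(2) r(1)] D_tmul'[OF x(1) b x(2)]
    unfolding gr_bracket_def
    by (cases "even p"; cases "even r")
      (simp_all add: tens_linear tmul_linear algebra_simps)
qed (intro flinear_intros flinear_act flinear_dt flinear_compose[OF flinear_dt] flinear_compose[OF flinear_act])+

text \<open>Induction on words. What makes it work is that \<open>delta i\<close> is a Lie element
  of the same weight as i: \<open>phi_lie\<close> then applies to it with the same coefficient
  \<open>deg i\<close> as to the letter.\<close>

lemma dt_phi:
  assumes "F \<in> T P l" shows "dt (phi F) = phi (D F)"
proof (rule T_linear_eq[OF assms])
  fix w assume "w \<in> lists S"
  then show "dt (phi (word w)) = phi (D (word w))"
  proof (induction w)
    case Nil
    then show ?case by (simp add: phi_word D_word dt_linear flinearD[OF flinear_phi])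
  next
    case (Cons i w)
    then have i: "i \<in> S" and w: "w \<in> lists S" by auto
    note li = lie_intros(1)[OF i]
    note wT = T_word[OF w]
    have 1: "dt (act (deg i + 1) (word [i]) (phi (word w))) =
        act (deg i + 2) (delta i) (phi (word w)) +
        fscale ((-1) ^ (deg i + 1)) (act (deg i + 1) (word [i]) (phi (D (word w))))"
      using dt_act[OF lie_T[OF li] _ phi_M[OF wT], of "deg i + 1"] Cons.IH i by (simp add: D_letter)
    have 2: "phi (tmul (delta i) (word w)) = fscale (of_nat (deg i)) (tens (delta i) (word w)) +
        act (deg i + 2) (delta i) (phi (word w))"
      by (rule phi_lie[OF delta_lie[OF i] wT])
    have 3: "phi (tmul (word [i]) (D (word w))) = fscale (of_nat (deg i)) (tens (word [i]) (D (word w))) +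
        act (deg i + 1) (word [i]) (phi (D (word w)))"
      by (rule phi_lie[OF li D_T[OF wT]])
    have "phi (D (word (i # w))) = phi (tmul (delta i) (word w)) +
        fscale ((-1) ^ (deg i + 1)) (phi (tmul (word [i]) (D (word w))))"
      using D_letter_tmul[OF i wT] by (simp add: tmul_word flinearD[OF flinear_phi])
    moreover have "phi (word (i # w)) = fscale (of_nat (deg i)) (tens (word [i]) (word w)) +
        act (deg i + 1) (word [i]) (phi (word w))"
      using i w by (simp add: phi_word)
    moreover have "dt (tens (word [i]) (word w)) =
        tens (delta i) (word w) + fscale ((-1) ^ (deg i + 1)) (tens (word [i]) (D (word w)))"
      using dt_tens[OF lie_T[OF li], of "deg i + 1" "word w"] i by (simp add: D_letter)
    ultimately show ?case
      by (simp only: 1 2 3 dt_linear) (simp add: algebra_simps)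
  qed
qed (intro flinear_compose[OF flinear_dt flinear_phi] flinear_compose[OF flinear_phi flinear_D])+

lemma tcollapse_dt:
  assumes "G \<in> M P l" shows "tcollapse (dt G) = D (tcollapse G)"
proof (rule M_linear_eq[OF assms])
  fix a b Q m Q' m' assume a: "a \<in> lie Q m" and b: "b \<in> T Q' m'"
  show "tcollapse (dt (tens a b)) = D (tcollapse (tens a b))"
    using dt_tens[OF lie_T[OF a] even_double, of b]
    by (simp add: flinearD[OF flinear_tcollapse] tcollapse_tens D_tmul[OF lie_T[OF a] b])
qed (intro flinear_compose[OF flinear_D] flinear_compose[OF flinear_tcollapse] flinear_dt flinear_tcollapse)+

text \<open>The term a (x) D b is lost because D b vanishes on the empty word.\<close>

lemma retr_dt:
  assumes "G \<in> M P l" shows "retr (dt G) = D (retr G)"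
proof (rule M_linear_eq[OF assms])
  fix a b Q m Q' m' assume a: "a \<in> lie Q m" and b: "b \<in> T Q' m'"
  show "retr (dt (tens a b)) = D (retr (tens a b))"
    using dt_tens[OF lie_T[OF a] even_double, of b]
    by (simp add: flinearD[OF flinear_retr] retr_tens D_linear D_Nil[OF b])
qed (intro flinear_compose[OF flinear_D] flinear_compose[OF flinear_retr] flinear_dt flinear_retr)+

lemma tcollapse_M: assumes "G \<in> M P l" shows "tcollapse G \<in> T P l"
  by (rule M_linear_mem[OF assms flinear_tcollapse T_subspace])
    (auto simp: tcollapse_tens intro!: T_tmul dest: lie_T)

text \<open>At l = 0 the truncated subtraction asks for y in \<open>X P 0\<close>; for X inside T
  its boundary has length 1, so the condition correctly says that there is no nonzero cycle.\<close>

definition exact_at :: "(nat \<Rightarrow> nat \<Rightarrow> ('i list \<Rightarrow> rat) set) \<Rightarrow> nat \<Rightarrow> nat \<Rightarrow> bool" where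
  "exact_at X P l \<longleftrightarrow> (\<forall>z\<in>X P l. D z = 0 \<longrightarrow> (\<exists>y\<in>X P (l - 1). D y = z))"

text \<open>A homotopy-like operator of degree \<open>-1\<close>; then \<open>1 - D h - h D\<close> is a chain map homotopic to
  the identity whose values are cycles.\<close>

lemma homotopy_exists:
  assumes "\<And>P l. frat.subspace (X P l)" "\<And>P l. X P l \<subseteq> T P l" "\<And>P l x. x \<in> X P l \<Longrightarrow> D x \<in> X P (Suc l)"
  obtains h where "flinear h" "\<And>P l x. x \<in> X P (Suc l) \<Longrightarrow> h x \<in> X P l"
    "\<And>P x. x \<in> X P 0 \<Longrightarrow> h x = 0" "\<And>P l x. x \<in> X P l \<Longrightarrow> D (h (D x)) = D x"
proof -
  have "\<exists>g. range g \<subseteq> X P l \<and> flinear g \<and> (\<forall>x\<in>D ` X P l. D (g x) = x)" for P l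
    by (rule fpair.linear_exists_right_inverse_on[OF flinear_D assms(1)])
  then obtain g where g: "\<And>P l. range (g P l) \<subseteq> X P l" "\<And>P l. flinear (g P l)"
    "\<And>P l x. x \<in> X P l \<Longrightarrow> D (g P l (D x)) = D x"
    by (metis image_eqI)
  define part where "part P l F = (\<lambda>w. if wgt w = P \<and> length w = l then F w else 0)"
    for P l and F :: "'i list \<Rightarrow> rat"
  have part_lin: "flinear (part P l)" for P l
    by (rule flinearI) (auto simp: part_def fscale_def fun_apply)
  have part_T: "part Q m F = (if P = Q \<and> l = m then F else 0)" if "F \<in> T P l" for P l Q m F
    by (rule ext) (use T_D[OF that] in \<open>auto simp: part_def words_def fun_apply\<close>)
  \<comment> \<open>The local inverses are glued: at v only the component of F of weight
    \<open>wgt v\<close> and length one larger is used, since only its image can be nonzero at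
    v.\<close>
  define h where "h F v = g (wgt v) (length v) (part (wgt v) (Suc (length v)) F) v" for F v
  have h_lin: "flinear h"
  proof (rule flinearI)
    show "h (F + G) = h F + h G" for F G
      by (rule ext) (simp add: h_def flinearD[OF part_lin] flinearD[OF g(2)] fun_apply)
    show "h (fscale c F) = fscale c (h F)" for c F
      by (rule ext, simp add: h_def flinearD[OF part_lin] flinearD[OF g(2)])
        (simp add: fscale_def h_def)
  qed
  have h_X: "h x = g P l x" if "x \<in> X P (Suc l)" for P l x
  proof
    fix v
    have x: "x \<in> T P (Suc l)" using that assms(2) by blast
    have gx: "g P l x \<in> T P l" using g(1) assms(2) by blast
    show "h x v = g P l x v"
    proof (cases "wgt v = P \<and> length v = l")
      case True then show ?thesis by (auto simp: h_def part_T[OF x])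
    next
      case False
      then have "g P l x v = 0" using T_D[OF gx, of v] by (auto simp: words_def)
      then show ?thesis using False by (auto simp: h_def part_T[OF x] flinearD[OF g(2)] fun_apply)
    qed
  qed
  show ?thesis
  proof (rule that[of h])
    fix P x assume "x \<in> X P 0"
    then have "x \<in> T P 0" using assms(2) by blast
    then show "h x = 0"
      by (intro ext) (simp add: h_def part_T flinearD[OF g(2)] fun_apply)
  next
    fix P l x assume "x \<in> X P (Suc l)"
    then show "h x \<in> X P l" using h_X g(1)[of P l] by auto
  next
    fix P l x assume "x \<in> X P l"
    then show "D (h (D x)) = D x" using h_X[OF assms(3)] g(3) by simp
  qed (rule h_lin)
qed

end

section \<open>Square-zero differentials, Kuenneth decomposition and transfer of exactness\<close>

locale quadratic_dgl = quadratic_letters S deg delta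
  for S :: "'i set" and deg :: "'i \<Rightarrow> nat" and delta +
  assumes D_delta: "i \<in> S \<Longrightarrow> D (delta i) = 0"
begin

text \<open>By induction on words: \<open>delta i\<close> has the parity opposite to that of the
  letter i, so the two terms \<open>delta i\<close> times D w cancel.\<close>

lemma D_D: assumes "F \<in> T P l" shows "D (D F) = 0"
proof (rule T_linear_eq[OF assms])
  fix w assume "w \<in> lists S"
  then show "D (D (word w)) = 0"
  proof (induction w)
    case Nil then show ?case by (simp add: D_word D_linear)
  next
    case (Cons i w)
    then have i: "i \<in> S" and w: "w \<in> lists S" by auto
    have "D (word (i # w)) = tmul (delta i) (word w) + fscale ((-1) ^ (deg i + 1)) (tmul (word [i]) (D (word w)))"
      using D_letter_tmul[OF i T_word[OF w]] by (simp add: tmul_word)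
    then show ?case
      using Cons.IH D_tmul[OF lie_T[OF delta_lie[OF i]] T_word[OF w]]
        D_letter_tmul[OF i D_T[OF T_word[OF w]]]
      by (simp add: D_linear D_delta[OF i] tmul_zero_left tmul_zero_right)
  qed
qed (intro flinear_compose[OF flinear_D flinear_D] flinear_zero)+

lemma dt_dt: assumes "G \<in> M P l" shows "dt (dt G) = 0"
proof (rule M_linear_eq[OF assms])
  fix a b R n R' n' assume "a \<in> lie R n" and b: "b \<in> T R' n'"
  then have a: "a \<in> T R n" by (simp add: lie_T)
  have 1: "dt (tens (D a) c) = tens (D (D a)) c + fscale ((-1) ^ Suc (R + n)) (tens (D a) (D c))" for c
    by (rule dt_tens[OF D_T[OF a]]) presburger
  show "dt (dt (tens a b)) = 0"
    unfolding dt_tens[OF a even_double] dt_linear 1 D_D[OF a] D_D[OF b] tens_linear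
    by (cases "even (R + n)") (simp_all add: minus_one_power_iff)
qed (intro flinear_compose[OF flinear_dt flinear_dt] flinear_zero)+

definition cycle_tensors :: "nat \<Rightarrow> nat \<Rightarrow> ('i list \<times> 'i list \<Rightarrow> rat) set" where
  "cycle_tensors P l = {tens a b | a b Q m Q' m'. a \<in> lie Q m \<and> b \<in> T Q' m' \<and> D a = 0 \<and> D b = 0 \<and>
     Q + Q' = P \<and> m + m' = l}"

text \<open>Only the surjectivity half of the Kuenneth formula is needed. The maps p and q are
  homotopic to the identity and take values in cycles; applying p on the left and q on the right
  changes a cycle G by boundaries only and sends pure tensors to tensors of cycles.\<close>

lemma kuenneth:
  assumes G: "G \<in> M P l" "dt G = 0"
  shows "\<exists>Z\<in>frat.span (cycle_tensors P l). \<exists>Y\<in>M P (l - 1). G = Z + dt Y"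
proof -
  obtain h where h: "flinear h" "\<And>P l x. x \<in> lie P (Suc l) \<Longrightarrow> h x \<in> lie P l"
    "\<And>P x. x \<in> lie P 0 \<Longrightarrow> h x = 0" "\<And>P l x. x \<in> lie P l \<Longrightarrow> D (h (D x)) = D x"
    by (rule homotopy_exists[where X = lie, OF lie_subspace _ D_lie]) (auto dest: lie_T)
  obtain k where k: "flinear k" "\<And>P l x. x \<in> T P (Suc l) \<Longrightarrow> k x \<in> T P l"
    "\<And>P x. x \<in> T P 0 \<Longrightarrow> k x = 0" "\<And>P l x. x \<in> T P l \<Longrightarrow> D (k (D x)) = D x"
    by (rule homotopy_exists[where X = T, OF T_subspace order_refl D_T], assumption) (rule that)
  note hl = flinearD[OF h(1)] and kl = flinearD[OF k(1)]
  define p where "p x = x - D (h x) - h (D x)" for x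
  define q where "q x = x - D (k x) - k (D x)" for x
  have p: "flinear p" and q: "flinear q"
    unfolding p_def q_def by (intro flinear_intros flinear_compose[OF flinear_D] flinear_compose[OF h(1)]
      flinear_compose[OF k(1)] flinear_D h(1) k(1))+
  \<comment> \<open>1 (x) k with its Koszul sign, k being of odd degree.\<close>
  define K where "K G = rapp k (lapp (sg 1) G)" for G
  have K: "flinear K"
    unfolding K_def by (intro flinear_compose[OF flinear_rapp[OF k(1)] flinear_lapp[OF flinear_sg]])
  have K_tens: "K (tens a b) = fscale ((-1) ^ r) (tens a (k b))" if "a \<in> T R n" "even (r + R + n)" for a b R n r
  proof -
    have 1: "(-1) ^ (R + n) = ((-1) ^ r :: rat)" using that(2) by (auto simp: minus_one_power_iff)
    show ?thesis
      unfolding K_def lapp_tens[OF flinear_sg] rapp_tens[OF k(1)] sg_T[OF that(1)] tens_linear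
        flinearD[OF flinear_rapp[OF k(1)]] by (simp add: 1)
  qed
  have h_D: "D (D (h x)) = 0" if "x \<in> lie R n" for x R n
  proof (cases n)
    case 0 then show ?thesis using h(3) that by (simp add: D_linear)
  next
    case (Suc m) then show ?thesis using D_D[OF lie_T[OF h(2)]] that by blast
  qed
  have k_D: "D (D (k x)) = 0" if "x \<in> T R n" for x R n
  proof (cases n)
    case 0 then show ?thesis using k(3) that by (simp add: D_linear)
  next
    case (Suc m) then show ?thesis using D_D[OF k(2)] that by blast
  qed
  have homh: "dt (lapp h G) + lapp h (dt G) = G - lapp p G" if "G \<in> M P l" for G
  proof (rule M_linear_eq[OF that])
    fix a b R n R' n' assume a: "a \<in> lie R n" and b: "b \<in> T R' n'"
    have "dt (tens (h a) b) = tens (D (h a)) b + fscale ((-1) ^ Suc (R + n)) (tens (h a) (D b))"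
    proof (cases n)
      case 0
      then show ?thesis using a h(3) by (simp add: tens_linear dt_linear D_linear)
    next
      case (Suc m)
      show ?thesis by (rule dt_tens[OF lie_T[OF h(2)], of _ _ m]) (use a Suc in auto)
    qed
    then show "dt (lapp h (tens a b)) + lapp h (dt (tens a b)) = tens a b - lapp p (tens a b)"
      unfolding lapp_tens[OF h(1)] lapp_tens[OF p] dt_tens[OF lie_T[OF a] even_double]
        flinearD[OF flinear_lapp[OF h(1)]] p_def
      by (simp add: tens_linear algebra_simps)
  qed (intro flinear_intros flinear_compose[OF flinear_dt flinear_lapp]
      flinear_compose[OF flinear_lapp flinear_dt] h(1) p)+
  have homk: "dt (K G) + K (dt G) = G - rapp q G" if "G \<in> M P l" for G
  proof (rule M_linear_eq[OF that])
    fix a b R n R' n' assume a: "a \<in> lie R n" and b: "b \<in> T R' n'"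
    have 1: "K (tens (D a) c) = fscale ((-1) ^ Suc (R + n)) (tens (D a) (k c))" for c
      by (rule K_tens[OF D_T[OF lie_T[OF a]]]) presburger
    show "dt (K (tens a b)) + K (dt (tens a b)) = tens a b - rapp q (tens a b)"
      unfolding K_tens[OF lie_T[OF a] even_double] rapp_tens[OF q] dt_tens[OF lie_T[OF a] even_double]
        flinearD[OF K] dt_linear 1 q_def
      by (cases "even (R + n)") (simp_all add: tens_linear minus_one_power_iff algebra_simps)
  qed (intro flinear_intros flinear_compose[OF flinear_dt K] flinear_compose[OF K flinear_dt] q)+
  have p_lie: "p a \<in> lie R n" if a: "a \<in> lie R n" for a R n
  proof -
    have "h (D a) \<in> lie R n" using h(2) D_lie a by blast
    moreover have "D (h a) \<in> lie R n"
    proof (cases n)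
      case 0 then show ?thesis using h(3) a by (simp add: D_linear lie_intros)
    next
      case (Suc m) then show ?thesis using D_lie h(2) a by auto
    qed
    ultimately show ?thesis unfolding p_def using a by (intro frat.subspace_diff[OF lie_subspace])
  qed
  have q_T: "q b \<in> T R n" if b: "b \<in> T R n" for b R n
  proof -
    have "k (D b) \<in> T R n" using k(2) D_T b by blast
    moreover have "D (k b) \<in> T R n"
    proof (cases n)
      case 0 then show ?thesis using k(3) b frat.subspace_0[OF T_subspace] by (simp add: D_linear)
    next
      case (Suc m) then show ?thesis using D_T k(2) b by auto
    qed
    ultimately show ?thesis unfolding q_def using b by (intro frat.subspace_diff[OF T_subspace])
  qed
  define G1 where "G1 = lapp p G"
  have hG: "lapp h G \<in> M P (l - 1)"
  proof (rule M_linear_mem[OF G(1) flinear_lapp[OF h(1)] M_subspace])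
    fix a b R n R' n' assume *: "a \<in> lie R n" "b \<in> T R' n'" "R + R' = P" "n + n' = l"
    show "lapp h (tens a b) \<in> M P (l - 1)"
    proof (cases n)
      case 0
      then show ?thesis using * h(3) frat.subspace_0[OF M_subspace] by (simp add: lapp_tens[OF h(1)] tens_linear)
    next
      case (Suc m)
      then show ?thesis using * h(2) by (auto simp: lapp_tens[OF h(1)] intro!: M_tens)
    qed
  qed
  have G1: "G = G1 + dt (lapp h G)"
    using homh[OF G(1)] G(2) by (simp add: G1_def flinearD[OF flinear_lapp[OF h(1)]] algebra_simps)
  have G1_M: "G1 \<in> M P l"
    unfolding G1_def
  proof (rule M_linear_mem[OF G(1) flinear_lapp[OF p] M_subspace])
    fix a b R n R' n' assume *: "a \<in> lie R n" "b \<in> T R' n'" "R + R' = P" "n + n' = l"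
    show "lapp p (tens a b) \<in> M P l"
      using * p_lie by (auto simp: lapp_tens[OF p] intro: M_tens)
  qed
  have "dt G = dt G1 + dt (dt (lapp h G))" by (subst G1) (simp only: dt_linear)
  then have "dt G1 = 0" using G(2) dt_dt[OF hG] by simp
  then have G2: "G1 = rapp q G1 + dt (K G1)"
    using homk[OF G1_M] by (simp add: flinearD[OF K] algebra_simps)
  have KG: "K G1 \<in> M P (l - 1)"
  proof (rule M_linear_mem[OF G1_M K M_subspace])
    fix a b R n R' n' assume *: "a \<in> lie R n" "b \<in> T R' n'" "R + R' = P" "n + n' = l"
    have "tens a (k b) \<in> M P (l - 1)"
    proof (cases n')
      case 0
      then show ?thesis using * k(3) frat.subspace_0[OF M_subspace] by (simp add: tens_linear)
    next
      case (Suc m)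
      then show ?thesis using * k(2) by (auto intro!: M_tens)
    qed
    then show "K (tens a b) \<in> M P (l - 1)"
      by (simp add: K_tens[OF lie_T[OF *(1)] even_double] frat.subspace_scale[OF M_subspace])
  qed
  have "rapp q G1 \<in> frat.span (cycle_tensors P l)"
    unfolding G1_def
  proof (rule M_linear_mem[OF G(1) flinear_compose[OF flinear_rapp[OF q] flinear_lapp[OF p]] frat.subspace_span])
    fix a b R n R' n' assume *: "a \<in> lie R n" "b \<in> T R' n'" "R + R' = P" "n + n' = l"
    note p_lie[OF *(1)] q_T[OF *(2)]
    \<comment> \<open>D (p a) = D a - D D h a - D h D a, where the second term is zero and the third
      equals D a.\<close>
    moreover have "D (p a) = 0" "D (q b) = 0"
      unfolding p_def q_def by (simp_all add: D_linear h_D[OF *(1)] k_D[OF *(2)] h(4)[OF *(1)] k(4)[OF *(2)])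
    ultimately show "rapp q (lapp p (tens a b)) \<in> frat.span (cycle_tensors P l)"
      unfolding lapp_tens[OF p] rapp_tens[OF q] cycle_tensors_def
      using *(3,4) by (intro frat.span_base) blast
  qed
  moreover have "G = rapp q G1 + dt (lapp h G + K G1)"
    by (subst G1, subst (1) G2) (simp add: dt_linear algebra_simps)
  moreover have "lapp h G + K G1 \<in> M P (l - 1)"
    by (rule frat.subspace_add[OF M_subspace hG KG])
  ultimately show ?thesis by blast
qed

text \<open>A primitive y of z in T is pushed into L: \<open>retr (phi y)\<close> has boundary P z,
  and P is invertible.\<close>

lemma exact_lie_if_exact_T:
  assumes "exact_at T P l" "P \<noteq> 0" shows "exact_at lie P l"
  unfolding exact_at_def
proof (intro ballI impI)
  fix z assume z: "z \<in> lie P l" "D z = 0"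
  then obtain y where y: "y \<in> T P (l - 1)" "D y = z"
    using assms(1) lie_T unfolding exact_at_def by blast
  have "fscale (of_nat P) z = retr (phi (D y))" using retr_phi_lie[OF z(1)] y(2) by simp
  also have "\<dots> = D (retr (phi y))" using dt_phi[OF y(1)] retr_dt[OF phi_M[OF y(1)]] by simp
  finally have "fscale (1 / of_nat P) (fscale (of_nat P) z) = D (fscale (1 / of_nat P) (retr (phi y)))"
    by (simp only: D_linear)
  then have "D (fscale (1 / of_nat P) (retr (phi y))) = z" using assms(2) by simp
  then show "\<exists>y\<in>lie P (l - 1). D y = z"
    using retr_M[OF phi_M[OF y(1)]] lie_intros(4) by blast
qed

text \<open>Up to a boundary, P z is a sum of products ab of cycles with a in L. If a is off the
  diagonal, it bounds by assumption. If a is on it, then b is off it because P and l differ, and b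
  has smaller weight because a nonzero element of L has positive weight; so b bounds by induction.
  Either way ab bounds.\<close>

lemma exact_T_if_exact_lie:
  assumes "\<And>P l. P \<noteq> l \<Longrightarrow> exact_at lie P l"
  shows "P \<noteq> l \<Longrightarrow> exact_at T P l"
proof (induction P arbitrary: l rule: less_induct)
  case (less P)
  show ?case
  proof (cases "P = 0")
    case True
    then have "D 0 = z" if "z \<in> T P l" for z
      using T_0_left[of z l] that less.prems by (simp add: D_linear)
    then show ?thesis unfolding exact_at_def using frat.subspace_0[OF T_subspace] by blast
  next
    case False
    show ?thesis
      unfolding exact_at_def
    proof (intro ballI impI)
      fix z assume z: "z \<in> T P l" "D z = 0"
      have "dt (phi z) = 0" using dt_phi[OF z(1)] z(2) by (simp add: flinearD[OF flinear_phi])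
      then obtain Z Y where Z: "Z \<in> frat.span (cycle_tensors P l)"
        and Y: "Y \<in> M P (l - 1)" and ZY: "phi z = Z + dt Y"
        using kuenneth[OF phi_M[OF z(1)]] by blast
      have img: "frat.subspace (D ` T P (l - 1))"
      proof -
        interpret D: Vector_Spaces.linear fscale fscale D by (rule flinear_D)
        show ?thesis by (rule D.subspace_image[OF T_subspace])
      qed
      have "tcollapse Z \<in> D ` T P (l - 1)"
      proof (rule span_linear_mem[OF Z flinear_tcollapse img])
        fix G assume "G \<in> cycle_tensors P l"
        then obtain a b Q m Q' m' where G: "G = tens a b" and a: "a \<in> lie Q m" "D a = 0"
          and b: "b \<in> T Q' m'" "D b = 0" and PQ: "Q + Q' = P" "m + m' = l"
          unfolding cycle_tensors_def by blast
        show "tcollapse G \<in> D ` T P (l - 1)"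
        proof (cases "a = 0 \<or> b = 0")
          case True
          then have "tcollapse G = D 0" by (auto simp: G tcollapse_tens tmul_zero_left tmul_zero_right D_linear)
          then show ?thesis using frat.subspace_0[OF T_subspace] by blast
        next
          case nz: False
          then have m: "m \<noteq> 0" "Q \<noteq> 0" using a lie_0[of a Q] lie_0_left[of a m] by auto
          show ?thesis
          proof (cases "Q = m")
            case False
            then obtain a' where a': "a' \<in> lie Q (m - 1)" "D a' = a"
              using assms a unfolding exact_at_def by blast
            have "D (tmul a' b) = tmul a b"
              using D_tmul[OF lie_T[OF a'(1)] b(1)] a' b by (simp add: tmul_zero_right)
            moreover have "tmul a' b \<in> T P (l - 1)"
              using T_tmul[OF lie_T[OF a'(1)] b(1)] PQ m by simp
            ultimately show ?thesis by (auto simp: G tcollapse_tens intro!: image_eqI[of _ _ "tmul a' b"])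
          next
            case True
            then have "Q' \<noteq> m'" "Q' < P" using PQ less.prems m by auto
            then obtain b' where b': "b' \<in> T Q' (m' - 1)" "D b' = b"
              using less.IH b unfolding exact_at_def by blast
            have "m' \<noteq> 0"
              using T_0(2)[of b Q'] b nz \<open>Q' \<noteq> m'\<close> by (cases "m' = 0") auto
            have "D (tmul a b') = fscale ((-1) ^ (Q + m)) (tmul a b)"
              using D_tmul[OF lie_T[OF a(1)] b'(1)] a b' by (simp add: tmul_zero_left)
            then have "D (fscale ((-1) ^ (Q + m)) (tmul a b')) = tmul a b"
              by (simp add: D_linear flip: power_mult_distrib)
            moreover have "fscale ((-1) ^ (Q + m)) (tmul a b') \<in> T P (l - 1)"
              using T_tmul[OF lie_T[OF a(1)] b'(1)] PQ \<open>m' \<noteq> 0\<close>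
              by (intro frat.subspace_scale[OF T_subspace]) (simp add: add_diff_assoc)
            ultimately show ?thesis by (auto simp: G tcollapse_tens intro!: image_eqI[of _ _ "fscale _ _"])
          qed
        qed
      qed
      moreover have "tcollapse (dt Y) \<in> D ` T P (l - 1)"
        using tcollapse_dt[OF Y] tcollapse_M[OF Y] by auto
      ultimately have "tcollapse Z + tcollapse (dt Y) \<in> D ` T P (l - 1)"
        by (rule frat.subspace_add[OF img])
      then have "fscale (of_nat P) z \<in> D ` T P (l - 1)"
        using tcollapse_phi[OF z(1)] ZY by (simp add: flinearD[OF flinear_tcollapse])
      then have "fscale (1 / of_nat P) (fscale (of_nat P) z) \<in> D ` T P (l - 1)"
        by (rule frat.subspace_scale[OF img])
      then show "\<exists>y\<in>T P (l - 1). D y = z" using False by auto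
    qed
  qed
qed

theorem exact_lie_iff_exact_T:
  "(\<forall>P l. P \<noteq> l \<longrightarrow> exact_at lie P l) \<longleftrightarrow> (\<forall>P l. P \<noteq> l \<longrightarrow> exact_at T P l)"
proof -
  have "exact_at lie 0 l" for l
    unfolding exact_at_def using lie_0_left lie_intros(2) D_linear(5) by metis
  then show ?thesis using exact_lie_if_exact_T exact_T_if_exact_lie by metis
qed

end

section \<open>Basis letters of a graded algebra\<close>

locale koszul_setup = graded_algebra scale A
  for scale :: "rat \<Rightarrow> 'a::ring_1 \<Rightarrow> 'a" and A :: "nat \<Rightarrow> 'a set" +
  assumes finite_type: "finite_type scale A"
    and connected: "connected_algebra scale A"
    and commutative: "graded_commutative A"
begin

definition bas :: "nat \<Rightarrow> 'a set" where
  "bas n = (SOME S. finite S \<and> independent S \<and> span S = A n)"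

lemma bas: "finite (bas n)" "independent (bas n)" "span (bas n) = A n"
proof -
  obtain S where S: "finite S" "A n = span S" using finite_type by (auto simp: finite_type_def)
  obtain T where T: "T \<subseteq> S" "independent T" "S \<subseteq> span T"
    using maximal_independent_subset[of S] by blast
  have "span T = span S"
    using span_mono[OF T(1)] span_minimal[OF T(3) subspace_span] by auto
  then have "\<exists>S. finite S \<and> independent S \<and> span S = A n"
    using S T finite_subset[of T S] by (intro exI[of _ T]) simp
  from someI_ex[OF this]
  show "finite (bas n)" "independent (bas n)" "span (bas n) = A n" by (auto simp: bas_def)
qed

lemma bas_A: "b \<in> bas n \<Longrightarrow> b \<in> A n"
  using bas(3) span_base by blast

lemma bas_nonzero: "b \<in> bas n \<Longrightarrow> b \<noteq> 0"
  using bas(2)[of n] dependent_zero by blast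

lemma A_disjoint: "x \<in> A m \<Longrightarrow> x \<in> A n \<Longrightarrow> x \<noteq> 0 \<Longrightarrow> m = n"
  using cmp_hom[of x m] cmp_hom[of x n] by (auto simp: fun_eq_iff split: if_splits)

definition ldeg :: "'a \<Rightarrow> nat" where
  "ldeg b = (THE n. b \<in> bas n)"

text \<open>Distinct components meet only in 0 and basis vectors are nonzero, so the degree is
  unique.\<close>

lemma ldeg: "b \<in> bas n \<Longrightarrow> ldeg b = n"
  unfolding ldeg_def using A_disjoint bas_A bas_nonzero by (intro the_equality) blast+

definition letters :: "'a set" where
  "letters = (\<Union>n. bas (Suc n))"

lemma letters_ldeg: "{c \<in> letters. ldeg c = n} = (if n = 0 then {} else bas n)"
  by (cases n) (auto simp: letters_def ldeg)

lemma letters_A: "c \<in> letters \<Longrightarrow> c \<in> A (ldeg c)"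
  by (auto simp: letters_def ldeg bas_A)

lemma letters_pos: "c \<in> letters \<Longrightarrow> 1 \<le> ldeg c"
  by (auto simp: letters_def ldeg)

text \<open>The dual basis; the passage to the component of b extends the functional by zero to the
  other degrees.\<close>

definition coord :: "'a \<Rightarrow> 'a \<Rightarrow> rat" where
  "coord b x = representation (bas (ldeg b)) (cmp x (ldeg b)) b"

lemma coord_linear: "Vector_Spaces.linear scale (*) (coord b)"
proof -
  have "cmp x n \<in> span (bas n)" for x n using bas(3) cmp(1) by auto
  then show ?thesis
    by (intro linI) (simp_all add: coord_def cmp_add cmp_scale representation_add[OF bas(2)]
          representation_scale[OF bas(2)])
qed

lemmas coord_simps = linD[OF coord_linear]

lemma coord_dual: "coord b \<in> graded_dual scale A (ldeg b)"
  unfolding graded_dual_def using coord_linear by (auto simp: coord_def cmp_hom representation_zero)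

lemma coord_expand:
  assumes "x \<in> A n" shows "x = (\<Sum>b\<in>bas n. scale (coord b x) b)"
proof -
  have "(\<Sum>b\<in>bas n. scale (coord b x) b) = (\<Sum>b\<in>bas n. scale (representation (bas n) x b) b)"
    by (intro sum.cong refl) (simp add: coord_def ldeg cmp_hom[OF assms])
  then show ?thesis
    using sum_representation_eq[OF bas(2)[of n], of x "bas n"] assms bas by simp
qed

lemma coord_letters:
  assumes "b \<in> letters" "c \<in> letters" shows "coord b c = (if b = c then 1 else 0)"
proof (cases "ldeg b = ldeg c")
  case True
  then obtain n where "b \<in> bas n" "c \<in> bas n" using assms by (auto simp: letters_def ldeg)
  then show ?thesis
    by (auto simp: coord_def ldeg cmp_hom[OF bas_A] representation_basis[OF bas(2)])
next
  case False
  then show ?thesis using dualD(2)[OF coord_dual letters_A[OF assms(2)]] by auto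
qed

lemma neg_one_scale': "scale ((-1) ^ n) x = (-1) ^ n * x"
  by (simp add: neg_one_scale)

lemma commute_hom: "x \<in> A m \<Longrightarrow> y \<in> A n \<Longrightarrow> x * y = scale ((-1) ^ (m * n)) (y * x)"
  using commutative unfolding graded_commutative_def neg_one_scale' by blast

text \<open>The structure constants of the multiplication read as a coproduct on the dual basis; the
  sign is the one in the Quillen differential.\<close>

definition delta :: "'a \<Rightarrow> 'a list \<Rightarrow> rat" where
  "delta c = (\<lambda>w. case w of [x, y] \<Rightarrow>
     if x \<in> letters \<and> y \<in> letters then (-1) ^ ldeg x * coord c (x * y) else 0 | _ \<Rightarrow> 0)"

sublocale W: weighted_words letters ldeg
  by unfold_locales (use letters_pos bas(1) in \<open>auto simp: letters_ldeg\<close>)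

lemma coord_mult_nonzero:
  "coord c (x * y) \<noteq> 0 \<Longrightarrow> x \<in> letters \<Longrightarrow> y \<in> letters \<Longrightarrow> ldeg c = ldeg x + ldeg y"
  using dualD(2)[OF coord_dual mult_in_component[OF letters_A letters_A]] by metis

text \<open>By graded commutativity the two terms of each commutator contribute equally, whence the
  factor \<open>1/2\<close>.\<close>

lemma delta_brackets:
  assumes "c \<in> letters"
  shows "delta c = (\<Sum>z | z \<in> letters \<times> letters \<and> ldeg (fst z) + ldeg (snd z) = ldeg c.
    fscale (1/2 * (-1) ^ ldeg (fst z) * coord c (fst z * snd z))
      (gr_bracket (ldeg (fst z) + 1) (ldeg (snd z) + 1) (word [fst z]) (word [snd z])))"
    (is "_ = (\<Sum>z\<in>?I. ?f z)")
proof -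
  define g where "g z = (-1) ^ ldeg (fst z) * coord c (fst z * snd z)" for z
  have fin: "finite ?I"
  proof (rule finite_subset)
    show "?I \<subseteq> (\<Union>n\<le>ldeg c. bas n) \<times> (\<Union>n\<le>ldeg c. bas n)"
      by (force simp: letters_def ldeg)
  qed (use bas(1) in auto)
  have 1: "delta c = (\<Sum>z\<in>?I. fscale (g z) (word [fst z, snd z]))"
  proof
    fix w
    show "delta c w = (\<Sum>z\<in>?I. fscale (g z) (word [fst z, snd z])) w"
    proof (cases "\<exists>x y. w = [x, y] \<and> (x, y) \<in> ?I")
      case False
      then have "delta c w = 0"
        using coord_mult_nonzero[of c] by (fastforce simp: delta_def split: list.splits)
      moreover have "fscale (g z) (word [fst z, snd z]) w = 0" if "z \<in> ?I" for z
      proof -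
        have "w \<noteq> [fst z, snd z]" using False that by auto
        then show ?thesis by (simp add: fscale_def word_def)
      qed
      ultimately show ?thesis by (simp add: sum_fun_rat)
    next
      case True
      then obtain x y where w: "w = [x, y]" and xy: "(x, y) \<in> ?I" by blast
      have "(\<Sum>z\<in>?I. fscale (g z) (word [fst z, snd z])) w = (\<Sum>z\<in>?I. if z = (x, y) then g z else 0)"
        unfolding sum_fun_rat w by (intro sum.cong refl) (auto simp: fscale_def word_def prod_eq_iff)
      then show ?thesis using fin xy by (simp add: w delta_def g_def)
    qed
  qed
  have 2: "delta c = (\<Sum>z\<in>?I. fscale (g (prod.swap z)) (word [snd z, fst z]))"
    unfolding 1 by (rule sum.reindex_bij_witness[where i = prod.swap and j = prod.swap]) auto
  have "?f z = fscale (1/2) (fscale (g z) (word [fst z, snd z]) + fscale (g (prod.swap z)) (word [snd z, fst z]))"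
    if "z \<in> ?I" for z
  proof -
    let ?x = "fst z" and ?y = "snd z"
    have c: "coord c (?y * ?x) = (-1) ^ (ldeg ?y * ldeg ?x) * coord c (?x * ?y)"
      using commute_hom[OF letters_A letters_A, of ?y ?x] that by (simp add: coord_simps mem_Times_iff)
    show ?thesis
      unfolding g_def fst_swap snd_swap c gr_bracket_def tmul_word
      by (cases "even (ldeg ?x)"; cases "even (ldeg ?y)")
        (simp_all add: frat.scale_right_distrib frat.scale_right_diff_distrib)
  qed
  then have "(\<Sum>z\<in>?I. ?f z) = fscale (1/2) (delta c + delta c)"
    by (subst 1, subst 2) (simp add: frat.scale_sum_right frat.scale_right_distrib sum.distrib)
  also have "\<dots> = delta c" by (rule ext, simp only: fscale_def fun_apply) simp
  finally show ?thesis ..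
qed

sublocale W: quadratic_letters letters ldeg delta
proof
  fix c assume c: "c \<in> letters"
  show "delta c \<in> W.lie (ldeg c) 2"
    unfolding delta_brackets[OF c]
  proof (intro frat.subspace_sum frat.subspace_scale W.lie_subspace)
    fix z assume "z \<in> {z \<in> letters \<times> letters. ldeg (fst z) + ldeg (snd z) = ldeg c}"
    then have z: "fst z \<in> letters" "snd z \<in> letters" "ldeg c = ldeg (fst z) + ldeg (snd z)" by auto
    show "gr_bracket (ldeg (fst z) + 1) (ldeg (snd z) + 1) (word [fst z]) (word [snd z]) \<in> W.lie (ldeg c) 2"
      using W.lie_intros(5)[OF W.lie_intros(1)[OF z(1)] W.lie_intros(1)[OF z(2)]]
      unfolding z(3) by (simp add: numeral_2_eq_2)
  qed
qed

lemma letters_sum: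
  assumes "x \<in> A n" "n \<noteq> 0"
  shows "x = (\<Sum>c | c \<in> letters \<and> ldeg c = n. scale (coord c x) c)"
  using coord_expand[OF assms(1)] assms(2) by (simp add: letters_ldeg)

text \<open>This is associativity: up to a common sign the value at [x, y, z] is the difference of
  the c-coordinates of (xy)z and x(yz), the inner products being expanded in letters.\<close>

sublocale W: quadratic_dgl letters ldeg delta
proof
  fix c assume c: "c \<in> letters"
  have dT: "delta c \<in> W.T (ldeg c) 2" by (rule W.lie_T[OF W.delta_lie[OF c]])
  have DT: "W.D (delta c) \<in> W.T (ldeg c) 3" using W.D_T[OF dT] by simp
  show "W.D (delta c) = 0"
  proof
    fix w
    show "W.D (delta c) w = 0 w"
    proof (cases "w \<in> lists letters \<and> length w = 3")
      case False
      then show ?thesis using W.T_D[OF DT, of w] by (cases "W.D (delta c) w = 0") (auto simp: W.words_def fun_apply)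
    next
      case True
      then obtain x y z where w: "w = [x, y, z]" and l: "x \<in> letters" "y \<in> letters" "z \<in> letters"
        by (auto simp: numeral_3_eq_3 length_Suc_conv)
      note hx = letters_A[OF l(1)] and hy = letters_A[OF l(2)] and hz = letters_A[OF l(3)]
      let ?C = "\<lambda>n. {d \<in> letters. ldeg d = n}"
      have T1: "(\<lambda>u. delta c (x # u)) \<in> W.T (ldeg c - ldeg x) 1"
        using W.T_tail[of "delta c" "ldeg c" 1 x] dT by (simp add: numeral_2_eq_2)
      have T0: "(\<lambda>u. delta c (x # y # u)) \<in> W.T (ldeg c - ldeg x - ldeg y) 0"
        using W.T_tail[of _ "ldeg c - ldeg x" 0 y] T1 by simp
      have "W.D (\<lambda>u. delta c (x # y # u)) [z] = 0"
        by (subst W.T_0(1)[OF T0]) (simp add: W.D_linear W.D_word fun_apply)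
      then have 1: "W.D (\<lambda>u. delta c (x # u)) [y, z] = (\<Sum>d\<in>?C (ldeg y + ldeg z). delta d [y, z] * delta c [x, d])"
        by (simp add: W.D_Cons[OF T1 l(2,3)])
      have pos: "ldeg x + ldeg y \<noteq> 0" "ldeg y + ldeg z \<noteq> 0" using l letters_pos by force+
      have 2: "(\<Sum>d\<in>?C (ldeg y + ldeg z). delta d [y, z] * delta c [x, d]) =
          (-1) ^ ldeg x * (-1) ^ ldeg y * coord c (x * (y * z))"
      proof -
        have "(\<Sum>d\<in>?C (ldeg y + ldeg z). delta d [y, z] * delta c [x, d]) =
          (-1) ^ ldeg x * (-1) ^ ldeg y * coord c (x * (\<Sum>d\<in>?C (ldeg y + ldeg z). scale (coord d (y * z)) d))"
          unfolding sum_distrib_left coord_simps scale_mult_right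
          by (intro sum.cong refl) (simp add: delta_def l)
        then show ?thesis using letters_sum[OF mult_in_component[OF hy hz] pos(2)] by simp
      qed
      have 3: "(\<Sum>d\<in>?C (ldeg x + ldeg y). delta d [x, y] * delta c [d, z]) =
          (-1) ^ ldeg y * coord c (x * y * z)"
      proof -
        have "(\<Sum>d\<in>?C (ldeg x + ldeg y). delta d [x, y] * delta c [d, z]) =
          (-1) ^ ldeg y * coord c ((\<Sum>d\<in>?C (ldeg x + ldeg y). scale (coord d (x * y)) d) * z)"
          unfolding sum_distrib_left sum_distrib_right coord_simps scale_mult_left
          by (intro sum.cong refl) (simp add: delta_def l power_add flip: power_mult_distrib)
        then show ?thesis using letters_sum[OF mult_in_component[OF hx hy] pos(1)] by simp
      qed
      show ?thesis
        unfolding w W.D_Cons[OF dT l(1,2)] 1 2 3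
        by (simp add: mult.assoc fun_apply flip: power_mult_distrib)
    qed
  qed
qed

end

section \<open>The bar complex\<close>

lemma independent_word: "frat.independent (range (word :: 'x list \<Rightarrow> _))"
  unfolding frat.dependent_explicit
proof (intro notI, elim exE conjE bexE)
  fix t and u :: "('x list \<Rightarrow> rat) \<Rightarrow> rat" and v
  assume t: "finite t" "t \<subseteq> range word" "(\<Sum>v\<in>t. fscale (u v) v) = 0" and v: "v \<in> t" "u v \<noteq> 0"
  obtain w where w: "v = word w" using v t(2) by blast
  have "(\<Sum>v\<in>t. fscale (u v) v) w = (\<Sum>v'\<in>t. if v' = v then u v else 0)"
    unfolding sum_fun_rat
  proof (intro sum.cong refl)
    fix v' assume "v' \<in> t"
    then obtain w' where w': "v' = word w'" using t(2) by blast
    have "v' = v \<longleftrightarrow> w' = w"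
      unfolding w w' by (metis word_def zero_neq_one)
    then show "fscale (u v') v' w = (if v' = v then u v else 0)"
      by (auto simp: fscale_def w' word_def)
  qed
  also have "\<dots> = u v" using t(1) v(1) by simp
  finally show False using t(3) v(2) by (simp add: fun_apply)
qed

lemma word_extend:
  fixes g :: "'x list \<Rightarrow> 'y \<Rightarrow> rat"
  shows "\<exists>f. flinear f \<and> (\<forall>w. f (word w) = g w)"
proof -
  have "inj (word :: 'x list \<Rightarrow> _)" by (rule injI) (metis word_def zero_neq_one)
  then show ?thesis
    using fpair.linear_independent_extend[OF independent_word, of "\<lambda>F. g (inv word F)"]
    by (auto simp: inv_f_f)
qed

text \<open>The quotient by N is modelled inside the same function space, by projecting onto a
  complement of N.\<close>

lemma quotient_map_exists:
  fixes N :: "('x \<Rightarrow> rat) set"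
  assumes "frat.subspace N"
  shows "\<exists>p :: ('x \<Rightarrow> rat) \<Rightarrow> 'x \<Rightarrow> rat. flinear p \<and> (\<forall>x. p x = 0 \<longleftrightarrow> x \<in> N)"
proof -
  obtain B where B: "B \<subseteq> N" "frat.independent B" "N \<subseteq> frat.span B"
    using frat.maximal_independent_subset by blast
  have NB: "N = frat.span B" using B frat.span_minimal[OF B(1) assms] by blast
  define C where "C = frat.extend_basis B"
  have C: "B \<subseteq> C" "frat.independent C" "frat.span C = UNIV"
    unfolding C_def using frat.extend_basis_superset frat.independent_extend_basis frat.span_extend_basis B(2)
    by auto
  obtain p where p: "flinear p" "\<And>b. b \<in> C \<Longrightarrow> p b = (if b \<in> B then 0 else b)"
    using fpair.linear_independent_extend[OF C(2), of "\<lambda>b. if b \<in> B then 0 else b"] by blast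
  have pB: "p x = 0" if "x \<in> frat.span B" for x
    by (rule fpair.linear_eq_on[OF p(1) flinear_zero that]) (use p(2) C(1) in auto)
  have pC: "p x = x" if "x \<in> frat.span (C - B)" for x
    by (rule fpair.linear_eq_on[OF p(1) flinear_id that]) (use p(2) in auto)
  have "x \<in> N" if "p x = 0" for x
  proof -
    have "x \<in> frat.span (B \<union> (C - B))" using C(1,3) by (simp add: Un_absorb1)
    then obtain u v where uv: "x = u + v" "u \<in> frat.span B" "v \<in> frat.span (C - B)"
      unfolding frat.span_Un by blast
    then have "p x = v" by (simp add: flinearD[OF p(1)] pB pC)
    then show ?thesis using that uv NB by simp
  qed
  then show ?thesis using p(1) pB NB by (intro exI[of _ p]) auto
qed

lemma separating_functional:
  assumes "frat.subspace N" "z \<notin> N"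
  shows "\<exists>f :: ('x \<Rightarrow> rat) \<Rightarrow> unit \<Rightarrow> rat. flinear f \<and> (\<forall>x\<in>N. f x = 0) \<and> f z \<noteq> 0"
proof -
  obtain p :: "('x \<Rightarrow> rat) \<Rightarrow> 'x \<Rightarrow> rat" where p: "flinear p" "\<And>x. p x = 0 \<longleftrightarrow> x \<in> N"
    using quotient_map_exists[OF assms(1)] by blast
  obtain w where w: "p z w \<noteq> 0" using p(2) assms(2) by (auto simp: fun_eq_iff fun_apply)
  have "flinear (\<lambda>x (_::unit). p x w)"
    by (rule flinearI; unfold flinearD[OF p(1)]) (auto simp: fun_apply fscale_def)
  moreover have "(\<lambda>(_::unit). p x w) = 0" if "x \<in> N" for x
    using p(2)[of x] that by (simp add: fun_eq_iff fun_apply)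
  moreover have "(\<lambda>(_::unit). p z w) \<noteq> 0" using w by (auto simp: fun_eq_iff fun_apply)
  ultimately show ?thesis by (intro exI[of _ "\<lambda>x (_::unit). p x w"]) auto
qed

text \<open>Exactness of duality: g vanishes on the kernel of C -> V/N induced by f, so it descends
  to the image, and the right inverse r extends it to all of V.\<close>

lemma functional_factors:
  fixes f :: "('x \<Rightarrow> rat) \<Rightarrow> 'y \<Rightarrow> rat" and g :: "('x \<Rightarrow> rat) \<Rightarrow> unit \<Rightarrow> rat"
  assumes C: "frat.subspace C" and N: "frat.subspace N" and f: "flinear f" and g: "flinear g"
    and ker: "\<And>z. z \<in> C \<Longrightarrow> f z \<in> N \<Longrightarrow> g z = 0"
  shows "\<exists>h. flinear h \<and> (\<forall>z\<in>C. h (f z) = g z) \<and> (\<forall>x\<in>N. h x = 0)"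
proof -
  obtain p :: "('y \<Rightarrow> rat) \<Rightarrow> 'y \<Rightarrow> rat" where p: "flinear p" "\<And>x. p x = 0 \<longleftrightarrow> x \<in> N"
    using quotient_map_exists[OF N] by blast
  have pf: "flinear (\<lambda>z. p (f z))" by (rule flinear_compose[OF p(1) f])
  obtain r where r: "range r \<subseteq> C" "flinear r" "\<And>y. y \<in> (\<lambda>z. p (f z)) ` C \<Longrightarrow> p (f (r y)) = y"
    using fpair.linear_exists_right_inverse_on[OF pf C] by auto
  define h where "h x = g (r (p x))" for x
  have "flinear h"
    unfolding h_def by (rule flinear_compose[OF g flinear_compose[OF r(2) p(1)]])
  moreover have "h (f z) = g z" if z: "z \<in> C" for z
  proof -
    have rz: "r (p (f z)) \<in> C" using r(1) by blast
    have "p (f (r (p (f z)))) = p (f z)" using r(3) z by blast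
    then have "p (f (r (p (f z)) - z)) = 0" by (simp add: flinearD[OF f] flinearD[OF p(1)])
    then have "g (r (p (f z)) - z) = 0"
      using ker frat.subspace_diff[OF C rz z] p(2) by blast
    then show ?thesis by (simp add: h_def flinearD[OF g])
  qed
  moreover have "h x = 0" if "x \<in> N" for x
    using that p(2)[of x] by (simp add: h_def flinearD[OF r(2)] flinearD[OF g])
  ultimately show ?thesis by blast
qed

text \<open>The transpose of \<open>bar_d_word\<close>: a function on words pulled back along the
  bar differential.\<close>

definition faces :: "('a::ring_1 list \<Rightarrow> rat) \<Rightarrow> 'a list \<Rightarrow> rat" where
  "faces f w = (\<Sum>i<length w - 1. (-1) ^ i * f (take i w @ (w ! i * w ! Suc i) # drop (i + 2) w))"

lemma faces_simps:
  "faces f [] = 0" "faces f [x] = 0"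
  "faces f (x # y # v) = f (x * y # v) - faces (\<lambda>u. f (x # u)) (y # v)"
proof -
  have "(\<Sum>i<Suc (length v). (-1) ^ i * f (take i (x # y # v) @ ((x # y # v) ! i * (x # y # v) ! Suc i) # drop (i + 2) (x # y # v)))
      = f (x * y # v) + (\<Sum>i<length v. (-1) ^ Suc i *
        f (x # take i (y # v) @ ((y # v) ! i * v ! i) # drop (i + 1) v))"
    by (subst sum.lessThan_Suc_shift) simp
  then show "faces f (x # y # v) = f (x * y # v) - faces (\<lambda>u. f (x # u)) (y # v)"
    by (simp add: faces_def sum_negf)
qed (simp_all add: faces_def)

lemma flinear_bar_d_word:
  assumes "flinear g"
  shows "g (bar_d_word w) () = faces (\<lambda>v. g (word v) ()) w"
  unfolding bar_d_word_def faces_def flinearD[OF assms] sum_fun_rat by (simp add: fscale_def)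

text \<open>\<open>bar_d\<close> sums over the support, which is meaningful only for finite support.
  A globally linear g agreeing with it on the span of words makes the lemmas on linear maps
  applicable.\<close>

lemma bar_d_linear_extension:
  "\<exists>g. flinear g \<and> (\<forall>w. g (word w) = bar_d_word w) \<and> (\<forall>z\<in>frat.span (range word). bar_d z = g z)"
proof -
  obtain g :: "('a list \<Rightarrow> rat) \<Rightarrow> 'a list \<Rightarrow> rat" where g: "flinear g" "\<And>w. g (word w) = bar_d_word w"
    using word_extend[of bar_d_word] by blast
  have "bar_d z = g z" if "z \<in> frat.span (range word)" for z
  proof -
    have fin: "finite {w. z w \<noteq> 0}"
      using that
    proof (induction rule: frat.span_induct_alt)
      case base show ?case by (simp add: fun_apply)
    next
      case (step c x y)
      then obtain w where "x = word w" by blast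
      then have "{v. (fscale c x + y) v \<noteq> 0} \<subseteq> insert w {v. y v \<noteq> 0}"
        by (auto simp: fun_apply fscale_def word_def)
      then show ?case using step finite_subset by blast
    qed
    have "z = (\<Sum>w | z w \<noteq> 0. fscale (z w) (word w))"
    proof
      fix v
      have "(\<Sum>w | z w \<noteq> 0. fscale (z w) (word w)) v = (\<Sum>w | z w \<noteq> 0. if w = v then z v else 0)"
        unfolding sum_fun_rat by (intro sum.cong) (auto simp: fscale_def word_def)
      then show "z v = (\<Sum>w | z w \<noteq> 0. fscale (z w) (word w)) v" using fin by simp
    qed
    then have "g z = g (\<Sum>w | z w \<noteq> 0. fscale (z w) (word w))" by (rule arg_cong)
    then show ?thesis by (simp add: bar_d_def flinearD[OF g(1)] g(2))
  qed
  then show ?thesis using g by blast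
qed

context graded_algebra begin

text \<open>Such functions on words are the functionals that descend to the tensor algebra, see
  \<open>mlin_iff_kills\<close>.\<close>

definition mlin :: "('a list \<Rightarrow> rat) \<Rightarrow> bool" where
  "mlin f \<longleftrightarrow> (\<forall>us vs x y. f (us @ (x + y) # vs) = f (us @ x # vs) + f (us @ y # vs)) \<and>
     (\<forall>us vs c x. f (us @ scale c x # vs) = c * f (us @ x # vs))"

lemma mlin_Cons: "mlin f \<Longrightarrow> mlin (\<lambda>u. f (x # u))"
  unfolding mlin_def by (metis append_Cons)

lemma mlin_linear: assumes "mlin f" shows "Vector_Spaces.linear scale (*) (\<lambda>x. f (us @ x # vs))"
  using assms by (intro linI) (auto simp: mlin_def)

lemma mlin_iff_kills:
  assumes "flinear g"
  shows "mlin (\<lambda>w. g (word w) ()) \<longleftrightarrow> (\<forall>z\<in>multilinearity scale. g z = 0)"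
proof -
  have z: "g z = 0 \<longleftrightarrow> g z () = 0" for z by (auto simp: fun_eq_iff fun_apply)
  have 1: "g (word (us @ (x + y) # vs) - word (us @ x # vs) - word (us @ y # vs)) = 0 \<longleftrightarrow>
      g (word (us @ (x + y) # vs)) () = g (word (us @ x # vs)) () + g (word (us @ y # vs)) ()" for us vs x y
    unfolding z unfolding flinearD[OF assms] fun_apply by (auto simp: algebra_simps)
  have 2: "g (word (us @ scale c x # vs) - fscale c (word (us @ x # vs))) = 0 \<longleftrightarrow>
      g (word (us @ scale c x # vs)) () = c * g (word (us @ x # vs)) ()" for us vs c x
    unfolding z unfolding flinearD[OF assms] unfolding fun_apply fscale_def by simp
  have "(\<forall>z\<in>multilinearity scale. g z = 0) \<longleftrightarrow>
    (\<forall>us vs x y. g (word (us @ (x + y) # vs) - word (us @ x # vs) - word (us @ y # vs)) = 0) \<and>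
    (\<forall>us vs c x. g (word (us @ scale c x # vs) - fscale c (word (us @ x # vs))) = 0)"
    unfolding multilinearity_def by blast
  then show ?thesis unfolding 1 2 mlin_def by blast
qed

lemma faces_add: "faces (\<lambda>u. f u + g u) w = faces f w + faces g w"
  by (simp add: faces_def distrib_left sum.distrib)

lemma faces_cmul: "faces (\<lambda>u. c * f u) w = c * faces f w"
  by (simp add: faces_def sum_distrib_left algebra_simps)

text \<open>The dual form of the fact that the bar differential respects the multilinearity
  relations; distributivity enters at the two faces that touch the changed letter.\<close>

lemma faces_mlin: assumes "mlin f" shows "mlin (faces f)"
proof -
  have "faces f (us @ (x + y) # vs) = faces f (us @ x # vs) + faces f (us @ y # vs) \<and>
    faces f (us @ scale c x # vs) = c * faces f (us @ x # vs)" for us vs x y c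
    using assms
  proof (induction us arbitrary: f)
    case (Nil f)
    note f = linD[OF mlin_linear[OF Nil, of "[]"], simplified]
    show ?case
      by (cases vs) (simp_all add: faces_simps distrib_right scale_mult_left f faces_add faces_cmul algebra_simps)
  next
    case (Cons u us f)
    note f = linD[OF mlin_linear[OF Cons.prems], simplified]
    note IH = Cons.IH[OF mlin_Cons[OF Cons.prems]]
    show ?case
    proof (cases us)
      case Nil
      then show ?thesis
        using IH[of u] f[of "[]"] by (simp add: faces_simps distrib_left scale_mult_right algebra_simps)
    next
      case (Cons u' us')
      then show ?thesis
        using IH[of u] f[of "(u * u') # us'"] by (simp add: faces_simps algebra_simps)
    qed
  qed
  then show ?thesis unfolding mlin_def by blast
qed

end

lemma (in vector_space) representation_singleton_scale:
  assumes "x \<noteq> 0" shows "representation {x} (scale c x) x = c"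
proof -
  have i: "independent {x}" using assms by simp
  have "representation {x} (scale c x) x = c * representation {x} x x"
    by (subst representation_scale[OF i]) (auto simp: span_base)
  then show ?thesis by (simp add: representation_basis[OF i])
qed

section \<open>Bar chains against functions on words of basis letters\<close>

context koszul_setup begin

definition counit :: "'a \<Rightarrow> rat" where
  "counit x = representation {1} (cmp x 0) 1"

lemma counit_linear: "Vector_Spaces.linear scale (*) counit"
proof -
  have i: "independent {1}" by simp
  have "cmp x 0 \<in> span {1}" for x
    using cmp(1)[of x 0] connected by (auto simp: connected_algebra_def span_singleton)
  then show ?thesis
    by (intro linI) (simp_all add: counit_def cmp_add cmp_scale representation_add[OF i]
          representation_scale[OF i])
qed

lemma counit_simps: "counit 1 = 1" "x \<in> A d \<Longrightarrow> 1 \<le> d \<Longrightarrow> counit x = 0"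
  using representation_singleton_scale[of 1 1]
  by (simp_all add: counit_def cmp_hom cmp_hom[OF one_in_component] representation_zero)

fun coord_word :: "'a list \<Rightarrow> 'a list \<Rightarrow> rat" where
  "coord_word [] [] = 1"
| "coord_word (b # w) (x # v) = coord b x * coord_word w v"
| "coord_word _ _ = 0"

lemma mlin_coord_word: "mlin (coord_word w)"
proof -
  have "coord_word w (us @ (x + y) # vs) = coord_word w (us @ x # vs) + coord_word w (us @ y # vs) \<and>
    coord_word w (us @ scale c x # vs) = c * coord_word w (us @ x # vs)" for us vs x y c
  proof (induction us arbitrary: w)
    case Nil
    show ?case by (cases w) (simp_all add: coord_simps algebra_simps)
  next
    case (Cons u us)
    then show ?case by (cases w) (simp_all add: algebra_simps)
  qed
  then show ?thesis unfolding mlin_def by blast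
qed

lemma coord_word_letters:
  "w \<in> lists letters \<Longrightarrow> v \<in> lists letters \<Longrightarrow> coord_word w v = (if w = v then 1 else 0)"
proof (induction w arbitrary: v)
  case Nil then show ?case by (cases v) auto
next
  case (Cons b w) then show ?case by (cases v) (auto simp: coord_letters)
qed

text \<open>Turns a function G on letter words of weight q into a functional on bar chains: the
  augmentation on the head realizes the tensor product with the trivial module, the dual basis
  evaluates the tail.\<close>

definition bar_eval :: "nat \<Rightarrow> ('a list \<Rightarrow> rat) \<Rightarrow> 'a list \<Rightarrow> rat" where
  "bar_eval q G w = (case w of [] \<Rightarrow> 0 | x # v \<Rightarrow>
     counit x * (\<Sum>u\<in>W.words q. G u * coord_word u v))"

lemma mlin_bar_eval: "mlin (bar_eval q G)"
proof -
  have "bar_eval q G (us @ (x + y) # vs) = bar_eval q G (us @ x # vs) + bar_eval q G (us @ y # vs) \<and>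
    bar_eval q G (us @ scale c x # vs) = c * bar_eval q G (us @ x # vs)" for us vs x y c
  proof (cases us)
    case Nil
    then show ?thesis by (simp add: bar_eval_def linD[OF counit_linear] algebra_simps)
  next
    case (Cons u us')
    have "coord_word w (us' @ (x + y) # vs) = coord_word w (us' @ x # vs) + coord_word w (us' @ y # vs)"
      "coord_word w (us' @ scale c x # vs) = c * coord_word w (us' @ x # vs)" for w
      using mlin_coord_word[of w] unfolding mlin_def by auto
    then show ?thesis using Cons
      by (simp add: bar_eval_def algebra_simps sum.distrib sum_distrib_left)
  qed
  then show ?thesis unfolding mlin_def by blast
qed

lemma bar_eval_head: "x \<in> A d \<Longrightarrow> 1 \<le> d \<Longrightarrow> bar_eval q G (x # v) = 0"
  by (simp add: bar_eval_def counit_simps)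

lemma bar_eval_one:
  assumes "v \<in> W.words q" shows "bar_eval q G (1 # v) = G v"
proof -
  have "(\<Sum>u\<in>W.words q. G u * coord_word u v) = (\<Sum>u\<in>W.words q. if u = v then G v else 0)"
    by (intro sum.cong refl) (use assms in \<open>auto simp: W.words_def coord_word_letters simp del: in_lists_conv_set\<close>)
  then show ?thesis using assms W.finite_words by (simp add: bar_eval_def counit_simps)
qed

lemma bar_words_one: "v \<in> W.words q \<Longrightarrow> length v = p \<Longrightarrow> 1 # v \<in> bar_words A 0 p q"
  unfolding bar_words_def W.words_def W.wgt_def
  by (auto intro!: exI[of _ "0::nat"] exI[of _ "map ldeg v"]
      simp: one_in_component list_all2_map2 list_all2_same letters_pos[unfolded One_nat_def] letters_A)

text \<open>A letter word is read here as a bar word whose head is its first letter. It arises as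
  the first face of \<open>1 # v\<close>, and it is null because letters have positive
  degree.\<close>

lemma bar_words_letters:
  assumes "v \<in> W.words q" "length v = Suc p" shows "v \<in> bar_words A 1 p q"
proof -
  obtain x xs where v: "v = x # xs" using assms(2) by (cases v) auto
  have l: "x \<in> letters" "\<forall>y\<in>set xs. y \<in> letters" "q = ldeg x + sum_list (map ldeg xs)"
    using assms(1) by (auto simp: v W.words_def W.wgt_def)
  have "list_all2 (\<lambda>y e. 1 \<le> e \<and> y \<in> A e) xs (map ldeg xs)"
    using l(2) by (simp add: list_all2_map2 list_all2_same letters_pos[unfolded One_nat_def] letters_A)
  then show ?thesis
    unfolding bar_words_def v using assms(2) l letters_pos[OF l(1)] letters_A[OF l(1)] v by auto
qed

lemma bar_eval_kills_null:
  assumes g: "flinear g" "\<And>w. g (word w) = (\<lambda>_::unit. bar_eval q G w)" and z: "z \<in> bar_null scale A p q'"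
  shows "g z = 0"
proof (rule fpair.linear_eq_on[OF g(1) flinear_zero z[unfolded bar_null_def]])
  fix b assume "b \<in> word ` bar_words A 1 p q' \<union> multilinearity scale"
  then show "g b = 0"
  proof
    assume "b \<in> word ` bar_words A 1 p q'"
    then show ?thesis using bar_eval_head by (auto simp: bar_words_def g(2) fun_eq_iff fun_apply)
  next
    assume "b \<in> multilinearity scale"
    moreover have "mlin (\<lambda>w. g (word w) ())" using mlin_bar_eval by (simp add: g(2))
    ultimately show ?thesis using mlin_iff_kills[OF g(1)] by blast
  qed
qed

text \<open>Modulo multilinearity and the words whose head has positive degree, the bar chains are
  spanned by the words \<open>1 # v\<close> with \<open>v\<close> a word of basis letters.\<close>

lemma kills_bar_chains:
  fixes g :: "('a list \<Rightarrow> rat) \<Rightarrow> unit \<Rightarrow> rat"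
  assumes g: "flinear g" and ml: "\<And>z. z \<in> multilinearity scale \<Longrightarrow> g z = 0"
    and null: "\<And>w. w \<in> bar_words A 1 p q \<Longrightarrow> g (word w) = 0"
    and one: "\<And>v. v \<in> W.words q \<Longrightarrow> length v = p \<Longrightarrow> g (word (1 # v)) = 0"
    and z: "z \<in> bar_chains scale A p q"
  shows "g z = 0"
proof (rule fpair.linear_eq_on[OF g flinear_zero z[unfolded bar_chains_def]])
  define f where "f w = g (word w) ()" for w
  have f: "mlin f" unfolding f_def using mlin_iff_kills[OF g] ml by blast
  have f0: "f w = 0 \<longleftrightarrow> g (word w) = 0" for w by (auto simp: f_def fun_eq_iff fun_apply)
  \<comment> \<open>The entries are expanded in the basis from left to right; \<open>us\<close>
    collects those already replaced by letters.\<close>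
  have hom: "f (1 # us @ xs) = 0"
    if "us \<in> lists letters" "list_all2 (\<lambda>y e. 1 \<le> e \<and> y \<in> A e) xs ds" "W.wgt us + sum_list ds = q"
      "length us + length xs = p" for us xs ds
    using that
  proof (induction xs arbitrary: us ds)
    case Nil
    then show ?case using one[of us] by (auto simp: f0 W.words_def)
  next
    case (Cons x xs)
    then obtain e ds' where ds: "ds = e # ds'" "1 \<le> e" "x \<in> A e"
      "list_all2 (\<lambda>y e. 1 \<le> e \<and> y \<in> A e) xs ds'" by (auto simp: list_all2_Cons1)
    have "f (1 # us @ x # xs) = f ((1 # us) @ (\<Sum>c | c \<in> letters \<and> ldeg c = e. scale (coord c x) c) # xs)"
      using letters_sum[of x e] ds by simp
    also have "\<dots> = (\<Sum>c | c \<in> letters \<and> ldeg c = e. coord c x * f ((1 # us) @ c # xs))"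
      by (simp only: linD[OF mlin_linear[OF f, of "1 # us" xs]])
    also have "\<dots> = 0"
    proof (intro sum.neutral ballI)
      fix c assume c: "c \<in> {c \<in> letters. ldeg c = e}"
      have "f (1 # (us @ [c]) @ xs) = 0"
        by (rule Cons.IH[OF _ ds(4)]) (use c Cons.prems ds in auto)
      then show "coord c x * f ((1 # us) @ c # xs) = 0" by simp
    qed
    finally show ?case .
  qed
  fix b assume "b \<in> word ` bar_words A 0 p q \<union> multilinearity scale"
  then show "g b = 0"
  proof
    assume "b \<in> word ` bar_words A 0 p q"
    then obtain x xs d ds where b: "b = word (x # xs)" and xs: "length xs = p" "x \<in> A d"
      "list_all2 (\<lambda>y e. 1 \<le> e \<and> y \<in> A e) xs ds" "q = d + sum_list ds"
      unfolding bar_words_def by auto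
    show "g b = 0"
    proof (cases "d = 0")
      case False
      then have "x # xs \<in> bar_words A 1 p q" unfolding bar_words_def using xs by (auto intro!: exI[of _ d] exI[of _ ds])
      then show ?thesis using null b by simp
    next
      case True
      then obtain c where c: "x = scale c 1" using xs(2) connected by (auto simp: connected_algebra_def)
      have "f (x # xs) = c * f (1 # xs)"
        using linD(2)[OF mlin_linear[OF f, of "[]" xs], of c 1] by (simp add: c)
      also have "f (1 # xs) = 0" using hom[of "[]" xs ds] xs True by simp
      finally show ?thesis by (simp add: b f0)
    qed
  qed (use ml in auto)
qed

text \<open>Up to the sign \<open>twist\<close>, the transpose \<open>bdr\<close> of the bar differential is \<open>D\<close>, whose signs
  depend on the degrees of the letters.\<close>

fun twist :: "'a list \<Rightarrow> nat" where
  "twist [] = 0"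
| "twist (x # v) = length v * ldeg x + twist v"

definition tw :: "('a list \<Rightarrow> rat) \<Rightarrow> 'a list \<Rightarrow> rat" where
  "tw F v = (-1) ^ twist v * F v"

lemma tw_T: "F \<in> W.T P l \<Longrightarrow> tw F \<in> W.T P l"
  by (auto simp: W.T_def tw_def)

lemma tw_tw: "tw (tw F) = F"
  by (rule ext) (simp add: tw_def flip: power_mult_distrib mult.assoc)

fun bdr :: "('a list \<Rightarrow> rat) \<Rightarrow> 'a list \<Rightarrow> rat" where
  "bdr F (x # y # v) = (\<Sum>c | c \<in> letters \<and> ldeg c = ldeg x + ldeg y. coord c (x * y) * F (c # v))
    - bdr (\<lambda>u. F (x # u)) (y # v)"
| "bdr F v = 0"

text \<open>Merging x and y into c lowers the exponent \<open>twist\<close> by exactly the degree of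
  x, which is the sign in \<open>delta\<close>. Passing over x changes it by the tail length times
  that degree, which turns the sign of D into the plain alternating one of
  \<open>bdr\<close>.\<close>

lemma D_tw:
  assumes "F \<in> W.T P l" "v \<in> lists letters" "length v = Suc l"
  shows "W.D (tw F) v = (-1) ^ twist v * bdr F v"
  using assms(1,3,2)
proof (induction F v arbitrary: P l rule: bdr.induct)
  case (1 F x y v)
  then obtain l' where l: "l = Suc l'" "length v = l'" by (cases l) auto
  have xy: "x \<in> letters" "y \<in> letters" "v \<in> lists letters" using 1 by auto
  have Fx: "(\<lambda>u. F (x # u)) \<in> W.T (P - ldeg x) l'" using W.T_tail 1(2) l by blast
  have e: "(\<lambda>u. tw F (x # u)) = fscale ((-1) ^ (l' * ldeg x)) (tw (\<lambda>u. F (x # u)))"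
  proof
    fix u
    show "tw F (x # u) = fscale ((-1) ^ (l' * ldeg x)) (tw (\<lambda>u. F (x # u))) u"
      using W.T_D[OF Fx, of u] by (cases "F (x # u) = 0") (auto simp: tw_def fscale_def power_add)
  qed
  have IH: "W.D (tw (\<lambda>u. F (x # u))) (y # v) = (-1) ^ twist (y # v) * bdr (\<lambda>u. F (x # u)) (y # v)"
    by (rule 1(1)[OF Fx]) (use 1 l in auto)
  have S: "(\<Sum>c | c \<in> letters \<and> ldeg c = ldeg x + ldeg y. delta c [x, y] * tw F (c # v)) =
     (-1) ^ twist (x # y # v) * (\<Sum>c | c \<in> letters \<and> ldeg c = ldeg x + ldeg y. coord c (x * y) * F (c # v))"
    unfolding sum_distrib_left
  proof (intro sum.cong refl)
    fix c assume "c \<in> {c \<in> letters. ldeg c = ldeg x + ldeg y}"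
    then show "delta c [x, y] * tw F (c # v) = (-1) ^ twist (x # y # v) * (coord c (x * y) * F (c # v))"
      using xy by (cases "even (ldeg x)"; cases "even (ldeg y)"; cases "even (length v)"; cases "even (twist v)")
        (simp_all add: delta_def tw_def minus_one_power_iff)
  qed
  have T: "(-1) ^ (ldeg x + 1) * ((-1) ^ (l' * ldeg x) * ((-1) ^ twist (y # v) * b)) =
      - ((-1) ^ twist (x # y # v) * b)" for b :: rat
    using l by (cases "even (ldeg x)"; cases "even l'"; cases "even (twist (y # v))")
      (simp_all add: minus_one_power_iff del: twist.simps(2) add: twist.simps(2)[of x])
  show ?case
    unfolding W.D_Cons[OF tw_T[OF 1(2)] xy(1,2)] S e W.D_linear bdr.simps
    unfolding fscale_def IH T by (simp add: right_diff_distrib)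
next
  case ("2_1" F)
  then show ?case by simp
next
  case ("2_2" F x)
  then have "tw F \<in> W.T P 0" using tw_T by simp
  then have "W.D (tw F) = 0"
    using W.T_0(1)[of "tw F" P] W.D_linear(4)[of "tw F []" "word []"] by (simp add: W.D_word)
  then show ?case by (simp add: fun_apply)
qed

lemma bdr_cong:
  assumes "\<And>u. u \<in> lists letters \<Longrightarrow> W.wgt u = W.wgt v \<Longrightarrow> Suc (length u) = length v \<Longrightarrow> f u = g u"
    and "v \<in> lists letters"
  shows "bdr f v = bdr g v"
  using assms
proof (induction f v arbitrary: g rule: bdr.induct)
  case (1 f x y v)
  have "bdr (\<lambda>u. f (x # u)) (y # v) = bdr (\<lambda>u. g (x # u)) (y # v)"
    by (rule 1(1)) (use 1(2,3) in auto)
  moreover have "f (c # v) = g (c # v)" if "c \<in> letters" "ldeg c = ldeg x + ldeg y" for c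
    using 1(2)[of "c # v"] 1(3) that by simp
  ultimately show ?case by (auto intro!: sum.cong)
qed auto

text \<open>Each product of neighbours is expanded in letters, which multilinearity allows.\<close>

lemma faces_letters:
  assumes "mlin f" "v \<in> lists letters" shows "faces f v = bdr f v"
  using assms
proof (induction f v rule: bdr.induct)
  case (1 f x y v)
  then have xy: "x \<in> letters" "y \<in> letters" "v \<in> lists letters" by auto
  have "ldeg x + ldeg y \<noteq> 0" using letters_pos[OF xy(1)] by simp
  then have "x * y = (\<Sum>c | c \<in> letters \<and> ldeg c = ldeg x + ldeg y. scale (coord c (x * y)) c)"
    using letters_sum[OF mult_in_component[OF letters_A letters_A, OF xy(1,2)]] by simp
  then have "f (x * y # v) = f ((\<Sum>c | c \<in> letters \<and> ldeg c = ldeg x + ldeg y. scale (coord c (x * y)) c) # v)"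
    by simp
  also have "\<dots> = (\<Sum>c | c \<in> letters \<and> ldeg c = ldeg x + ldeg y. coord c (x * y) * f (c # v))"
  proof -
    have "f ([] @ (\<Sum>c | c \<in> letters \<and> ldeg c = ldeg x + ldeg y. scale (coord c (x * y)) c) # v) =
        (\<Sum>c | c \<in> letters \<and> ldeg c = ldeg x + ldeg y. coord c (x * y) * f ([] @ c # v))"
      by (simp only: linD[OF mlin_linear[OF 1(2), of "[]" v]])
    then show ?thesis by simp
  qed
  finally show ?case
    using 1(1)[OF mlin_Cons[OF 1(2)]] xy by (simp add: faces_simps)
qed (simp_all add: faces_simps)

text \<open>The face that absorbs the head 1 gives v itself and is killed by assumption; the others
  are shifted by one position, whence the minus sign.\<close>

lemma faces_one:
  assumes "mlin f" "v \<in> lists letters" "f v = 0"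
  shows "faces f (1 # v) = - bdr (\<lambda>u. f (1 # u)) v"
proof (cases v)
  case Nil then show ?thesis by (simp add: faces_simps)
next
  case (Cons x v')
  then show ?thesis
    using faces_letters[OF mlin_Cons[OF assms(1)] assms(2)] assms(3) by (simp add: faces_simps)
qed

lemma bar_subspaces: "frat.subspace (bar_chains scale A p q)" "frat.subspace (bar_null scale A p q)"
  by (simp_all add: bar_chains_def bar_null_def)

lemma multilinearity_span_word: "multilinearity scale \<subseteq> frat.span (range word)"
  unfolding multilinearity_def
  by (auto intro!: frat.span_diff frat.span_scale intro: frat.span_base)

lemma bar_chains_span_word: "bar_chains scale A p q \<subseteq> frat.span (range word)"
  unfolding bar_chains_def
  using multilinearity_span_word by (intro frat.span_minimal) (auto intro: frat.span_base)

lemma multilinearity_null: "z \<in> multilinearity scale \<Longrightarrow> z \<in> bar_null scale A p q"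
  unfolding bar_null_def by (auto intro: frat.span_base)

lemma bar_word_null: "w \<in> bar_words A 1 p q \<Longrightarrow> word w \<in> bar_null scale A p q"
  unfolding bar_null_def by (auto intro: frat.span_base)

lemma bar_word_chains: "w \<in> bar_words A 0 p q \<Longrightarrow> word w \<in> bar_chains scale A p q"
  unfolding bar_chains_def by (auto intro: frat.span_base)

lemma T_ext:
  assumes "F \<in> W.T P l" "G \<in> W.T P l" "\<And>v. v \<in> W.words P \<Longrightarrow> length v = l \<Longrightarrow> F v = G v"
  shows "F = G"
proof
  fix v show "F v = G v"
    using W.T_D[OF assms(1), of v] W.T_D[OF assms(2), of v] assms(3)[of v] by metis
qed

text \<open>If the head has positive degree, so has the head of each face.\<close>

lemma faces_bar_eval_null:
  assumes "w \<in> bar_words A 1 p q" shows "faces (bar_eval q' G) w = 0"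
proof -
  obtain x xs d ds where w: "w = x # xs" and x: "1 \<le> d" "x \<in> A d"
    and xs: "list_all2 (\<lambda>y e. 1 \<le> e \<and> y \<in> A e) xs ds"
    using assms unfolding bar_words_def by blast
  show ?thesis
  proof (cases xs)
    case Nil then show ?thesis by (simp add: w faces_simps)
  next
    case (Cons y ys)
    then obtain e where "y \<in> A e" using xs by (auto simp: list_all2_Cons1)
    then have "x * y \<in> A (d + e)" using mult_in_component x(2) by blast
    moreover have "faces (\<lambda>u. bar_eval q' G (x # u)) (y # ys) = 0"
      using bar_eval_head[OF x(2,1)] by (simp add: faces_def)
    ultimately show ?thesis using x(1) by (simp add: w Cons faces_simps bar_eval_head)
  qed
qed

lemma faces_bar_eval_one:
  assumes "G \<in> W.T q l" "v \<in> W.words q" "length v = Suc l"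
  shows "faces (bar_eval q G) (1 # v) = - bdr G v"
proof -
  have v: "v \<in> lists letters" using assms(2) by (simp add: W.words_def)
  obtain x xs where "v = x # xs" using assms(3) by (cases v) auto
  then have "bar_eval q G v = 0"
    using bar_eval_head[OF letters_A letters_pos] v by simp
  then have "faces (bar_eval q G) (1 # v) = - bdr (\<lambda>u. bar_eval q G (1 # u)) v"
    by (rule faces_one[OF mlin_bar_eval v])
  also have "bdr (\<lambda>u. bar_eval q G (1 # u)) v = bdr G v"
    by (rule bdr_cong[OF bar_eval_one v]) (use assms(2) in \<open>simp add: W.words_def\<close>)
  finally show ?thesis .
qed

text \<open>The passage opposite to \<open>bar_eval\<close>: from a functional on bar chains to an
  element of T.\<close>

definition word_values :: "(('a list \<Rightarrow> rat) \<Rightarrow> unit \<Rightarrow> rat) \<Rightarrow> nat \<Rightarrow> nat \<Rightarrow> 'a list \<Rightarrow> rat" where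
  "word_values g q l v = (if v \<in> W.words q \<and> length v = l then g (word (1 # v)) () else 0)"

lemma word_values_T: "word_values g q l \<in> W.T q l"
  by (auto simp: word_values_def W.T_def)

lemma bar_d_word_values:
  assumes g: "flinear g" "\<And>x. x \<in> bar_null scale A l q \<Longrightarrow> g x = 0"
    and v: "v \<in> W.words q" "length v = Suc l"
  shows "g (bar_d_word (1 # v)) () = - bdr (word_values g q l) v"
proof -
  define f where "f w = g (word w) ()" for w
  have f: "mlin f" unfolding f_def using mlin_iff_kills[OF g(1)] g(2) multilinearity_null by blast
  have vl: "v \<in> lists letters" using v(1) by (simp add: W.words_def)
  have f0: "f v = 0" using g(2)[OF bar_word_null[OF bar_words_letters[OF v]]] by (simp add: f_def fun_apply)
  have "g (bar_d_word (1 # v)) () = faces f (1 # v)" unfolding f_def by (rule flinear_bar_d_word[OF g(1)])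
  also have "\<dots> = - bdr (\<lambda>u. f (1 # u)) v" by (rule faces_one[OF f vl f0])
  also have "bdr (\<lambda>u. f (1 # u)) v = bdr (word_values g q l) v"
    by (rule bdr_cong[OF _ vl]) (use v in \<open>simp add: word_values_def f_def W.words_def\<close>)
  finally show ?thesis .
qed

text \<open>A cycle of T gives a functional g on bar chains that vanishes on boundaries. As Tor
  vanishes, g also vanishes on cycles, so it factors through the bar differential as h; the values
  of h on letter words give the primitive.\<close>

lemma exact_T_if_tor_zero:
  assumes p: "1 \<le> p" and tor: "sq_zero (tor scale A p q)"
  shows "W.exact_at W.T q p"
  unfolding W.exact_at_def
proof (intro ballI impI)
  obtain l where l: "p = Suc l" using p by (cases p) auto
  fix F0 assume F0: "F0 \<in> W.T q p" "W.D F0 = 0"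
  define F where "F = tw F0"
  have F: "F \<in> W.T q p" "tw F = F0" by (simp_all add: F_def tw_T F0 tw_tw)
  have bF: "bdr F v = 0" if "v \<in> W.words q" "length v = Suc p" for v
    using D_tw[OF F(1), of v] that F0(2) by (simp add: F(2) W.words_def fun_apply)
  obtain d :: "('a list \<Rightarrow> rat) \<Rightarrow> 'a list \<Rightarrow> rat" where d: "flinear d" "\<And>w. d (word w) = bar_d_word w"
    "\<And>z. z \<in> frat.span (range word) \<Longrightarrow> bar_d z = d z"
    using bar_d_linear_extension by blast
  have d': "bar_d z = d z" if "z \<in> bar_chains scale A r s" for z r s
    using d(3) bar_chains_span_word that by blast
  obtain g :: "('a list \<Rightarrow> rat) \<Rightarrow> unit \<Rightarrow> rat" where
    g: "flinear g" "\<And>w. g (word w) = (\<lambda>_. bar_eval q F w)"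
    using word_extend[of "\<lambda>w _. bar_eval q F w"] by blast
  have gd: "flinear (\<lambda>z. g (d z))" by (rule flinear_compose[OF g(1) d(1)])
  have gdw: "g (d (word w)) = 0 \<longleftrightarrow> faces (bar_eval q F) w = 0" for w
    using flinear_bar_d_word[OF g(1), of w] by (auto simp: d(2) g(2) fun_eq_iff fun_apply)
  have g_bd: "g (d z) = 0" if "z \<in> bar_chains scale A (Suc p) q" for z
  proof (rule kills_bar_chains[OF gd _ _ _ that])
    have "mlin (\<lambda>w. g (d (word w)) ())"
      using faces_mlin[OF mlin_bar_eval] flinear_bar_d_word[OF g(1)] by (simp add: d(2) g(2))
    then show "g (d z) = 0" if "z \<in> multilinearity scale" for z
      using mlin_iff_kills[OF gd] that by blast
    show "g (d (word w)) = 0" if "w \<in> bar_words A 1 (Suc p) q" for w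
      using faces_bar_eval_null[OF that] gdw by blast
    show "g (d (word (1 # v))) = 0" if "v \<in> W.words q" "length v = Suc p" for v
      using faces_bar_eval_one[OF F(1) that] bF[OF that] gdw by simp
  qed
  have ker: "g z = 0" if "z \<in> bar_chains scale A p q" "d z \<in> bar_null scale A l q" for z
  proof -
    have "z \<in> fst (tor scale A p q)" using that d' l by (simp add: tor_def)
    then obtain z' n where z': "z = bar_d z' + n" "z' \<in> bar_chains scale A (Suc p) q" "n \<in> bar_null scale A p q"
      using tor unfolding sq_zero_def tor_def by auto
    then show ?thesis
      using g_bd[OF z'(2)] bar_eval_kills_null[OF g z'(3)] d'[OF z'(2)] by (simp add: flinearD[OF g(1)])
  qed
  obtain h where h: "flinear h" "\<And>z. z \<in> bar_chains scale A p q \<Longrightarrow> h (d z) = g z"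
    "\<And>x. x \<in> bar_null scale A l q \<Longrightarrow> h x = 0"
    using functional_factors[OF bar_subspaces d(1) g(1) ker] by blast
  define G where "G = word_values h q l"
  have G: "G \<in> W.T q l" by (simp add: G_def word_values_T)
  have FG: "F v = - bdr G v" if v: "v \<in> W.words q" "length v = p" for v
  proof -
    have "F v = g (word (1 # v)) ()" by (simp add: g(2) bar_eval_one[OF v(1)])
    also have "\<dots> = h (bar_d_word (1 # v)) ()"
      using h(2)[OF bar_word_chains[OF bar_words_one[OF v]]] by (simp add: d(2))
    also have "\<dots> = - bdr G v"
      unfolding G_def by (rule bar_d_word_values[OF h(1,3)]) (use v l in auto)
    finally show ?thesis .
  qed
  \<comment> \<open>The minus sign undoes the one of \<open>faces_one\<close>.\<close>
  have y: "fscale (-1) (tw G) \<in> W.T q (p - 1)"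
    using frat.subspace_scale[OF W.T_subspace tw_T[OF G], of "-1"] l by simp
  have "W.D (fscale (-1) (tw G)) = F0"
  proof (rule T_ext[OF _ F0(1)])
    show "W.D (fscale (-1) (tw G)) \<in> W.T q p" using W.D_T[OF y] l by simp
    fix v assume v: "v \<in> W.words q" "length v = p"
    then have "W.D (tw G) v = (-1) ^ twist v * bdr G v"
      by (intro D_tw[OF G]) (auto simp: W.words_def l)
    moreover have "F0 v = (-1) ^ twist v * F v" using F(2) by (auto simp: tw_def fun_eq_iff)
    ultimately show "W.D (fscale (-1) (tw G)) v = F0 v"
      using FG[OF v] by (simp add: W.D_linear fun_apply)
  qed
  then show "\<exists>y\<in>W.T q (p - 1). W.D y = F0" using y by blast
qed

text \<open>A bar cycle z outside the boundaries Y is detected by a functional g that kills Y. Its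
  values form a cycle of T, hence a boundary given by some G. Correcting g by the functional e of G
  composed with the bar differential gives zero on all chains; but the correction vanishes at the
  cycle z, so g z = 0.\<close>

lemma tor_zero_if_exact_T:
  assumes p: "1 \<le> p" and exact: "W.exact_at W.T q p"
  shows "sq_zero (tor scale A p q)"
proof -
  obtain l where l: "p = Suc l" using p by (cases p) auto
  obtain d :: "('a list \<Rightarrow> rat) \<Rightarrow> 'a list \<Rightarrow> rat" where d: "flinear d" "\<And>w. d (word w) = bar_d_word w"
    "\<And>z. z \<in> frat.span (range word) \<Longrightarrow> bar_d z = d z"
    using bar_d_linear_extension by blast
  have d': "bar_d z = d z" if "z \<in> bar_chains scale A r s" for z r s
    using d(3) bar_chains_span_word that by blast
  define Y where "Y = {bar_d z + n | z n. z \<in> bar_chains scale A (Suc p) q \<and> n \<in> bar_null scale A p q}"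
  have Y: "frat.subspace Y"
  proof -
    interpret d: Vector_Spaces.linear fscale fscale d by (rule d(1))
    have "Y = {x + y |x y. x \<in> d ` bar_chains scale A (Suc p) q \<and> y \<in> bar_null scale A p q}"
      unfolding Y_def using d'[of _ "Suc p" q] by (auto; metis image_eqI)
    then show ?thesis
      using frat.subspace_sums[OF d.subspace_image[OF bar_subspaces(1)] bar_subspaces(2)] by simp
  qed
  have Y1: "d z \<in> Y" if "z \<in> bar_chains scale A (Suc p) q" for z
    unfolding Y_def using that d'[OF that] frat.subspace_0[OF bar_subspaces(2)[of p q]]
    by (metis (mono_tags, lifting) add.right_neutral mem_Collect_eq)
  have Y2: "n \<in> Y" if "n \<in> bar_null scale A p q" for n
    unfolding Y_def using that d'[of 0 "Suc p" q] frat.subspace_0[OF bar_subspaces(1)[of "Suc p" q]]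
      flinearD(5)[OF d(1)]
    by (metis (mono_tags, lifting) add.left_neutral mem_Collect_eq)
  have "z \<in> Y" if z: "z \<in> bar_chains scale A p q" "bar_d z \<in> bar_null scale A l q" for z
  proof (rule ccontr)
    assume "z \<notin> Y"
    then obtain g :: "('a list \<Rightarrow> rat) \<Rightarrow> unit \<Rightarrow> rat" where
      g: "flinear g" "\<And>x. x \<in> Y \<Longrightarrow> g x = 0" "g z \<noteq> 0"
      using separating_functional[OF Y] by blast
    define F where "F = word_values g q p"
    have F: "F \<in> W.T q p" by (simp add: F_def word_values_T)
    have "W.D (tw F) = 0"
    proof (rule T_ext[OF W.D_T[OF tw_T[OF F]] frat.subspace_0[OF W.T_subspace]])
      fix v assume v: "v \<in> W.words q" "length v = Suc p"
      then have vl: "v \<in> lists letters" by (simp add: W.words_def)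
      have "g (bar_d_word (1 # v)) () = 0"
        using g(2)[OF Y1[OF bar_word_chains[OF bar_words_one[OF v]]]] by (simp add: d(2) fun_apply)
      then have "bdr F v = 0" using bar_d_word_values[OF g(1) g(2)[OF Y2] v] by (simp add: F_def)
      then show "W.D (tw F) v = 0 v" using D_tw[OF F vl v(2)] by (simp add: fun_apply)
    qed
    then obtain y where y: "y \<in> W.T q l" "W.D y = tw F"
      using exact tw_T[OF F] unfolding W.exact_at_def l by auto
    define G where "G = tw y"
    have G: "G \<in> W.T q l" "tw G = y" by (simp_all add: G_def tw_T y tw_tw)
    have GF: "bdr G v = F v" if v: "v \<in> W.words q" "length v = p" for v
    proof -
      have "W.D (tw G) v = (-1) ^ twist v * bdr G v"
        using v by (intro D_tw[OF G(1)]) (auto simp: W.words_def l)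
      then show ?thesis by (simp add: G(2) y(2) tw_def)
    qed
    obtain e :: "('a list \<Rightarrow> rat) \<Rightarrow> unit \<Rightarrow> rat" where
      e: "flinear e" "\<And>w. e (word w) = (\<lambda>_. bar_eval q G w)"
      using word_extend[of "\<lambda>w _. bar_eval q G w"] by blast
    have ed: "flinear (\<lambda>z. e (d z))" by (rule flinear_compose[OF e(1) d(1)])
    have edw: "e (d (word w)) = (\<lambda>_. faces (bar_eval q G) w)" for w
      using flinear_bar_d_word[OF e(1), of w] by (auto simp: d(2) e(2) fun_eq_iff)
    \<comment> \<open>On the spanning words \<open>1 # v\<close> the second summand is -
      \<open>bdr G v\<close> = - \<open>F v\<close>.\<close>
    have "g z + e (d z) = 0"
    proof (rule kills_bar_chains[OF flinear_add[OF g(1) ed] _ _ _ z(1)])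
      have "mlin (\<lambda>w. e (d (word w)) ())" using faces_mlin[OF mlin_bar_eval] by (simp add: edw)
      then show "g x + e (d x) = 0" if "x \<in> multilinearity scale" for x
        using mlin_iff_kills[OF ed] that g(2)[OF Y2[OF multilinearity_null]] by simp
      show "g (word w) + e (d (word w)) = 0" if "w \<in> bar_words A 1 p q" for w
        using faces_bar_eval_null[OF that] g(2)[OF Y2[OF bar_word_null[OF that]]]
        by (simp add: edw fun_eq_iff fun_apply)
      show "g (word (1 # v)) + e (d (word (1 # v))) = 0" if v: "v \<in> W.words q" "length v = p" for v
      proof -
        have "g (word (1 # v)) () = F v" using v by (simp add: F_def word_values_def)
        then show ?thesis
          using faces_bar_eval_one[OF G(1) v(1)] v(2) GF[OF v] l by (simp add: edw fun_eq_iff fun_apply)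
      qed
    qed
    moreover have "e (d z) = 0"
      using bar_eval_kills_null[OF e z(2)] d'[OF z(1)] by simp
    ultimately show False using g(3) by simp
  qed
  then show ?thesis unfolding sq_zero_def tor_def using l by (auto simp: Y_def)
qed

text \<open>Without bars the internal degree is that of the head, so for positive q every chain is
  null.\<close>

lemma tor_zero_0:
  assumes "q \<noteq> 0" shows "sq_zero (tor scale A 0 q)"
proof -
  have "bar_words A 0 0 q \<subseteq> bar_words A 1 0 q" unfolding bar_words_def using assms by force
  then have "bar_chains scale A 0 q \<subseteq> bar_null scale A 0 q"
    unfolding bar_chains_def bar_null_def by (intro frat.span_mono) blast
  moreover have "bar_d 0 = 0" by (simp add: bar_d_def fun_apply)
  ultimately have "z = bar_d 0 + z \<and> 0 \<in> bar_chains scale A (Suc 0) q \<and> z \<in> bar_null scale A 0 q"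
    if "z \<in> bar_chains scale A 0 q" for z
    using that frat.subspace_0[OF bar_subspaces(1)[of "Suc 0" q]] by auto
  then show ?thesis unfolding sq_zero_def tor_def fst_conv snd_conv by blast
qed

theorem koszul_iff_exact_T: "koszul scale A \<longleftrightarrow> (\<forall>P l. P \<noteq> l \<longrightarrow> W.exact_at W.T P l)"
proof -
  have "W.exact_at W.T P 0" if "P \<noteq> 0" for P
    unfolding W.exact_at_def using W.T_0(2)[OF _ that] W.D_linear(5) frat.subspace_0[OF W.T_subspace] by metis
  then have "W.exact_at W.T P l \<longleftrightarrow> sq_zero (tor scale A l P)" if "P \<noteq> l" for P l
    using that tor_zero_0[of P] exact_T_if_tor_zero[of l P] tor_zero_if_exact_T[of l P] by (cases l) auto
  then show ?thesis unfolding koszul_def by metis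
qed

end

section \<open>Tensors on the dual of the augmentation ideal, restricted to basis letters\<close>

context koszul_setup begin

text \<open>The tensor product of dual basis vectors, as a function on words of arbitrary elements
  of A; \<open>word w\<close> is its restriction to words of letters.\<close>

primrec ew :: "'a list \<Rightarrow> 'a list \<Rightarrow> rat" where
  "ew [] = word []"
| "ew (b # w) = tmul (gen (coord b)) (ew w)"

lemma ew_append: "tmul (ew u) (ew w) = ew (u @ w)"
  by (induction u) (simp_all add: tmul_word_Nil tmul_assoc)

definition tensors :: "('a list \<Rightarrow> rat) set" where
  "tensors = frat.span (ew ` lists letters)"

lemma tensors_subspace: "frat.subspace tensors"
  by (simp add: tensors_def)

lemma tensors_tmul: assumes "F \<in> tensors" "G \<in> tensors" shows "tmul F G \<in> tensors"
proof (rule span_linear_mem[OF assms(1)[unfolded tensors_def] flinear_tmul(2) tensors_subspace])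
  fix x assume "x \<in> ew ` lists letters"
  then obtain u where u: "u \<in> lists letters" "x = ew u" by blast
  show "tmul x G \<in> tensors"
  proof (rule span_linear_mem[OF assms(2)[unfolded tensors_def] flinear_tmul(1) tensors_subspace])
    fix y assume "y \<in> ew ` lists letters"
    then show "tmul x y \<in> tensors"
      using u by (auto simp: tensors_def ew_append intro!: frat.span_base imageI simp del: in_lists_conv_set)
  qed
qed

lemma tensors_gr_bracket: "F \<in> tensors \<Longrightarrow> G \<in> tensors \<Longrightarrow> gr_bracket m n F G \<in> tensors"
  unfolding gr_bracket_def
  by (intro frat.subspace_diff[OF tensors_subspace] frat.subspace_scale[OF tensors_subspace] tensors_tmul)

lemma dual_expand:
  assumes f: "f \<in> graded_dual scale A q"
  shows "f = (\<Sum>b\<in>bas q. fscale (f b) (coord b))"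
proof
  fix x
  note l = linD[OF dualD(1)[OF f]]
  have "f x = (\<Sum>b\<in>bas q. f b * coord b x)"
  proof (rule lin_ext[OF dualD(1)[OF f]])
    show "Vector_Spaces.linear scale (*) (\<lambda>x. \<Sum>b\<in>bas q. f b * coord b x)"
      by (rule linI) (simp_all add: coord_simps algebra_simps sum.distrib sum_distrib_left)
    fix n x assume x: "x \<in> A n"
    show "f x = (\<Sum>b\<in>bas q. f b * coord b x)"
    proof (cases "n = q")
      case True
      have "f x = f (\<Sum>b\<in>bas q. scale (coord b x) b)" using coord_expand x True by simp
      then show ?thesis by (simp add: l mult.commute)
    next
      case False
      then have "f x = 0" "\<And>b. b \<in> bas q \<Longrightarrow> coord b x = 0"
        using dualD(2)[OF f x] dualD(2)[OF coord_dual x] ldeg by auto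
      then show ?thesis by simp
    qed
  qed
  then show "f x = (\<Sum>b\<in>bas q. fscale (f b) (coord b)) x" by (simp add: sum_fun_rat fscale_def)
qed

lemma gen_coord_tensors: "b \<in> letters \<Longrightarrow> gen (coord b) \<in> tensors"
proof -
  assume "b \<in> letters"
  then have "ew [b] \<in> tensors" unfolding tensors_def by (intro frat.span_base imageI) simp
  moreover have "ew [b] = gen (coord b)"
  proof
    fix v show "ew [b] v = gen (coord b) v"
      by (cases v) (auto simp: tmul_Nil tmul_Cons gen_def word_def tmul_def split: list.splits)
  qed
  ultimately show ?thesis by simp
qed

lemma gen_expand: "f \<in> graded_dual scale A q \<Longrightarrow> gen f = (\<Sum>b\<in>bas q. fscale (f b) (gen (coord b)))"
  using arg_cong[OF dual_expand, of f q gen] by (simp add: flinearD[OF flinear_gen])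

lemma gen_tensors: "f \<in> graded_dual scale A q \<Longrightarrow> q \<noteq> 0 \<Longrightarrow> gen f \<in> tensors"
  unfolding gen_expand
  by (intro frat.subspace_sum[OF tensors_subspace] frat.subspace_scale[OF tensors_subspace] gen_coord_tensors)
    (auto simp: letters_def gr0_conv_Suc)

text \<open>Restriction to words of basis letters identifies the tensor algebra on the dual of the
  augmentation ideal with the functions of finite support on such words.\<close>

definition res :: "('a list \<Rightarrow> rat) \<Rightarrow> 'a list \<Rightarrow> rat" where
  "res F w = (if w \<in> lists letters then F w else 0)"

lemma flinear_res: "flinear res"
  by (rule flinearI) (auto simp: res_def fun_apply fscale_def)

lemmas res_linear = flinearD[OF flinear_res]

lemma res_tmul: "res (tmul F G) = tmul (res F) (res G)"
proof
  fix w
  have l: "take i w \<in> lists letters \<and> drop i w \<in> lists letters \<longleftrightarrow> w \<in> lists letters" for i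
    unfolding append_in_lists_conv[symmetric] by simp
  show "res (tmul F G) w = tmul (res F) (res G) w"
  proof (cases "w \<in> lists letters")
    case True
    then have "take i w \<in> lists letters" "drop i w \<in> lists letters" for i using l by blast+
    then show ?thesis using True by (simp only: res_def tmul_def if_True)
  next
    case False
    then have "res F (take i w) * res G (drop i w) = 0" for i
      using l[of i] by (simp only: res_def) (simp split: if_splits)
    then have "tmul (res F) (res G) w = 0" unfolding tmul_def by (intro sum.neutral) simp
    then show ?thesis using False by (simp only: res_def[of "tmul F G"] if_False)
  qed
qed

lemma res_gr_bracket: "res (gr_bracket m n F G) = gr_bracket m n (res F) (res G)"
  by (simp add: gr_bracket_def res_linear res_tmul)

lemma res_gen_coord: "b \<in> letters \<Longrightarrow> res (gen (coord b)) = word [b]"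
  by (rule ext) (auto simp: res_def gen_def word_def coord_letters split: list.splits)

lemma res_ew: "w \<in> lists letters \<Longrightarrow> res (ew w) = word w"
proof (induction w)
  case Nil then show ?case by (auto simp: res_def word_def)
next
  case (Cons b w) then show ?case by (simp add: res_tmul res_gen_coord tmul_word)
qed

lemma res_inverse: "\<exists>E. flinear E \<and> (\<forall>x\<in>tensors. E (res x) = x)"
proof -
  obtain E :: "('a list \<Rightarrow> rat) \<Rightarrow> 'a list \<Rightarrow> rat" where E: "flinear E" "\<And>w. E (word w) = ew w"
    using word_extend[of ew] by blast
  have "E (res x) = x" if "x \<in> tensors" for x
    by (rule fpair.linear_eq_on[OF flinear_compose[OF E(1) flinear_res] flinear_id that[unfolded tensors_def]])
      (clarify, simp only: E(2) res_ew in_listsI)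
  then show ?thesis using E(1) by blast
qed

lemma res_inj: "x \<in> tensors \<Longrightarrow> y \<in> tensors \<Longrightarrow> res x = res y \<Longrightarrow> x = y"
  using res_inverse by metis

lemma dim_res: assumes "Z \<subseteq> tensors" shows "frat.dim (res ` Z) = frat.dim Z"
proof -
  interpret r: Vector_Spaces.linear fscale fscale res by (rule flinear_res)
  obtain B where B: "B \<subseteq> Z" "frat.independent B" "Z \<subseteq> frat.span B"
    using frat.maximal_independent_subset by blast
  have sp: "frat.span B = frat.span Z"
    using frat.span_mono[OF B(1)] frat.span_minimal[OF B(3)] by auto
  have "frat.span B \<subseteq> tensors" using B(1) assms by (intro frat.span_minimal tensors_subspace) auto
  then have inj: "inj_on res (frat.span B)" using res_inj by (auto simp: inj_on_def)
  have "frat.independent (res ` B)" by (rule r.independent_inj_on_image[OF B(2) inj])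
  moreover have "frat.span (res ` B) = frat.span (res ` Z)" by (simp add: r.span_image sp)
  ultimately have "frat.dim (res ` Z) = card (res ` B)" by (metis frat.dim_eq_card)
  also have "\<dots> = card B" by (rule card_image[OF inj_on_subset[OF inj frat.span_superset]])
  also have "\<dots> = frat.dim Z" by (metis frat.dim_eq_card sp B(2))
  finally show ?thesis .
qed

lemma res_gen:
  assumes c: "c \<in> graded_dual scale A q" "q \<noteq> 0"
  shows "res (gen c) \<in> W.lie q 1"
    "W.D (res (gen c)) = (\<lambda>w. case w of [x, y] \<Rightarrow>
      if x \<in> letters \<and> y \<in> letters then (-1) ^ ldeg x * c (x * y) else 0 | _ \<Rightarrow> 0)"
proof -
  have l: "b \<in> letters \<and> ldeg b = q" if "b \<in> bas q" for b
    using that c(2) by (auto simp: letters_def ldeg gr0_conv_Suc)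
  have r: "res (gen c) = (\<Sum>b\<in>bas q. fscale (c b) (word [b]))"
    by (subst gen_expand[OF c(1)]) (simp add: res_linear res_gen_coord l)
  show "res (gen c) \<in> W.lie q 1"
    unfolding r using W.lie_intros(1) l
    by (intro frat.subspace_sum[OF W.lie_subspace] frat.subspace_scale[OF W.lie_subspace]) metis
  have "W.D (res (gen c)) = (\<Sum>b\<in>bas q. fscale (c b) (delta b))"
    unfolding r W.D_linear by (intro sum.cong refl) (simp add: W.D_letter l)
  moreover have "(\<Sum>b\<in>bas q. fscale (c b) (delta b)) w = (case w of [x, y] \<Rightarrow>
      if x \<in> letters \<and> y \<in> letters then (-1) ^ ldeg x * c (x * y) else 0 | _ \<Rightarrow> 0)" for w
  proof (cases "\<exists>x y. w = [x, y] \<and> x \<in> letters \<and> y \<in> letters")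
    case False
    then show ?thesis by (auto simp: sum_fun_rat fscale_def delta_def split: list.splits)
  next
    case True
    then obtain x y where w: "w = [x, y]" "x \<in> letters" "y \<in> letters" by blast
    have "c (x * y) = (\<Sum>b\<in>bas q. c b * coord b (x * y))"
      using fun_cong[OF dual_expand[OF c(1)], of "x * y"] by (simp add: sum_fun_rat fscale_def)
    then show ?thesis using w
      by (simp add: sum_fun_rat fscale_def delta_def sum_distrib_left mult.left_commute)
  qed
  ultimately show "W.D (res (gen c)) = (\<lambda>w. case w of [x, y] \<Rightarrow>
      if x \<in> letters \<and> y \<in> letters then (-1) ^ ldeg x * c (x * y) else 0 | _ \<Rightarrow> 0)" by auto
qed

section \<open>The holonomy Lie algebra\<close>

abbreviation V1 :: "('a \<Rightarrow> rat) set" where "V1 \<equiv> graded_dual scale A 1"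

text \<open>Bidegree (n, n) has even parity, so there the graded commutator is the plain
  one.\<close>

lemma free_lie_res:
  assumes "x \<in> free_lie V1 n" shows "x \<in> tensors \<and> res x \<in> W.lie n n"
proof -
  have "(n, x) \<in> lie_closure (\<lambda>_ _. bracket) {(1, gen f) | f. f \<in> V1}"
    using assms by (simp add: free_lie_def)
  then show ?thesis
  proof (induction rule: lie_closure.induct)
    case (base n x) then show ?case using gen_tensors[of _ 1] res_gen(1)[of _ 1] by auto
  next
    case zero then show ?case using frat.subspace_0[OF tensors_subspace] by (simp add: res_linear W.lie_intros)
  next
    case add then show ?case using frat.subspace_add[OF tensors_subspace] by (simp add: res_linear W.lie_intros)
  next
    case scale then show ?case using frat.subspace_scale[OF tensors_subspace] by (simp add: res_linear W.lie_intros)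
  next
    case (bracket m x n y)
    have b: "bracket = gr_bracket (m + m) (n + n)" by (rule bracket_gr_bracket[symmetric]) simp
    show ?case
      unfolding b res_gr_bracket
      using bracket.IH tensors_gr_bracket W.lie_intros(5) by blast
  qed
qed

lemma free_lie_closed:
  "0 \<in> free_lie V n" "x \<in> free_lie V n \<Longrightarrow> y \<in> free_lie V n \<Longrightarrow> x + y \<in> free_lie V n"
  "x \<in> free_lie V n \<Longrightarrow> fscale c x \<in> free_lie V n"
  "x \<in> free_lie V m \<Longrightarrow> z \<in> free_lie V n \<Longrightarrow> bracket x z \<in> free_lie V (m + n)"
  unfolding free_lie_def by (auto intro: lie_closure.intros)

text \<open>Letters have degree at least 1, so weight equals length only for brackets of letters of
  degree 1. The alternative \<open>y = 0\<close> is needed since zero lies in every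
  bidegree.\<close>

lemma lie_diagonal:
  assumes "y \<in> W.lie P l"
  shows "y = 0 \<or> l \<le> P \<and> (P = l \<longrightarrow> (\<exists>x\<in>free_lie V1 l. res x = y))"
  using assms
proof (induction rule: W.lie_induct)
  case (letter i)
  have "gen (coord i) \<in> free_lie V1 1" if "ldeg i = 1"
    unfolding free_lie_def mem_Collect_eq by (rule lie_closure.base) (use coord_dual[of i] that in auto)
  then show ?case using letters_pos[OF letter] res_gen_coord[OF letter] by auto
next
  case (add P l x y)
  then show ?case using free_lie_closed(2) by (metis add_0 add.right_neutral res_linear(1))
next
  case (scale P l c x)
  then show ?case using free_lie_closed(3) by (metis frat.scale_zero_right res_linear(4))
next
  case (bracket P l Q m x y)
  show ?case
  proof (cases "x = 0 \<or> y = 0")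
    case True
    then show ?thesis by (auto simp: gr_bracket_def tmul_zero_left tmul_zero_right)
  next
    case False
    then have le: "l \<le> P" "m \<le> Q" using bracket.IH by auto
    have "\<exists>z\<in>free_lie V1 (l + m). res z = gr_bracket (P + l) (Q + m) x y" if "P + Q = l + m"
    proof -
      have "P = l" "Q = m" using that le by auto
      then obtain x' y' where "x' \<in> free_lie V1 l" "res x' = x" "y' \<in> free_lie V1 m" "res y' = y"
        using bracket.IH False by blast
      moreover have "bracket = gr_bracket (P + l) (Q + m)"
        by (rule bracket_gr_bracket[symmetric]) (simp add: \<open>P = l\<close>)
      ultimately show ?thesis using free_lie_closed(4)[of x' V1 l y' m] res_gr_bracket by metis
    qed
    then show ?thesis using le by auto
  qed
qed auto

lemma res_free_lie: "res ` free_lie V1 n = W.lie n n"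
proof
  show "W.lie n n \<subseteq> res ` free_lie V1 n"
    using lie_diagonal[of _ n n] free_lie_closed(1) res_linear(5) by (metis image_eqI subsetI)
qed (use free_lie_res in auto)

text \<open>The sum is supported on pairs of letters of degree 1, where the sign in D is -1.\<close>

lemma nabla_sum:
  fixes N :: nat
  assumes ab: "\<And>i. i < N \<Longrightarrow> a i \<in> V1" "\<And>i. i < N \<Longrightarrow> b i \<in> V1"
    and c: "c \<in> graded_dual scale A 2"
    and cab: "\<And>x y. x \<in> A 1 \<Longrightarrow> y \<in> A 1 \<Longrightarrow> c (x * y) = (\<Sum>i<N. a i x * b i y - a i y * b i x)"
  shows "res (\<Sum>i<N. bracket (gen (a i)) (gen (b i))) = - W.D (res (gen c))"
proof
  define r where "r = (\<Sum>i<N. bracket (gen (a i)) (gen (b i)))"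
  fix w
  have "res r w = (- W.D (res (gen c))) w"
  proof (cases "\<exists>x y. w = [x, y] \<and> x \<in> letters \<and> y \<in> letters")
    case False
    then have "W.D (res (gen c)) w = 0"
      using res_gen(2)[OF c] by (auto split: list.splits)
    moreover have "res r w = 0"
    proof (cases "w \<in> lists letters")
      case True
      then have "\<nexists>x y. w = [x, y]" using False by auto
      then have "bracket (gen f) (gen g) w = 0" for f g
        by (auto simp: bracket_def tmul_gen fun_apply split: list.splits)
      then show ?thesis by (simp add: res_def r_def sum_fun_rat)
    qed (simp add: res_def)
    ultimately show ?thesis by (simp add: fun_apply)
  next
    case True
    then obtain x y where w: "w = [x, y]" "x \<in> letters" "y \<in> letters" by blast
    have 1: "res r w = (\<Sum>i<N. a i x * b i y - a i y * b i x)"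
      using w by (simp add: res_def r_def sum_fun_rat bracket_def tmul_gen fun_apply mult.commute)
    have 2: "W.D (res (gen c)) w = (-1) ^ ldeg x * c (x * y)"
      using res_gen(2)[OF c] w by simp
    show ?thesis
    proof (cases "ldeg x = 1 \<and> ldeg y = 1")
      case True
      then show ?thesis
        using 1 2 cab letters_A[OF w(2)] letters_A[OF w(3)] by (simp add: fun_apply)
    next
      case False
      then have "ldeg x + ldeg y \<noteq> 2" using letters_pos[OF w(2)] letters_pos[OF w(3)] by linarith
      then have "c (x * y) = 0"
        using dualD(2)[OF c mult_in_component[OF letters_A[OF w(2)] letters_A[OF w(3)]]] by simp
      moreover have "a i x * b i y - a i y * b i x = 0" if "i < N" for i
        using False dualD(2)[OF ab(1)[OF that]] dualD(2)[OF ab(2)[OF that]] letters_A w by fastforce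
      ultimately show ?thesis using 1 2 by (simp add: fun_apply)
    qed
  qed
  then show "res (\<Sum>i<N. bracket (gen (a i)) (gen (b i))) w = (- W.D (res (gen c))) w" by (simp add: r_def)
qed

lemma nabla_image_res:
  assumes "r \<in> nabla_image scale A" shows "r \<in> tensors" "res r \<in> W.D ` W.lie 2 1"
proof -
  obtain N :: nat and a b c where r: "r = (\<Sum>i<N. bracket (gen (a i)) (gen (b i)))"
    and ab: "\<And>i. i < N \<Longrightarrow> a i \<in> V1" "\<And>i. i < N \<Longrightarrow> b i \<in> V1"
    and c: "c \<in> graded_dual scale A 2"
    and cab: "\<And>x y. x \<in> A 1 \<Longrightarrow> y \<in> A 1 \<Longrightarrow> c (x * y) = (\<Sum>i<N. a i x * b i y - a i y * b i x)"
    using assms unfolding nabla_image_def by blast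
  have e: "bracket = (gr_bracket 0 0 :: ('a list \<Rightarrow> rat) \<Rightarrow> _)" by (rule bracket_gr_bracket[symmetric]) simp
  show "r \<in> tensors"
    unfolding r e using ab gen_tensors[of _ 1]
    by (auto intro!: frat.subspace_sum[OF tensors_subspace] tensors_gr_bracket)
  have "res r = W.D (- res (gen c))"
    unfolding r using nabla_sum[OF ab c cab] by (simp add: W.D_linear)
  moreover have "- res (gen c) \<in> W.lie 2 1"
    using frat.subspace_neg[OF W.lie_subspace] res_gen(1)[OF c] by simp
  ultimately show "res r \<in> W.D ` W.lie 2 1" by blast
qed

text \<open>The coefficient functionals of \<open>A\<^sup>1\<close> turn a functional on \<open>A\<^sup>2\<close> into an antisymmetric tensor.\<close>

lemma nabla_image_exists:
  assumes c: "c \<in> graded_dual scale A 2"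
  shows "\<exists>r\<in>nabla_image scale A. res r = - W.D (res (gen c))"
proof -
  note cl = linD[OF dualD(1)[OF c]]
  obtain h where h: "bij_betw h {..<card (bas 1)} (bas 1)"
    using ex_bij_betw_nat_finite[OF bas(1)[of 1]] by (auto simp: lessThan_atLeast0)
  define N where "N = card (bas 1)"
  \<comment> \<open>The factor 1/2 compensates the antisymmetrization: in degree 1, c (xy) = (c (xy)
    - c (yx)) / 2.\<close>
  define a where "a i = fscale (1/2) (coord (h i))" for i
  define b where "b i y = c (h i * cmp y 1)" for i y
  have hi: "h i \<in> bas 1" if "i < N" for i using h that by (auto simp: bij_betw_def N_def)
  have a: "a i \<in> V1" if "i < N" for i
    using coord_dual[of "h i"] ldeg[OF hi[OF that]] coord_simps[of "h i"]
    by (auto simp: a_def graded_dual_def fscale_def intro!: linI simp: algebra_simps)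
  have b: "b i \<in> V1" for i
    by (auto simp: graded_dual_def b_def cmp_add cmp_scale distrib_left scale_mult_right cl cmp_hom
        intro!: linI)
  have half: "(\<Sum>i<N. a i x * b i y) = 1/2 * c (x * y)" if "x \<in> A 1" "y \<in> A 1" for x y
  proof -
    have "(\<Sum>i<N. a i x * b i y) = (\<Sum>i<N. 1/2 * (coord (h i) x * c (h i * y)))"
      by (simp add: a_def b_def fscale_def cmp_hom[OF that(2)])
    also have "\<dots> = 1/2 * (\<Sum>u\<in>bas 1. coord u x * c (u * y))"
      unfolding sum_distrib_left N_def by (rule sum.reindex_bij_betw[OF h])
    also have "(\<Sum>u\<in>bas 1. coord u x * c (u * y)) = c ((\<Sum>u\<in>bas 1. scale (coord u x) u) * y)"
      by (simp add: sum_distrib_right cl scale_mult_left)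
    also have "\<dots> = c (x * y)" using coord_expand[OF that(1)] by simp
    finally show ?thesis .
  qed
  have cab: "c (x * y) = (\<Sum>i<N. a i x * b i y - a i y * b i x)" if "x \<in> A 1" "y \<in> A 1" for x y
  proof -
    have "c (x * y) = - c (y * x)"
      using arg_cong[OF commute_hom[OF that], of c] by (simp only: cl) simp
    then show ?thesis using half[OF that] half[OF that(2,1)] by (simp add: sum_subtractf)
  qed
  define r where "r = (\<Sum>i<N. bracket (gen (a i)) (gen (b i)))"
  have rn: "r \<in> nabla_image scale A"
    unfolding nabla_image_def r_def using a b c cab by blast
  then show ?thesis using nabla_sum[OF a b c cab] unfolding r_def by blast
qed

text \<open>In the subalgebra generated by the letters of degrees \<open>1\<close> and \<open>2\<close>, the elements of
  subdiagonal bidegree contain exactly one letter of degree \<open>2\<close>, and their boundaries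
  generate the ideal of quadratic relations.\<close>

abbreviation ideal1 :: "nat \<Rightarrow> ('a list \<Rightarrow> rat) set" where
  "ideal1 n \<equiv> {x. (n, x) \<in> lie_ideal V1 (nabla_image scale A)}"

text \<open>The value would have length n + 1 above its weight n.\<close>

lemma D_diagonal: "x \<in> W.lie n n \<Longrightarrow> W.D x = 0"
  by (rule W.T_gt_zero[OF W.D_T[OF W.lie_T]]) auto

lemma ideal_res:
  assumes "(n, x) \<in> lie_ideal V1 (nabla_image scale A)"
  shows "x \<in> tensors \<and> res x \<in> W.D ` W.lie n (n - 1)"
proof -
  interpret D: Vector_Spaces.linear fscale fscale W.D by (rule W.flinear_D)
  have sub: "frat.subspace (W.D ` W.lie n (n - 1))" for n by (rule D.subspace_image[OF W.lie_subspace])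
  show ?thesis
    using assms
  proof (induction rule: lie_ideal.induct)
    case (base r) then show ?case using nabla_image_res by simp
  next
    case zero then show ?case using frat.subspace_0[OF tensors_subspace] frat.subspace_0[OF sub] by (simp add: res_linear)
  next
    case add then show ?case using frat.subspace_add[OF tensors_subspace] frat.subspace_add[OF sub] by (simp add: res_linear)
  next
    case scale then show ?case using frat.subspace_scale[OF tensors_subspace] frat.subspace_scale[OF sub] by (simp add: res_linear)
  next
    case (bracket x m n y)
    obtain y' where y': "y' \<in> W.lie n (n - 1)" "res y = W.D y'" using bracket.IH by blast
    have x: "x \<in> tensors" "res x \<in> W.lie m m" using free_lie_res bracket.hyps by auto
    have b: "bracket = (gr_bracket (m + m) (n + n) :: ('a list \<Rightarrow> rat) \<Rightarrow> _)"
      by (rule bracket_gr_bracket[symmetric]) simp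
    have "bracket x y \<in> tensors" unfolding b using x bracket.IH tensors_gr_bracket by blast
    moreover have "res (bracket x y) \<in> W.D ` W.lie (m + n) (m + n - 1)"
    proof (cases n)
      case 0
      then have "y' = 0" using y' W.lie_0_left by simp
      then have "res (bracket x y) = 0"
        unfolding b res_gr_bracket y'(2) by (simp add: W.D_linear flinearD[OF gr_bracket_flinear(1)])
      then show ?thesis using frat.subspace_0[OF sub] by simp
    next
      case (Suc n')
      have e: "Suc (n + (n - 1)) = n + n" using Suc by simp
      \<comment> \<open>\<open>res x\<close> is a diagonal cycle of even parity, so the Leibniz rule
        leaves only the bracket with D y'.\<close>
      have "W.D (gr_bracket (m + m) (n + (n - 1)) (res x) y') = res (bracket x y)"
        using W.D_gr_bracket[OF W.lie_T[OF x(2)] W.lie_T[OF y'(1)] even_double even_double]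
        unfolding b res_gr_bracket y'(2) e
        by (simp add: D_diagonal[OF x(2)] flinearD[OF gr_bracket_flinear(2)])
      moreover have "gr_bracket (m + m) (n + (n - 1)) (res x) y' \<in> W.lie (m + n) (m + n - 1)"
        using W.lie_intros(5)[OF x(2) y'(1)] Suc by simp
      ultimately show ?thesis by (metis image_eqI)
    qed
    ultimately show ?case by blast
  qed
qed

text \<open>Stated as an implication so that the induction can run through all bidegrees. In a
  nonzero bracket on the subdiagonal one factor is diagonal, hence a cycle, and the other
  subdiagonal, so its boundary lies in the ideal by induction.\<close>

lemma lie_subdiagonal:
  assumes "y \<in> W.lie P l"
  shows "P = Suc l \<longrightarrow> (\<exists>x\<in>ideal1 P. res x = W.D y)"
  using assms
proof (induction rule: W.lie_induct)
  case (letter i)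
  show ?case
  proof
    assume d: "ldeg i = Suc 1"
    then have "coord i \<in> graded_dual scale A 2" using coord_dual[of i] by (simp add: numeral_2_eq_2)
    from nabla_image_exists[OF this] obtain r where
      r: "r \<in> nabla_image scale A" "res r = - W.D (word [i])" by (auto simp: res_gen_coord[OF letter])
    have "(2, fscale (-1) r) \<in> lie_ideal V1 (nabla_image scale A)"
      by (intro lie_ideal.scale lie_ideal.base r)
    moreover have "res (fscale (-1) r) = W.D (word [i])" unfolding res_linear r(2) by simp
    ultimately show "\<exists>x\<in>ideal1 (ldeg i). res x = W.D (word [i])"
      using d by (intro bexI[of _ "fscale (-1) r"]) (simp_all add: numeral_2_eq_2)
  qed
next
  case (zero P l)
  show ?case using lie_ideal.zero by (auto simp: W.D_linear res_linear intro!: exI[of _ 0])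
next
  case (add P l x y)
  then show ?case by (metis (no_types, lifting) lie_ideal.add mem_Collect_eq res_linear(1) W.D_linear(1))
next
  case (scale P l c x)
  then show ?case by (metis (no_types, lifting) lie_ideal.scale mem_Collect_eq res_linear(4) W.D_linear(4))
next
  case (bracket P l Q m x y)
  let ?b = "gr_bracket (P + l) (Q + m) x y"
  show ?case
  proof
    assume PQ: "P + Q = Suc (l + m)"
    note D = W.D_gr_bracket[OF W.lie_T[OF bracket.hyps(1)] W.lie_T[OF bracket.hyps(2)] even_double even_double]
    show "\<exists>z\<in>ideal1 (P + Q). res z = W.D ?b"
    proof (cases "x = 0 \<or> y = 0")
      case True
      then have "?b = 0" by (auto simp: gr_bracket_def tmul_zero_left tmul_zero_right)
      then show ?thesis using lie_ideal.zero by (auto simp: W.D_linear res_linear intro!: exI[of _ 0])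
    next
      case False
      then have "l \<le> P" "m \<le> Q" using lie_diagonal bracket.hyps by blast+
      then consider "P = l" "Q = Suc m" | "P = Suc l" "Q = m" using PQ by linarith
      then show ?thesis
      proof cases
        case 1
        obtain y' where y': "(Q, y') \<in> lie_ideal V1 (nabla_image scale A)" "res y' = W.D y"
          using bracket.IH(2) 1 by blast
        obtain x' where x': "x' \<in> free_lie V1 P" "res x' = x"
          using lie_diagonal[OF bracket.hyps(1)] 1 False by blast
        have b: "bracket = (gr_bracket (P + l) (Suc (Q + m)) :: ('a list \<Rightarrow> rat) \<Rightarrow> _)"
          by (rule bracket_gr_bracket[symmetric]) (simp add: 1)
        have "W.D x = 0" using D_diagonal bracket.hyps(1) 1 by blast
        then have "res (bracket x' y') = W.D ?b"
          unfolding b res_gr_bracket D using 1 x' y' by (simp add: flinearD[OF gr_bracket_flinear(2)])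
        then show ?thesis using lie_ideal.bracket[OF x'(1) y'(1)] by blast
      next
        case 2
        obtain x' where x': "(P, x') \<in> lie_ideal V1 (nabla_image scale A)" "res x' = W.D x"
          using bracket.IH(1) 2 by blast
        obtain y' where y': "y' \<in> free_lie V1 Q" "res y' = y"
          using lie_diagonal[OF bracket.hyps(2)] 2 False by blast
        have b: "bracket = (gr_bracket (Suc (P + l)) (Q + m) :: ('a list \<Rightarrow> rat) \<Rightarrow> _)"
          by (rule bracket_gr_bracket[symmetric]) (simp add: 2)
        \<comment> \<open>The ideal is closed under brackets with a free Lie element on the left;
          here that element stands on the right.\<close>
        have b': "bracket y' x' = - bracket x' y'" by (simp add: bracket_def)
        have "W.D y = 0" using D_diagonal bracket.hyps(2) 2 by blast
        then have "res (fscale (-1) (bracket y' x')) = W.D ?b"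
          unfolding b' unfolding b res_linear res_gr_bracket D x'(2) y'(2)
          by (simp add: flinearD[OF gr_bracket_flinear(1)])
        moreover have "(P + Q, fscale (-1) (bracket y' x')) \<in> lie_ideal V1 (nabla_image scale A)"
          using lie_ideal.scale[OF lie_ideal.bracket[OF y'(1) x'(1)]] by (simp only: add.commute)
        ultimately show ?thesis by blast
      qed
    qed
  qed
qed

lemma res_ideal: "res ` ideal1 n = W.D ` W.lie n (n - 1)"
proof
  show "W.D ` W.lie n (n - 1) \<subseteq> res ` ideal1 n"
  proof
    fix z assume "z \<in> W.D ` W.lie n (n - 1)"
    then obtain y where y: "y \<in> W.lie n (n - 1)" "z = W.D y" by blast
    show "z \<in> res ` ideal1 n"
    proof (cases n)
      case 0
      then have "y = 0" using y(1) W.lie_0_left by simp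
      then have "z = res 0" by (simp add: y(2) W.D_linear res_linear)
      then show ?thesis using lie_ideal.zero by blast
    next
      case (Suc m)
      then show ?thesis using lie_subdiagonal[OF y(1)] y(2) by (auto intro: sym)
    qed
  qed
qed (use ideal_res in auto)

end

section \<open>Dimensions of subspaces of finite-dimensional spaces\<close>

lemma subspace_basis:
  assumes "Z \<subseteq> frat.span W" "finite W"
  obtains B where "B \<subseteq> Z" "frat.independent B" "Z \<subseteq> frat.span B" "finite B" "card B = frat.dim Z"
proof -
  obtain B where B: "B \<subseteq> Z" "frat.independent B" "Z \<subseteq> frat.span B"
    using frat.maximal_independent_subset by blast
  then have "finite B" using frat.independent_span_bound[OF assms(2) B(2)] assms(1) by blast
  moreover have "frat.span B = frat.span Z"
    using frat.span_mono[OF B(1)] frat.span_minimal[OF B(3) frat.subspace_span] by blast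
  then have "card B = frat.dim Z" using frat.dim_eq_card B(2) by metis
  ultimately show ?thesis using B that by blast
qed

lemma dim_mono_finite:
  assumes "U \<subseteq> V" "V \<subseteq> frat.span W" "finite W" shows "frat.dim U \<le> frat.dim V"
proof -
  obtain B where "B \<subseteq> V" "frat.independent B" "V \<subseteq> frat.span B" "finite B" "card B = frat.dim V"
    by (rule subspace_basis[OF assms(2,3)])
  then show ?thesis using frat.dim_le_card[of U B] assms(1) by auto
qed

lemma subspace_eq_if_dim_eq:
  assumes U: "frat.subspace U" and "U \<subseteq> V" "V \<subseteq> frat.span W" "finite W" "frat.dim U = frat.dim V"
  shows "U = V"
proof -
  obtain B where B: "B \<subseteq> U" "frat.independent B" "U \<subseteq> frat.span B" "finite B" "card B = frat.dim U"
    by (rule subspace_basis[of U W]) (use assms in auto)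
  obtain C where C: "B \<subseteq> C" "C \<subseteq> V" "frat.independent C" "V \<subseteq> frat.span C"
  proof (rule frat.maximal_independent_subset_extend)
    show "B \<subseteq> V" using B(1) assms(2) by blast
    show "frat.independent B" by (rule B(2))
  qed
  have "finite C" using frat.independent_span_bound[OF assms(4) C(3)] C(2) assms(3) by blast
  moreover have "frat.span C = frat.span V"
    using frat.span_mono[OF C(2)] frat.span_minimal[OF C(4) frat.subspace_span] by blast
  then have "card C = frat.dim V" using frat.dim_eq_card C(3) by metis
  ultimately have "B = C" using card_subset_eq[of C B] C(1) B(5) assms(5) by simp
  then have "V \<subseteq> frat.span U" using C(4) frat.span_mono[OF B(1)] by blast
  then show ?thesis using assms(2) frat.span_minimal[OF order_refl U] by blast
qed

lemma dim_projection:
  assumes Z: "frat.subspace Z" "Z \<subseteq> frat.span W" "finite W" and p: "flinear p"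
    and pZ: "\<And>z. z \<in> Z \<Longrightarrow> p z \<in> Z" "\<And>z. z \<in> Z \<Longrightarrow> p (p z) = p z"
  shows "frat.dim Z = frat.dim (p ` Z) + frat.dim {z \<in> Z. p z = 0}"
proof -
  note pl = flinearD[OF p]
  obtain B where B: "B \<subseteq> p ` Z" "frat.independent B" "p ` Z \<subseteq> frat.span B" "finite B" "card B = frat.dim (p ` Z)"
    by (rule subspace_basis[of "p ` Z" W]) (use pZ(1) Z(2,3) in auto)
  obtain C where C: "C \<subseteq> {z \<in> Z. p z = 0}" "frat.independent C" "{z \<in> Z. p z = 0} \<subseteq> frat.span C"
    "finite C" "card C = frat.dim {z \<in> Z. p z = 0}"
    by (rule subspace_basis[of "{z \<in> Z. p z = 0}" W]) (use Z(2,3) in auto)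
  have pB: "p b = b" if "b \<in> B" for b using B(1) that pZ(2) by auto
  have pC: "p c = 0" if "c \<in> C" for c using C(1) that by auto
  have disj: "B \<inter> C = {}"
    using pB pC B(2) frat.dependent_zero by (metis disjoint_iff)
  have "frat.independent (B \<union> C)"
    unfolding frat.dependent_explicit
  proof (intro notI, elim exE conjE bexE)
    fix t and u :: "('a \<Rightarrow> rat) \<Rightarrow> rat" and v
    assume t: "finite t" "t \<subseteq> B \<union> C" "(\<Sum>v\<in>t. fscale (u v) v) = 0" and v: "v \<in> t" "u v \<noteq> 0"
    have split: "(\<Sum>v\<in>t. f v) = (\<Sum>v\<in>t \<inter> B. f v) + (\<Sum>v\<in>t \<inter> C. f v)"
      for f :: "('a \<Rightarrow> rat) \<Rightarrow> 'a \<Rightarrow> rat"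
    proof -
      have "t = (t \<inter> B) \<union> (t \<inter> C)" using t(2) by blast
      then show ?thesis using sum.union_disjoint[of "t \<inter> B" "t \<inter> C" f] t(1) disj by auto
    qed
    have "p (\<Sum>v\<in>t. fscale (u v) v) = (\<Sum>v\<in>t \<inter> B. fscale (u v) (p v)) + (\<Sum>v\<in>t \<inter> C. fscale (u v) (p v))"
      unfolding pl(6) pl(4) by (rule split)
    then have 1: "(\<Sum>v\<in>t \<inter> B. fscale (u v) v) = 0" using t(3) pB pC by (simp add: pl)
    then have 2: "(\<Sum>v\<in>t \<inter> C. fscale (u v) v) = 0" using t(3) split by simp
    show False
      using frat.independentD[OF B(2) _ _ 1] frat.independentD[OF C(2) _ _ 2] t(1,2) v by blast
  qed
  moreover have "frat.span (B \<union> C) = frat.span Z"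
  proof
    show "frat.span (B \<union> C) \<subseteq> frat.span Z" using B(1) C(1) pZ(1) by (intro frat.span_mono) auto
    have "z \<in> frat.span (B \<union> C)" if "z \<in> Z" for z
    proof -
      have "p z \<in> frat.span (B \<union> C)" using B(3) that frat.span_mono[of B "B \<union> C"] by blast
      moreover have "p (z - p z) = 0" using pZ(2)[OF that] by (simp add: pl)
      then have "z - p z \<in> frat.span (B \<union> C)"
        using C(3) frat.subspace_diff[OF Z(1) that pZ(1)[OF that]] frat.span_mono[of C "B \<union> C"] by blast
      ultimately have "p z + (z - p z) \<in> frat.span (B \<union> C)" by (rule frat.span_add)
      then show ?thesis by simp
    qed
    then show "frat.span Z \<subseteq> frat.span (B \<union> C)" by (intro frat.span_minimal frat.subspace_span) blast
  qed
  ultimately have "frat.dim Z = card (B \<union> C)" using frat.dim_eq_card by metis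
  then show ?thesis using card_Un_disjoint[OF B(4) C(4) disj] B(5) C(5) by simp
qed

section \<open>The Quillen model of the rescaled algebra\<close>

locale rescaled = koszul_setup scale A
  for scale :: "rat \<Rightarrow> 'a::ring_1 \<Rightarrow> 'a" and A :: "nat \<Rightarrow> 'a set" +
  fixes k :: nat
  assumes k: "0 < k"
begin

definition kap :: nat where "kap = 2 * k + 1"

lemma kap: "0 < kap" "odd kap" by (simp_all add: kap_def)

text \<open>Rescaling by an odd number keeps the parity: total degree and weight plus length agree
  modulo 2, so bracket signs are unchanged.\<close>

lemma kap_parity: "kap * P = n + l \<Longrightarrow> even (n + (P + l))"
proof -
  assume "kap * P = n + l"
  then have "even (n + l) \<longleftrightarrow> even P" using kap(2) by (metis even_mult_iff)
  then show ?thesis by auto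
qed

abbreviation RA :: "nat \<Rightarrow> 'a set" where "RA \<equiv> rescale_algebra k A"

lemma RA_mult: "RA (kap * q) = A q" "\<not> kap dvd p \<Longrightarrow> RA p = {0}"
  using kap unfolding rescale_algebra_def kap_def[symmetric] by simp_all

lemma RA_cases: "x \<in> RA p \<Longrightarrow> x = 0 \<or> (\<exists>q. p = kap * q \<and> x \<in> A q)"
  using RA_mult by (cases "kap dvd p") (auto elim!: dvdE)

lemma graded_algebra_RA: "graded_algebra scale RA"
proof (rule graded_algebra.intro[OF vector_space_axioms], rule graded_algebra_axioms.intro)
  fix c :: rat and x y :: 'a and m n :: nat
  show "scale c x * y = scale c (x * y)" "x * scale c y = scale c (x * y)"
    by (simp_all add: scale_mult_left scale_mult_right)
  show "subspace (RA n)"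
    using RA_mult subspace_component by (cases "kap dvd n") (auto elim!: dvdE)
  show "1 \<in> RA 0" using RA_mult(1)[of 0] one_in_component by simp
  show "x * y \<in> RA (m + n)" if xy: "x \<in> RA m" "y \<in> RA n"
  proof (cases "x = 0 \<or> y = 0")
    case True
    then show ?thesis using RA_mult by (cases "kap dvd (m + n)") (auto elim!: dvdE)
  next
    case False
    then obtain p q where "m = kap * p" "x \<in> A p" "n = kap * q" "y \<in> A q" using RA_cases xy by metis
    then show ?thesis using mult_in_component[of x p y q] RA_mult(1)[of "p + q"] by (simp add: distrib_left)
  qed
  show "\<exists>!f. (\<forall>n. f n \<in> RA n) \<and> finite {n. f n \<noteq> 0} \<and> x = (\<Sum>n | f n \<noteq> 0. f n)"
  proof (rule ex1I)
    define F where "F n = (if kap dvd n then cmp x (n div kap) else 0)" for n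
    have inj: "inj_on ((*) kap) S" for S using kap by (auto simp: inj_on_def)
    have supp: "{n. F n \<noteq> 0} = (*) kap ` {q. cmp x q \<noteq> 0}"
      using kap by (auto simp: F_def elim!: dvdE)
    have "(\<Sum>n | F n \<noteq> 0. F n) = (\<Sum>q | cmp x q \<noteq> 0. cmp x q)"
      unfolding supp by (subst sum.reindex[OF inj]) (use kap in \<open>simp add: F_def\<close>)
    then have "x = (\<Sum>n | F n \<noteq> 0. F n)" using cmp(3)[of x] by simp
    moreover have "F n \<in> RA n" for n
      using RA_mult(1)[of "n div kap"] cmp(1)[of x "n div kap"] RA_mult(2)[of n] by (auto simp: F_def)
    moreover have "finite {n. F n \<noteq> 0}" unfolding supp by (rule finite_imageI[OF cmp(2)])
    ultimately show "(\<forall>n. F n \<in> RA n) \<and> finite {n. F n \<noteq> 0} \<and> x = (\<Sum>n | F n \<noteq> 0. F n)" by blast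
    fix f assume f: "(\<forall>n. f n \<in> RA n) \<and> finite {n. f n \<noteq> 0} \<and> x = (\<Sum>n | f n \<noteq> 0. f n)"
    have supp': "{n. f n \<noteq> 0} = (*) kap ` {q. f (kap * q) \<noteq> 0}"
      using f RA_cases by (fastforce simp: image_iff)
    have "cmp x = (\<lambda>q. f (kap * q))"
    proof (rule cmp_eqI)
      show "f (kap * q) \<in> A q" for q using f RA_mult(1) by metis
      show "finite {q. f (kap * q) \<noteq> 0}"
        using f finite_imageD[OF _ inj] unfolding supp' by blast
      have "x = (\<Sum>n | f n \<noteq> 0. f n)" using f by blast
      also have "\<dots> = (\<Sum>q | f (kap * q) \<noteq> 0. f (kap * q))"
        unfolding supp' by (subst sum.reindex[OF inj]) simp
      finally show "x = (\<Sum>q | f (kap * q) \<noteq> 0. f (kap * q))" .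
    qed auto
    then show "f = F"
      using f RA_mult(2) by (auto simp: F_def fun_eq_iff)
  qed
qed

lemma finite_type_RA: "finite_type scale RA"
  unfolding finite_type_def
proof
  fix n show "\<exists>S. finite S \<and> RA n = span S"
  proof (cases "kap dvd n")
    case True
    then show ?thesis using RA_mult(1) finite_type unfolding finite_type_def by (metis dvdE)
  next
    case False
    then show ?thesis using RA_mult(2) span_empty by (metis finite.emptyI)
  qed
qed

lemma graded_commutative_RA: "graded_commutative RA"
  unfolding graded_commutative_def
proof (intro allI ballI)
  fix m n x y assume xy: "x \<in> RA m" "y \<in> RA n"
  show "x * y = (-1) ^ (m * n) * (y * x)"
  proof (cases "x = 0 \<or> y = 0")
    case False
    then obtain p q where *: "m = kap * p" "x \<in> A p" "n = kap * q" "y \<in> A q" using RA_cases xy by metis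
    have "(-1) ^ (m * n) = ((-1) ^ (p * q) :: 'a)" using kap(2) by (simp add: * minus_one_power_iff)
    moreover have "x * y = (-1) ^ (p * q) * (y * x)"
      using commutative * unfolding graded_commutative_def by blast
    ultimately show ?thesis by (simp only:)
  qed auto
qed

sublocale B: graded_algebra scale RA
  by (rule graded_algebra_RA)

lemma dual_RA: "graded_dual scale RA (kap * q) = graded_dual scale A q"
proof -
  have "(\<forall>p. p \<noteq> kap * q \<longrightarrow> (\<forall>x\<in>RA p. f x = 0)) \<longleftrightarrow> (\<forall>r. r \<noteq> q \<longrightarrow> (\<forall>x\<in>A r. f x = 0))"
    if "Vector_Spaces.linear scale (*) f" for f :: "'a \<Rightarrow> rat"
    using RA_cases RA_mult(1) kap(1) linD(3)[OF that] by (metis mult_cancel1 not_gr_zero)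
  then show ?thesis unfolding graded_dual_def by blast
qed

lemma dual_RA_zero: assumes "f \<in> graded_dual scale RA p" "\<not> kap dvd p" shows "f = 0"
proof
  fix x
  note l = B.dualD(1)[OF assms(1)]
  show "f x = 0 x"
    unfolding fun_apply
  proof (rule lin_ext[OF l])
    show "Vector_Spaces.linear scale (*) (\<lambda>x. 0)" by (rule linI) simp_all
    fix n x assume "x \<in> A n"
    then show "f x = 0" using B.dualD(2)[OF assms(1), of x "kap * n"] RA_mult(1) assms(2)
      by (cases "kap * n = p") auto
  qed
qed

lemma L_tensors: "x \<in> B.L n \<Longrightarrow> x \<in> tensors"
proof (induction rule: B.L_induct)
  case (gen n f)
  show ?case
  proof (cases "kap dvd Suc n")
    case True
    then obtain q where q: "Suc n = kap * q" by (auto elim: dvdE)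
    then show ?thesis using gen gen_tensors[of f q] dual_RA[of q] by (cases "q = 0") auto
  next
    case False
    then show ?thesis
      using dual_RA_zero[OF gen] frat.subspace_0[OF tensors_subspace] by (simp add: gen_zero)
  qed
next
  case bracket then show ?case by (intro tensors_gr_bracket)
qed (auto intro: frat.subspace_0[OF tensors_subspace] frat.subspace_add[OF tensors_subspace]
    frat.subspace_scale[OF tensors_subspace])

lemma flinear_qD: "flinear B.qD"
  by (rule flinearI) (simp_all only: B.qD_add B.qD_scale)

lemma qm_letters: "x \<in> letters \<Longrightarrow> y \<in> letters \<Longrightarrow> B.qm x y = scale ((-1) ^ ldeg x) (x * y)"
proof -
  assume x: "x \<in> letters" and y: "y \<in> letters"
  have "x \<in> RA (kap * ldeg x)" "y \<in> RA (kap * ldeg y)" using RA_mult letters_A x y by auto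
  moreover have "kap * ldeg x \<noteq> 0" "kap * ldeg y \<noteq> 0" using kap letters_pos[OF x] letters_pos[OF y] by auto
  moreover have "(-1) ^ (kap * ldeg x) = ((-1) ^ ldeg x :: rat)" using kap(2) by (simp add: minus_one_power_iff)
  ultimately show ?thesis unfolding B.qm_def by (simp add: B.wt_hom scale_mult_left)
qed

lemma gen_coord_L: "b \<in> letters \<Longrightarrow> gen (coord b) \<in> B.L (kap * ldeg b - 1)"
  using kap letters_pos[of b] coord_dual[of b] by (intro B.L_gen) (simp add: dual_RA)

lemma res_qD_gen: assumes "b \<in> letters" shows "res (B.qD (gen (coord b))) = delta b"
proof
  fix w
  show "res (B.qD (gen (coord b))) w = delta b w"
    by (auto simp: res_def B.qD_gen delta_def qm_letters coord_simps split: list.splits)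
qed

text \<open>Both operators obey the same Leibniz rule and agree on generators; the degree
  \<open>kap * ldeg b - 1\<close> of a generator has the parity of
  \<open>ldeg b + 1\<close>.\<close>

lemma res_qD: assumes "x \<in> tensors" shows "res (B.qD x) = W.D (res x)"
proof (rule fpair.linear_eq_on[OF flinear_compose[OF flinear_res flinear_qD]
      flinear_compose[OF W.flinear_D flinear_res] assms[unfolded tensors_def]])
  fix x assume "x \<in> ew ` lists letters"
  then obtain w where w: "w \<in> lists letters" "x = ew w" by blast
  have "res (B.qD (ew w)) = W.D (word w)"
    using w(1)
  proof (induction w)
    case Nil
    have "B.qD (word []) = 0"
    proof
      have 1: "word [] = (\<lambda>u::'a list. if u = [] then 1 else 0)" by (auto simp: word_def)
      show "B.qD (word []) v = 0 v" for v unfolding 1 B.qD_def dexp_unit fun_apply ..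
    qed
    then show ?case by (simp add: res_linear W.D_word)
  next
    case (Cons b w)
    then have b: "b \<in> letters" and w: "w \<in> lists letters" by auto
    have "(-1) ^ (kap * ldeg b - 1) = ((-1) ^ (ldeg b + 1) :: rat)"
      using kap letters_pos[OF b] by (simp add: minus_one_power_iff)
    then have "B.qD (ew (b # w)) = tmul (B.qD (gen (coord b))) (ew w)
        + fscale ((-1) ^ (ldeg b + 1)) (tmul (gen (coord b)) (B.qD (ew w)))"
      using B.qD_tmul[OF gen_coord_L[OF b]] by simp
    then show ?case
      using Cons.IH W.D_letter_tmul[OF b W.T_word[OF w]]
      by (simp add: res_linear res_tmul res_qD_gen[OF b] res_gen_coord[OF b] res_ew[OF w] tmul_word)
  qed
  then show "res (B.qD x) = W.D (res x)" using w res_ew by simp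
qed

text \<open>A letter of weight d has degree \<open>kap * d - 1\<close> in the Quillen model, so
  bidegree (P, l) has total degree \<open>kap * P - l\<close>.\<close>

definition X :: "nat \<Rightarrow> ('a list \<Rightarrow> rat) set" where
  "X n = frat.span (\<Union>{W.lie P l | P l. kap * P = n + l})"

lemma X_subspace: "frat.subspace (X n)" by (simp add: X_def)

lemma lie_X: "y \<in> W.lie P l \<Longrightarrow> kap * P = n + l \<Longrightarrow> y \<in> X n"
  unfolding X_def by (rule frat.span_base) blast

lemma X_linear_mem:
  assumes "z \<in> X n" "flinear f" "frat.subspace Y" "\<And>P l y. y \<in> W.lie P l \<Longrightarrow> kap * P = n + l \<Longrightarrow> f y \<in> Y"
  shows "f z \<in> Y"
  by (rule span_linear_mem[OF assms(1)[unfolded X_def] assms(2,3)]) (use assms(4) in blast)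

lemma X_linear_eq:
  assumes "z \<in> X n" "flinear f" "flinear g" "\<And>P l y. y \<in> W.lie P l \<Longrightarrow> kap * P = n + l \<Longrightarrow> f y = g y"
  shows "f z = g z"
  by (rule fpair.linear_eq_on[OF assms(2,3) assms(1)[unfolded X_def]]) (use assms(4) in blast)

lemma res_L: "x \<in> B.L n \<Longrightarrow> res x \<in> X n"
proof (induction rule: B.L_induct)
  case (gen n f)
  show ?case
  proof (cases "kap dvd Suc n")
    case True
    then obtain q where q: "Suc n = kap * q" by (auto elim: dvdE)
    then have "f \<in> graded_dual scale A q" "q \<noteq> 0" using gen dual_RA by (auto intro: Nat.gr0I)
    then show ?thesis using res_gen(1) q by (intro lie_X[of _ q 1]) auto
  next
    case False
    then show ?thesis
      using dual_RA_zero[OF gen] frat.subspace_0[OF X_subspace] by (simp add: gen_zero res_linear)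
  qed
next
  case (bracket m n x y)
  show ?case
    unfolding res_gr_bracket
  proof (rule X_linear_mem[OF bracket.IH(1) gr_bracket_flinear(2) X_subspace])
    fix P l u assume u: "u \<in> W.lie P l" "kap * P = m + l"
    show "gr_bracket m n u (res y) \<in> X (m + n)"
    proof (rule X_linear_mem[OF bracket.IH(2) gr_bracket_flinear(1) X_subspace])
      fix Q l' v assume v: "v \<in> W.lie Q l'" "kap * Q = n + l'"
      have "even (m + (P + l))" "even (n + (Q + l'))" using kap_parity u(2) v(2) by blast+
      then have "gr_bracket m n = (gr_bracket (P + l) (Q + l') :: ('a list \<Rightarrow> rat) \<Rightarrow> _)"
        by (intro gr_bracket_parity) auto
      then show "gr_bracket m n u v \<in> X (m + n)"
        using W.lie_intros(5)[OF u(1) v(1)] u(2) v(2) by (simp add: lie_X distrib_left)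
    qed
  qed
qed (auto simp: res_linear intro: frat.subspace_0[OF X_subspace] frat.subspace_add[OF X_subspace]
    frat.subspace_scale[OF X_subspace])

text \<open>The alternative \<open>y = 0\<close> covers bidegrees with \<open>kap * P < l\<close>,
  which have no total degree.\<close>

lemma lie_L: "y \<in> W.lie P l \<Longrightarrow> y = 0 \<or> (\<exists>n x. kap * P = n + l \<and> x \<in> B.L n \<and> res x = y)"
proof (induction rule: W.lie_induct)
  case (letter i)
  then have "kap * ldeg i = (kap * ldeg i - 1) + 1" using kap letters_pos[OF letter] by simp
  then show ?case using gen_coord_L[OF letter] res_gen_coord[OF letter] by blast
next
  case (add P l x y)
  show ?case
  proof (cases "x = 0 \<or> y = 0")
    case True then show ?thesis using add.IH by auto
  next
    case False
    then obtain n x' m y' where x: "kap * P = n + l" "x' \<in> B.L n" "res x' = x"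
      and y: "kap * P = m + l" "y' \<in> B.L m" "res y' = y" using add.IH by blast
    have "m = n" using x(1) y(1) by simp
    then show ?thesis using B.L_closed(2)[of x' n y'] x y res_linear(1)[of x' y'] by blast
  qed
next
  case (scale P l c x)
  then show ?case using B.L_closed(3) res_linear(4) by (metis frat.scale_zero_right)
next
  case (bracket P l Q m x y)
  show ?case
  proof (cases "x = 0 \<or> y = 0")
    case True then show ?thesis by (auto simp: gr_bracket_def tmul_zero_left tmul_zero_right)
  next
    case False
    then obtain n x' n' y' where x: "kap * P = n + l" "x' \<in> B.L n" "res x' = x"
      and y: "kap * Q = n' + m" "y' \<in> B.L n'" "res y' = y" using bracket.IH by blast
    have "even (n + (P + l))" "even (n' + (Q + m))" using kap_parity x(1) y(1) by blast+
    then have "gr_bracket n n' = (gr_bracket (P + l) (Q + m) :: ('a list \<Rightarrow> rat) \<Rightarrow> _)"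
      by (intro gr_bracket_parity) auto
    then have "res (gr_bracket n n' x' y') = gr_bracket (P + l) (Q + m) x y"
      using x y by (simp add: res_gr_bracket)
    moreover have "gr_bracket n n' x' y' \<in> B.L (n + n')" using B.L_closed(4) x y by blast
    moreover have "kap * (P + Q) = (n + n') + (l + m)" using x(1) y(1) by (simp add: distrib_left)
    ultimately show ?thesis by blast
  qed
qed auto

lemma L_subspace: "frat.subspace (B.L n)"
  by (auto simp: frat.subspace_def intro: B.L_closed)

lemma res_L_eq: "res ` B.L n = X n"
proof
  interpret r: Vector_Spaces.linear fscale fscale res by (rule flinear_res)
  have "y \<in> res ` B.L n" if y: "y \<in> W.lie P l" "kap * P = n + l" for y P l
  proof (cases "y = 0")
    case True
    then show ?thesis using res_linear(5) B.L_closed(1) by (metis image_eqI)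
  next
    case False
    then show ?thesis using lie_L[OF y(1)] y(2) by auto
  qed
  then show "X n \<subseteq> res ` B.L n"
    unfolding X_def by (intro frat.span_minimal r.subspace_image L_subspace) blast
qed (use res_L in auto)

text \<open>\<open>quillen_d\<close> is an arbitrary choice, but its axioms fix it on the Lie
  algebra: every generator has some reduced coproduct, and additivity and the Leibniz rule determine
  the rest.\<close>

lemma quillen_d_eq: "x \<in> B.L n \<Longrightarrow> quillen_d scale RA x = B.qD x"
proof -
  let ?d = "quillen_d scale RA"
  note Q = B.quillen_differential_quillen_d[OF finite_type_RA graded_commutative_RA]
  note Q = Q[unfolded quillen_differential_def Let_def]
  have lin: "?d (x + y) = ?d x + ?d y \<and> ?d (fscale c x) = fscale c (?d x)" if "x \<in> B.L n" "y \<in> B.L n" for n x y c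
    using Q that by blast
  have br: "?d (gr_bracket m n x y) =
      gr_bracket (m - 1) n (?d x) y + fscale ((-1) ^ m) (gr_bracket m (n - 1) x (?d y))"
    if "x \<in> B.L m" "y \<in> B.L n" for m n x y
    using Q that by blast
  have ge: "?d (gen c) = fscale (1/2) (\<Sum>i<N. fscale ((-1) ^ p' i)
            (gr_bracket (p' i - 1) (p'' i - 1) (gen (c' i)) (gen (c'' i))))"
    if "1 \<le> p" "c \<in> graded_dual scale RA p" "reduced_coproduct scale RA c N p' c' p'' c''" for p c N p' c' p'' c''
    using Q that by blast
  assume "x \<in> B.L n"
  then show ?thesis
  proof (induction rule: B.L_induct)
    case (gen n f)
    obtain N p' c' p'' c'' where cop: "reduced_coproduct scale RA f N p' c' p'' c''"
      using B.coproduct_exists[OF finite_type_RA gen] by blast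
    show ?case
      using ge[OF _ gen cop] B.qD_gen_formula[OF graded_commutative_RA gen cop] by simp
  next
    case (zero n)
    then show ?case using lin[OF B.L_closed(1)[of n] B.L_closed(1)[of n], of 0] B.qD_zero by simp
  next
    case (add n x y)
    then show ?case using lin[OF add.hyps] by (simp only: B.qD_add)
  next
    case (scale n c x)
    then show ?case using lin[OF scale.hyps scale.hyps] by (simp only: B.qD_scale)
  next
    case (bracket m n x y)
    have "m = 0 \<Longrightarrow> B.qD x = 0" "n = 0 \<Longrightarrow> B.qD y = 0"
      using B.qD_L[OF finite_type_RA graded_commutative_RA] bracket.hyps by blast+
    then show ?case using br[OF bracket.hyps] B.qD_bracket[OF bracket.hyps] bracket.IH by simp
  qed
qed

lemma qD_tensors: assumes "x \<in> B.L n" shows "B.qD x \<in> tensors"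
  using B.qD_L[OF finite_type_RA graded_commutative_RA assms] L_tensors frat.subspace_0[OF tensors_subspace]
  by (cases n) auto

lemma sq_dim_quillen_homology:
  "sq_dim (quillen_homology scale RA n) = frat.dim {z \<in> X n. W.D z = 0} - frat.dim (W.D ` X (Suc n))"
proof -
  have "res ` {x \<in> B.L n. quillen_d scale RA x = 0} = {z \<in> X n. W.D z = 0}"
  proof -
    have "quillen_d scale RA x = 0 \<longleftrightarrow> W.D (res x) = 0" if x: "x \<in> B.L n" for x
    proof -
      have "B.qD x = 0 \<longleftrightarrow> res (B.qD x) = res 0"
        using res_inj[OF qD_tensors[OF x] frat.subspace_0[OF tensors_subspace]] by auto
      then show ?thesis using quillen_d_eq[OF x] res_qD[OF L_tensors[OF x]] by (simp add: res_linear)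
    qed
    then show ?thesis unfolding res_L_eq[symmetric] by blast
  qed
  moreover have "res ` (quillen_d scale RA ` B.L (Suc n)) = W.D ` X (Suc n)"
    unfolding res_L_eq[symmetric] image_image
    by (rule image_cong) (simp_all add: quillen_d_eq res_qD L_tensors)
  moreover have "{x \<in> B.L n. quillen_d scale RA x = 0} \<subseteq> tensors" using L_tensors by auto
  note dim_res[OF this]
  moreover have "quillen_d scale RA ` B.L (Suc n) \<subseteq> tensors" using qD_tensors quillen_d_eq by auto
  note dim_res[OF this]
  ultimately show ?thesis
    unfolding sq_dim_def quillen_homology_def fst_conv snd_conv by (simp only:)
qed

end

section \<open>Diagonal and off-diagonal parts of the rescaled homology\<close>

context rescaled begin

lemma lie_part: "y \<in> W.lie P m \<Longrightarrow> part l y = (if l = m then y else 0)"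
  by (rule W.part_T[OF W.lie_T])

lemma lie_eq_0: "y \<in> W.lie P l \<Longrightarrow> P < l \<Longrightarrow> y = 0"
  by (rule W.T_gt_zero[OF W.lie_T])

text \<open>In total degree n the length l determines the weight by \<open>kap * P = n + l\<close>,
  so selecting a length selects a bidegree.\<close>

lemma part_X:
  assumes "z \<in> X n"
  shows "kap * P = n + l \<Longrightarrow> part l z \<in> W.lie P l"
    "\<not> kap dvd (n + l) \<Longrightarrow> part l z = 0"
proof -
  show "part l z \<in> W.lie P l" if P: "kap * P = n + l"
  proof (rule X_linear_mem[OF assms flinear_part W.lie_subspace])
    fix Q m y assume y: "y \<in> W.lie Q m" "kap * Q = n + m"
    show "part l y \<in> W.lie P l"
    proof (cases "l = m")
      case True
      then have "kap * P = kap * Q" using P y(2) by simp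
      then have "P = Q" using kap(1) by simp
      then show ?thesis using y(1) True by (simp add: lie_part[OF y(1)])
    qed (simp add: lie_part[OF y(1)] W.lie_intros)
  qed
  show "part l z = 0" if "\<not> kap dvd (n + l)"
  proof (rule X_linear_eq[OF assms flinear_part])
    fix Q m y assume y: "y \<in> W.lie Q m" "kap * Q = n + m"
    then show "part l y = 0" using that by (auto simp: lie_part[OF y(1)] simp flip: y(2))
  qed (rule flinear_zero)
qed

text \<open>From l \<le> P one gets 2kP \<le> n. This bound makes \<open>X n\<close>
  finite-dimensional.\<close>

lemma length_bound: assumes "kap * P = n + l" "l \<le> P" shows "P \<le> n"
proof -
  have "2 * k * P + P = n + l" using assms(1) by (simp add: kap_def algebra_simps)
  moreover have "P \<le> 2 * k * P" using k by simp
  ultimately show ?thesis using assms(2) by linarith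
qed

lemma part_sum: assumes "z \<in> X n" shows "z = (\<Sum>l\<le>n. part l z)"
proof (rule X_linear_eq[OF assms flinear_id])
  show "flinear (\<lambda>z. \<Sum>l\<le>n. part l z)"
    by (rule flinearI) (simp_all add: flinearD[OF flinear_part] sum.distrib frat.scale_sum_right)
  fix P l y assume y: "y \<in> W.lie P l" "kap * P = n + l"
  show "y = (\<Sum>l\<le>n. part l y)"
  proof (cases "y = 0")
    case True then show ?thesis by (simp add: flinearD[OF flinear_part])
  next
    case False
    then have "l \<le> P" using lie_eq_0[OF y(1)] by (meson not_le)
    then have "l \<le> n" using length_bound[OF y(2)] by simp
    then show ?thesis by (simp add: lie_part[OF y(1)])
  qed
qed

lemma D_part: assumes "z \<in> X n" shows "W.D (part l z) = part (Suc l) (W.D z)"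
proof (rule X_linear_eq[OF assms])
  fix P m y assume y: "y \<in> W.lie P m"
  show "W.D (part l y) = part (Suc l) (W.D y)"
    using lie_part[OF y] lie_part[OF W.D_lie[OF y]] by (simp add: W.D_linear)
qed (intro flinear_compose[OF W.flinear_D flinear_part] flinear_compose[OF flinear_part W.flinear_D])+

lemma D_X: assumes "z \<in> X (Suc n)" shows "W.D z \<in> X n"
  by (rule X_linear_mem[OF assms W.flinear_D X_subspace]) (rule lie_X[OF W.D_lie], auto)

lemma X_finite: "X n \<subseteq> frat.span (word ` (\<Union>P\<le>n. W.words P))"
  unfolding X_def
proof (intro frat.span_minimal frat.subspace_span, rule subsetI)
  fix y assume "y \<in> \<Union>{W.lie P l | P l. kap * P = n + l}"
  then obtain P l where y: "y \<in> W.lie P l" "kap * P = n + l" by blast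
  show "y \<in> frat.span (word ` (\<Union>P\<le>n. W.words P))"
  proof (cases "y = 0")
    case True then show ?thesis by (simp add: frat.span_zero)
  next
    case False
    then have "l \<le> P" using lie_eq_0[OF y(1)] by (meson not_le)
    then have "P \<le> n" by (rule length_bound[OF y(2)])
    then have "word ` {w \<in> W.words P. length w = l} \<subseteq> word ` (\<Union>P\<le>n. W.words P)" by blast
    then show ?thesis using W.lie_T[OF y(1)] frat.span_mono unfolding W.T_eq_span by blast
  qed
qed

lemma finite_bound: "finite (word ` (\<Union>P\<le>n. W.words P))"
  using W.finite_words by auto

text \<open>The projection onto the bidegree of the diagonal that has total degree \<open>n\<close>, if there is one.\<close>

definition dproj :: "nat \<Rightarrow> ('a list \<Rightarrow> rat) \<Rightarrow> 'a list \<Rightarrow> rat" where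
  "dproj n = (if (2 * k) dvd n then part (n div (2 * k)) else (\<lambda>_. 0))"

lemma flinear_dproj: "flinear (dproj n)"
  by (simp add: dproj_def flinear_part flinear_zero)

lemma dproj_diagonal: "dproj (2 * k * w) = part w"
  using k by (simp add: dproj_def)

lemma dproj_cases:
  obtains w where "n = 2 * k * w" "dproj n = part w" | "\<not> (2 * k) dvd n" "dproj n = (\<lambda>_. 0)"
proof (cases "(2 * k) dvd n")
  case True
  then obtain w where "n = 2 * k * w" by (auto elim: dvdE)
  then show ?thesis using that dproj_diagonal by blast
qed (use that in \<open>simp add: dproj_def\<close>)

definition Z0 where "Z0 n = {z \<in> X n. W.D z = 0}"
definition B0 where "B0 n = W.D ` X (Suc n)"
definition offZ where "offZ n = {z \<in> Z0 n. dproj n z = 0}"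
definition offB where "offB n = {z \<in> B0 n. dproj n z = 0}"

lemma Z0_subspace: "frat.subspace (Z0 n)"
  using frat.subspace_0[OF X_subspace] frat.subspace_add[OF X_subspace] frat.subspace_scale[OF X_subspace]
  by (auto simp: frat.subspace_def Z0_def W.D_linear)

lemma B0_subspace: "frat.subspace (B0 n)"
proof -
  interpret D: Vector_Spaces.linear fscale fscale W.D by (rule W.flinear_D)
  show ?thesis unfolding B0_def by (rule D.subspace_image[OF X_subspace])
qed

lemma off_subspace: "frat.subspace (offZ n)" "frat.subspace (offB n)"
  using frat.subspace_0[OF Z0_subspace] frat.subspace_add[OF Z0_subspace] frat.subspace_scale[OF Z0_subspace]
    frat.subspace_0[OF B0_subspace] frat.subspace_add[OF B0_subspace] frat.subspace_scale[OF B0_subspace]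
  by (auto simp: frat.subspace_def offZ_def offB_def flinearD[OF flinear_dproj])

lemma X_D_D: assumes "z \<in> X n" shows "W.D (W.D z) = 0"
  by (rule X_linear_eq[OF assms flinear_compose[OF W.flinear_D W.flinear_D] flinear_zero])
    (rule W.D_D[OF W.lie_T])

lemma B0_Z0: "B0 n \<subseteq> Z0 n"
  using D_X X_D_D by (auto simp: B0_def Z0_def)

lemma Z0_X: "Z0 n \<subseteq> X n" by (auto simp: Z0_def)

lemma kap_diag: "kap * w = 2 * k * w + w" by (simp add: kap_def)

text \<open>Everything in bidegree (w, w) is a cycle, so the diagonal part of the cycles is all of
  it.\<close>

lemma dproj_Z0: "dproj n ` Z0 n = (if (2 * k) dvd n then W.lie (n div (2 * k)) (n div (2 * k)) else {0})"
proof (cases n rule: dproj_cases)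
  case (1 w)
  have w: "n div (2 * k) = w" "(2 * k) dvd n" using 1(1) k by simp_all
  have "part w ` Z0 n = W.lie w w"
  proof
    show "part w ` Z0 n \<subseteq> W.lie w w"
      using part_X(1)[of _ n w w] kap_diag[of w] by (auto simp: Z0_def 1(1))
    have "z \<in> part w ` Z0 n" if z: "z \<in> W.lie w w" for z
    proof -
      have "z \<in> Z0 n" using lie_X[OF z, of n] D_diagonal[OF z] by (simp add: Z0_def 1(1) kap_diag)
      moreover have "z = part w z" by (simp add: lie_part[OF z])
      ultimately show ?thesis by blast
    qed
    then show "W.lie w w \<subseteq> part w ` Z0 n" by blast
  qed
  then show ?thesis using w 1(2) by simp
next
  case 2
  then show ?thesis using frat.subspace_0[OF Z0_subspace] by auto
qed

text \<open>Lowering the length by one raises the total degree by one, so the diagonal boundaries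
  come from (w, w - 1). For w = 0 the truncated subtraction is harmless: both sides are
  zero.\<close>

lemma dproj_B0:
  "dproj n ` B0 n = (if (2 * k) dvd n then W.D ` W.lie (n div (2 * k)) (n div (2 * k) - 1) else {0})"
proof (cases n rule: dproj_cases)
  case (1 w)
  have w: "n div (2 * k) = w" "(2 * k) dvd n" using 1(1) k by simp_all
  have "part w ` B0 n = W.D ` W.lie w (w - 1)"
  proof (cases w)
    case 0
    have "W.lie 0 0 = {0}" using W.lie_0 W.lie_intros(2)[of 0 0] by blast
    then have "W.D ` W.lie w (w - 1) = {0}" by (simp add: 0 W.D_linear)
    moreover have "part w z = 0" if "z \<in> B0 n" for z
    proof -
      have "part w z \<in> W.lie 0 0"
        using part_X(1)[of z n 0 0] that B0_Z0 Z0_X 1(1) by (auto simp: 0)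
      then show ?thesis by (rule W.lie_0)
    qed
    ultimately show ?thesis using frat.subspace_0[OF B0_subspace] by (auto simp: image_iff)
  next
    case (Suc w')
    have e: "kap * w = Suc n + w'" using kap_diag[of w] by (simp add: 1(1) Suc)
    show ?thesis
    proof
      show "part w ` B0 n \<subseteq> W.D ` W.lie w (w - 1)"
        using D_part[of _ "Suc n" w'] part_X(1)[OF _ e] by (auto simp: B0_def Suc simp flip: D_part)
      have "W.D y \<in> part w ` B0 n" if y: "y \<in> W.lie w w'" for y
      proof -
        have "W.D y = part w (W.D y)" using lie_part[OF W.D_lie[OF y], of w] Suc by simp
        then show ?thesis using lie_X[OF y e] by (auto simp: B0_def)
      qed
      then show "W.D ` W.lie w (w - 1) \<subseteq> part w ` B0 n" by (auto simp: Suc)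
    qed
  qed
  then show ?thesis using w 1(2) by simp
next
  case 2
  then show ?thesis using frat.subspace_0[OF B0_subspace] by auto
qed

lemma dproj_sub: "dproj n ` Z0 n \<subseteq> Z0 n" "dproj n ` B0 n \<subseteq> B0 n"
proof -
  show "dproj n ` Z0 n \<subseteq> Z0 n"
  proof (cases n rule: dproj_cases)
    case (1 w)
    have w: "n div (2 * k) = w" using 1(1) k by simp
    have "z \<in> Z0 n" if z: "z \<in> W.lie w w" for z
      using lie_X[OF z, of n] D_diagonal[OF z] by (simp add: Z0_def 1(1) kap_diag)
    then show ?thesis unfolding dproj_Z0 w using frat.subspace_0[OF Z0_subspace] by auto
  next
    case 2 then show ?thesis using frat.subspace_0[OF Z0_subspace] by auto
  qed
  show "dproj n ` B0 n \<subseteq> B0 n"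
  proof (cases n rule: dproj_cases)
    case (1 w)
    have w: "n div (2 * k) = w" using 1(1) k by simp
    have "W.D y \<in> B0 n" if y: "y \<in> W.lie w (w - 1)" for y
    proof (cases w)
      case 0
      then have "y = 0" using y W.lie_0 by simp
      then show ?thesis using frat.subspace_0[OF B0_subspace] by (simp add: W.D_linear)
    next
      case (Suc w')
      then have "kap * w = Suc n + (w - 1)" using kap_diag[of w] by (simp add: 1(1))
      then show ?thesis using lie_X[OF y] by (auto simp: B0_def)
    qed
    then show ?thesis unfolding dproj_B0 w using frat.subspace_0[OF B0_subspace] by auto
  next
    case 2 then show ?thesis using frat.subspace_0[OF B0_subspace] by auto
  qed
qed

lemma dproj_dproj: "dproj n (dproj n z) = dproj n z"
  by (auto simp: dproj_def part_def)

lemma dim_Z0: "frat.dim (Z0 n) = frat.dim (dproj n ` Z0 n) + frat.dim (offZ n)"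
  unfolding offZ_def using dproj_sub(1) X_finite Z0_X
  by (intro dim_projection[OF Z0_subspace _ finite_bound[of n] flinear_dproj] dproj_dproj) blast+

lemma dim_B0: "frat.dim (B0 n) = frat.dim (dproj n ` B0 n) + frat.dim (offB n)"
  unfolding offB_def using dproj_sub(2) X_finite Z0_X B0_Z0
  by (intro dim_projection[OF B0_subspace _ finite_bound[of n] flinear_dproj] dproj_dproj) blast+

lemma sq_dim_holonomy:
  "sq_dim (rescale_lie k (holonomy scale A) n) = frat.dim (dproj n ` Z0 n) - frat.dim (dproj n ` B0 n)"
proof (cases "(2 * k) dvd n")
  case True
  let ?w = "n div (2 * k)"
  have "frat.dim (free_lie V1 ?w) = frat.dim (W.lie ?w ?w)"
    using dim_res[of "free_lie V1 ?w", unfolded res_free_lie] free_lie_res[of _ ?w] by (metis subsetI)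
  moreover have "frat.dim (ideal1 ?w) = frat.dim (W.D ` W.lie ?w (?w - 1))"
  proof -
    have "ideal1 ?w \<subseteq> tensors" using ideal_res by blast
    from dim_res[OF this, unfolded res_ideal] show ?thesis by (rule sym)
  qed
  ultimately show ?thesis
    using True by (simp add: sq_dim_def rescale_lie_def holonomy_def dproj_Z0 dproj_B0)
qed (simp add: sq_dim_def rescale_lie_def dproj_Z0 dproj_B0)

text \<open>Cycles and boundaries split along \<open>dproj\<close>, and the diagonal contributions
  are those of the holonomy Lie algebra. As boundaries are cycles in both parts, no truncation
  occurs in the subtractions, and equality means that the off-diagonal dimensions agree.\<close>

lemma sq_dim_eq_iff:
  "sq_dim (quillen_homology scale RA n) = sq_dim (rescale_lie k (holonomy scale A) n) \<longleftrightarrow> offZ n \<subseteq> offB n"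
proof -
  have sub: "offB n \<subseteq> offZ n" using B0_Z0 by (auto simp: offB_def offZ_def)
  have fin: "offZ n \<subseteq> frat.span (word ` (\<Union>P\<le>n. W.words P))"
    using Z0_X X_finite by (auto simp: offZ_def)
  have "dproj n ` Z0 n \<subseteq> frat.span (word ` (\<Union>P\<le>n. W.words P))"
    using dproj_sub(1) Z0_X X_finite by blast
  then have 1: "frat.dim (dproj n ` B0 n) \<le> frat.dim (dproj n ` Z0 n)"
    by (rule dim_mono_finite[OF image_mono[OF B0_Z0] _ finite_bound])
  have 2: "frat.dim (offB n) \<le> frat.dim (offZ n)"
    by (rule dim_mono_finite[OF sub fin finite_bound])
  have "sq_dim (quillen_homology scale RA n) = sq_dim (rescale_lie k (holonomy scale A) n) \<longleftrightarrow>
      frat.dim (offB n) = frat.dim (offZ n)"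
    unfolding sq_dim_holonomy sq_dim_quillen_homology Z0_def[symmetric] B0_def[symmetric] dim_Z0 dim_B0
    using 1 2 by linarith
  also have "\<dots> \<longleftrightarrow> offZ n \<subseteq> offB n"
    using subspace_eq_if_dim_eq[OF off_subspace(2) sub fin finite_bound] sub by auto
  finally show ?thesis .
qed

text \<open>The off-diagonal part of total degree n is the sum of its bidegrees (P, l) with P
  \<noteq> l, and D respects this decomposition.\<close>

lemma off_iff_exact: "(\<forall>n. offZ n \<subseteq> offB n) \<longleftrightarrow> (\<forall>P l. P \<noteq> l \<longrightarrow> W.exact_at W.lie P l)"
proof (intro iffI allI impI)
  fix P l :: nat assume off: "\<forall>n. offZ n \<subseteq> offB n" and Pl: "P \<noteq> l"
  show "W.exact_at W.lie P l"
    unfolding W.exact_at_def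
  proof (intro ballI impI)
    fix z assume z: "z \<in> W.lie P l" "W.D z = 0"
    show "\<exists>y\<in>W.lie P (l - 1). W.D y = z"
    proof (cases "z = 0")
      case True
      then show ?thesis using W.lie_intros(2) W.D_linear(5) by blast
    next
      case False
      then have l: "l \<le> P" "l \<noteq> 0" using lie_eq_0[OF z(1)] W.lie_0 z(1) by (meson not_le, metis)
      \<comment> \<open>This is \<open>kap * P - l\<close>, written so that the truncated
        subtraction is covered by l \<le> P.\<close>
      define n where "n = 2 * k * P + (P - l)"
      have n: "kap * P = n + l" using l(1) by (simp add: n_def kap_def)
      have "dproj n z = 0"
      proof (cases n rule: dproj_cases)
        case (1 w)
        have "w \<noteq> l"
        proof
          assume "w = l"
          then have "kap * P = kap * l" using n 1(1) by (simp add: kap_diag)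
          then show False using Pl kap(1) by simp
        qed
        then show ?thesis by (simp add: 1(2) lie_part[OF z(1)])
      qed simp
      then have "z \<in> offB n" using off lie_X[OF z(1) n] z(2) by (auto simp: offZ_def Z0_def)
      then obtain y where y: "y \<in> X (Suc n)" "W.D y = z" by (auto simp: offB_def B0_def)
      have "W.D (part (l - 1) y) = z"
        using D_part[OF y(1), of "l - 1"] l(2) y(2) by (simp add: lie_part[OF z(1)])
      moreover have "part (l - 1) y \<in> W.lie P (l - 1)"
        by (rule part_X(1)[OF y(1)]) (use n l(2) in simp)
      ultimately show ?thesis by blast
    qed
  qed
next
  fix n :: nat assume exact: "\<forall>P l. P \<noteq> l \<longrightarrow> W.exact_at W.lie P l"
  show "offZ n \<subseteq> offB n"
  proof
    fix z assume "z \<in> offZ n"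
    then have z: "z \<in> X n" "W.D z = 0" "dproj n z = 0" by (auto simp: offZ_def Z0_def)
    have "part l z \<in> B0 n" for l
    proof (cases "part l z = 0")
      case True then show ?thesis using frat.subspace_0[OF B0_subspace] by simp
    next
      case False
      then obtain P where P: "n + l = kap * P" using part_X(2)[OF z(1)] by (auto elim: dvdE)
      have pz: "part l z \<in> W.lie P l" by (rule part_X(1)[OF z(1) P[symmetric]])
      have "P \<noteq> l"
      proof
        assume "P = l"
        then have "n = 2 * k * l" using P by (simp add: kap_diag)
        then show False using z(3) False dproj_diagonal[of l] by simp
      qed
      moreover have "W.D (part l z) = 0"
        using D_part[OF z(1)] z(2) by (simp add: flinearD[OF flinear_part])
      ultimately obtain y where y: "y \<in> W.lie P (l - 1)" "W.D y = part l z"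
        using exact pz unfolding W.exact_at_def by blast
      have "l \<noteq> 0" using pz W.lie_0 False by metis
      then have "y \<in> X (Suc n)" using P by (intro lie_X[OF y(1)]) simp
      then show ?thesis unfolding B0_def y(2)[symmetric] by (rule imageI)
    qed
    then have "(\<Sum>l\<le>n. part l z) \<in> B0 n" by (intro frat.subspace_sum[OF B0_subspace])
    then show "z \<in> offB n" using part_sum[OF z(1)] z(3) by (simp add: offB_def)
  qed
qed

lemma koszul_iff_hilb:
  "koszul scale A \<longleftrightarrow> hilb (quillen_homology scale RA) = hilb (rescale_lie k (holonomy scale A))"
proof -
  have "hilb (quillen_homology scale RA) = hilb (rescale_lie k (holonomy scale A)) \<longleftrightarrow> (\<forall>n. offZ n \<subseteq> offB n)"
    by (simp add: fps_eq_iff hilb_def sq_dim_eq_iff)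
  then show ?thesis
    unfolding koszul_iff_exact_T off_iff_exact W.exact_lie_iff_exact_T by blast
qed

end

theorem corollary3p4:
  fixes scale :: "rat \<Rightarrow> 'a::ring_1 \<Rightarrow> 'a"
    and A :: "nat \<Rightarrow> 'a set"
    and k :: nat
  assumes "graded_algebra scale A"
    and "finite_type scale A"
    and "connected_algebra scale A"
    and "graded_commutative A"
    and "k > 0"
  shows "koszul scale A \<longleftrightarrow>
    hilb (quillen_homology scale (rescale_algebra k A)) =
    hilb (rescale_lie k (holonomy scale A))"
proof -
  interpret graded_algebra scale A by fact
  interpret rescaled scale A k by unfold_locales fact+
  show ?thesis by (rule koszul_iff_hilb)
qed

end
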